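(* The following algorithm solves in time $O(n^3)$ the task FindMinCostSep in the case of $I$-minimality: given an ancestral graph $G=(V,E)$ with $n$ nodes, pairwise disjoint sets $X,Y,R\subseteq V$ with $X,Y$ non-empty, a set $I\subseteq R$, and a cost function $w$ on $V$ that is positive real on $R$ and satisfies $w(U)=\infty$ for $U\notin R$, output an $I$-minimum $m$-separator $Z$ relative to $(X,Y)$ with $I\subseteq Z\subseteq R$, or $\bot$ if no such set exists. Algorithm FindMinCostSep$(G,X,Y,I,R,w)$: 1. Let $G'=G_{Ant(X\cup Y\cup I)}$ and $G'^a=(G_{Ant(X\cup Y\cup I)})^a$. 2. Add a node $X^m$ connected to all nodes in $X$, and a node $Y^m$ connected to all nodes in $Y$. 3. Assign infinite cost to all nodes in $X\cup Y\cup(V\setminus R)$ and cost $w(v)$ to every other node $v$. 4. Remove all nodes of $I$ from $G'^a$. 5. Return a minimum vertex cut $Z$ separating $X^m$ and $Y^m$ in the undirected graph.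
   Context: A mixed graph has directed ($A\to B$), undirected ($A-B$) and bidirected ($A\leftrightarrow B$) edges. A path is a sequence of distinct nodes with consecutive nodes adjacent. $U$ is an ancestor of $W$ if there is a directed path $U\to\cdots\to W$; $U$ is an anterior of $W$ if there is a path from $U$ to $W$ that becomes directed after replacing each undirected edge $S-T$ on it (traversed from $S$ to $T$) by $S\to T$. Every node is its own ancestor and anterior; $An(S)$, $Ant(S)$ are the ancestor and anterior sets of $S$. A mixed graph is an ancestral graph if (1) for each edge $A\gets B$ or $A\leftrightarrow B$, $A$ is not an anterior of $B$, and (2) for each edge $A-B$ there are no edges $A\gets C$, $A\leftrightarrow C$, $B\gets C$ or $B\leftrightarrow C$. A node on a path is a collider if two arrowheads of the path meet at it. Nodes $U,W$ are $m$-connected by $Z$ if there is a path between them on which every collider is in $An(Z)$ and every non-collider is not in $Z$; otherwise $Z$ $m$-separates them. $Z$ $m$-separates sets $X,Y$ (is an $m$-separator relative to $(X,Y)$) if it $m$-separates every $U\in X$ from every $W\in Y$. An $m$-separator $Z$ relative to $(X,Y)$ is $I$-minimum according to $w$ if $I\subseteq Z$ and there is no $m$-separator $Z'$ relative to $(X,Y)$ with $I\subseteq Z'$ and $\sum_{U\in Z'}w(U)<\sum_{U\in Z}w(U)$. $G_S$ denotes the induced subgraph on $S$. The augmented graph $(H)^a$ of an ancestral graph $H$ is the undirected graph on the same nodes whose edges are all pairs of nodes joined in $H$ by a path all of whose non-endpoint nodes are colliders (in particular all adjacent pairs). A vertex cut separating two nodes is a set of other nodes meeting every path between them; it is minimum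 if its total cost is smallest.
   Formalization: Step 5 as written returns a cut of a graph without the nodes of I, so it cannot contain I; here the algorithm returns the minimum vertex cut together with I, and ⊥ exactly when the minimum cut has infinite cost. *)

theory Defs
  imports Complex_Main "HOL-Library.Extended_Real" "HOL-Library.Landau_Symbols"
begin

text \<open>\<open>(a, b) \<in> dir G\<close> is the edge \<open>a \<rightarrow> b\<close>; \<open>und G\<close> and \<open>bid G\<close> are symmetric relations.\<close>

record 'v mgraph =
  nodes :: "'v set"
  dir :: "('v \<times> 'v) set"
  und :: "('v \<times> 'v) set"
  bid :: "('v \<times> 'v) set"

definition mixed_graph :: "'v mgraph \<Rightarrow> bool" where
  "mixed_graph G \<longleftrightarrow> finite (nodes G) \<and>
     dir G \<subseteq> nodes G \<times> nodes G \<and> und G \<subseteq> nodes G \<times> nodes G \<and> bid G \<subseteq> nodes G \<times> nodes G \<and>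
     sym (und G) \<and> sym (bid G) \<and> irrefl (dir G) \<and> irrefl (und G) \<and> irrefl (bid G)"

definition adjacent :: "'v mgraph \<Rightarrow> 'v \<Rightarrow> 'v \<Rightarrow> bool" where
  "adjacent G a b \<longleftrightarrow> (a, b) \<in> dir G \<or> (b, a) \<in> dir G \<or> (a, b) \<in> und G \<or> (a, b) \<in> bid G"

definition path :: "'v mgraph \<Rightarrow> 'v \<Rightarrow> 'v list \<Rightarrow> 'v \<Rightarrow> bool" where
  "path G u p w \<longleftrightarrow> p \<noteq> [] \<and> hd p = u \<and> last p = w \<and> distinct p \<and> set p \<subseteq> nodes G \<and>
     successively (adjacent G) p"

definition ancestor :: "'v mgraph \<Rightarrow> 'v \<Rightarrow> 'v \<Rightarrow> bool" where
  "ancestor G u w \<longleftrightarrow> (\<exists>p. path G u p w \<and> successively (\<lambda>a b. (a, b) \<in> dir G) p)"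

definition anterior :: "'v mgraph \<Rightarrow> 'v \<Rightarrow> 'v \<Rightarrow> bool" where
  "anterior G u w \<longleftrightarrow>
     (\<exists>p. path G u p w \<and> successively (\<lambda>a b. (a, b) \<in> dir G \<or> (a, b) \<in> und G) p)"

definition An :: "'v mgraph \<Rightarrow> 'v set \<Rightarrow> 'v set" where
  "An G S = {u. \<exists>w\<in>S. ancestor G u w}"

definition Ant :: "'v mgraph \<Rightarrow> 'v set \<Rightarrow> 'v set" where
  "Ant G S = {u. \<exists>w\<in>S. anterior G u w}"

definition arrowhead :: "'v mgraph \<Rightarrow> 'v \<Rightarrow> 'v \<Rightarrow> bool" where
  "arrowhead G a b \<longleftrightarrow> (a, b) \<in> dir G \<or> (a, b) \<in> bid G"

definition ancestral_graph :: "'v mgraph \<Rightarrow> bool" where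
  "ancestral_graph G \<longleftrightarrow> mixed_graph G \<and>
     (\<forall>a b. arrowhead G b a \<longrightarrow> \<not> anterior G a b) \<and>
     (\<forall>a b. (a, b) \<in> und G \<longrightarrow> \<not> (\<exists>c. arrowhead G c a \<or> arrowhead G c b))"

text \<open>A path is given by its node sequence. This determines its edges, because an ancestral graph
  has at most one edge between any two nodes.\<close>

definition collider :: "'v mgraph \<Rightarrow> 'v list \<Rightarrow> nat \<Rightarrow> bool" where
  "collider G p i \<longleftrightarrow> 0 < i \<and> Suc i < length p \<and>
     arrowhead G (p ! (i - 1)) (p ! i) \<and> arrowhead G (p ! Suc i) (p ! i)"

text \<open>The endpoints of a path count as non-colliders.\<close>

definition m_connected :: "'v mgraph \<Rightarrow> 'v set \<Rightarrow> 'v \<Rightarrow> 'v \<Rightarrow> bool" where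
  "m_connected G Z u w \<longleftrightarrow> (\<exists>p. path G u p w \<and>
     (\<forall>i<length p. if collider G p i then p ! i \<in> An G Z else p ! i \<notin> Z))"

definition m_separator :: "'v mgraph \<Rightarrow> 'v set \<Rightarrow> 'v set \<Rightarrow> 'v set \<Rightarrow> bool" where
  "m_separator G X Y Z \<longleftrightarrow> Z \<subseteq> nodes G \<and> (\<forall>u\<in>X. \<forall>w\<in>Y. \<not> m_connected G Z u w)"

definition I_minimum ::
  "'v mgraph \<Rightarrow> 'v set \<Rightarrow> 'v set \<Rightarrow> 'v set \<Rightarrow> ('v \<Rightarrow> ereal) \<Rightarrow> 'v set \<Rightarrow> bool" where
  "I_minimum G X Y I w Z \<longleftrightarrow> m_separator G X Y Z \<and> I \<subseteq> Z \<and>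
     \<not> (\<exists>Z'. m_separator G X Y Z' \<and> I \<subseteq> Z' \<and> sum w Z' < sum w Z)"

definition sep_input ::
  "'v mgraph \<Rightarrow> 'v set \<Rightarrow> 'v set \<Rightarrow> 'v set \<Rightarrow> 'v set \<Rightarrow> ('v \<Rightarrow> ereal) \<Rightarrow> bool" where
  "sep_input G X Y I R w \<longleftrightarrow> ancestral_graph G \<and>
     X \<subseteq> nodes G \<and> Y \<subseteq> nodes G \<and> R \<subseteq> nodes G \<and>
     X \<inter> Y = {} \<and> X \<inter> R = {} \<and> Y \<inter> R = {} \<and> X \<noteq> {} \<and> Y \<noteq> {} \<and> I \<subseteq> R \<and>
     (\<forall>u\<in>R. 0 < w u \<and> w u < \<infinity>) \<and> (\<forall>u\<in>nodes G - R. w u = \<infinity>)"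

text \<open>The result \<open>None\<close> is the answer \<open>\<bottom>\<close>.\<close>

definition solves_min_cost_sep ::
  "'v mgraph \<Rightarrow> 'v set \<Rightarrow> 'v set \<Rightarrow> 'v set \<Rightarrow> 'v set \<Rightarrow> ('v \<Rightarrow> ereal) \<Rightarrow> 'v set option \<Rightarrow> bool" where
  "solves_min_cost_sep G X Y I R w res \<longleftrightarrow> (case res of
       Some Z \<Rightarrow> I_minimum G X Y I w Z \<and> I \<subseteq> Z \<and> Z \<subseteq> R
     | None \<Rightarrow> \<not> (\<exists>Z. I_minimum G X Y I w Z \<and> I \<subseteq> Z \<and> Z \<subseteq> R))"

record 'a ugraph =
  unodes :: "'a set"
  uedges :: "('a \<times> 'a) set"

definition upath :: "'a ugraph \<Rightarrow> 'a \<Rightarrow> 'a list \<Rightarrow> 'a \<Rightarrow> bool" where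
  "upath H u p w \<longleftrightarrow> p \<noteq> [] \<and> hd p = u \<and> last p = w \<and> distinct p \<and> set p \<subseteq> unodes H \<and>
     successively (\<lambda>a b. (a, b) \<in> uedges H) p"

definition vertex_cut :: "'a ugraph \<Rightarrow> 'a \<Rightarrow> 'a \<Rightarrow> 'a set \<Rightarrow> bool" where
  "vertex_cut H u w C \<longleftrightarrow> C \<subseteq> unodes H - {u, w} \<and> (\<forall>p. upath H u p w \<longrightarrow> set p \<inter> C \<noteq> {})"

definition min_vertex_cut :: "'a ugraph \<Rightarrow> ('a \<Rightarrow> ereal) \<Rightarrow> 'a \<Rightarrow> 'a \<Rightarrow> 'a set \<Rightarrow> bool" where
  "min_vertex_cut H c u w C \<longleftrightarrow> vertex_cut H u w C \<and>
     (\<forall>C'. vertex_cut H u w C' \<longrightarrow> sum c C \<le> sum c C')"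

definition induced :: "'v mgraph \<Rightarrow> 'v set \<Rightarrow> 'v mgraph" where
  "induced G S = \<lparr>nodes = nodes G \<inter> S, dir = dir G \<inter> S \<times> S, und = und G \<inter> S \<times> S,
     bid = bid G \<inter> S \<times> S\<rparr>"

definition augmented :: "'v mgraph \<Rightarrow> 'v ugraph" where
  "augmented H = \<lparr>unodes = nodes H,
     uedges = {(u, w). u \<noteq> w \<and> (\<exists>p. path H u p w \<and>
       (\<forall>i. 0 < i \<and> Suc i < length p \<longrightarrow> collider H p i))}\<rparr>"

datatype 'v ext = Node 'v | Xm | Ym

definition step1 :: "'v mgraph \<Rightarrow> 'v set \<Rightarrow> 'v set \<Rightarrow> 'v set \<Rightarrow> 'v ugraph" where
  "step1 G X Y I = augmented (induced G (Ant G (X \<union> Y \<union> I)))"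

definition step2 :: "'v set \<Rightarrow> 'v set \<Rightarrow> 'v ugraph \<Rightarrow> 'v ext ugraph" where
  "step2 X Y H = \<lparr>unodes = Node ` unodes H \<union> {Xm, Ym},
     uedges = {(Node a, Node b) | a b. (a, b) \<in> uedges H} \<union>
       {(Xm, Node x) | x. x \<in> X} \<union> {(Node x, Xm) | x. x \<in> X} \<union>
       {(Ym, Node y) | y. y \<in> Y} \<union> {(Node y, Ym) | y. y \<in> Y}\<rparr>"

text \<open>The costs of \<open>Xm\<close> and \<open>Ym\<close> are irrelevant, since a vertex cut contains neither.\<close>

definition step3 ::
  "'v mgraph \<Rightarrow> 'v set \<Rightarrow> 'v set \<Rightarrow> 'v set \<Rightarrow> ('v \<Rightarrow> ereal) \<Rightarrow> 'v ext \<Rightarrow> ereal" where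
  "step3 G X Y R w x = (case x of
       Node v \<Rightarrow> if v \<in> X \<union> Y \<union> (nodes G - R) then \<infinity> else w v
     | Xm \<Rightarrow> \<infinity>
     | Ym \<Rightarrow> \<infinity>)"

definition step4 :: "'v set \<Rightarrow> 'v ext ugraph \<Rightarrow> 'v ext ugraph" where
  "step4 I H = \<lparr>unodes = unodes H - Node ` I,
     uedges = {(a, b) \<in> uedges H. a \<notin> Node ` I \<and> b \<notin> Node ` I}\<rparr>"

text \<open>The algorithm may return any minimum vertex cut, so it is a relation between inputs and
  results. The nodes of \<open>I\<close>, which step 4 removes from the graph, are part of the separator that
  is returned. A minimum cut always exists, as \<open>X\<close> yields one of infinite cost; the answer is
  \<open>\<bottom>\<close> iff the minimum cost is infinite.\<close>

definition find_min_cost_sep ::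
  "'v mgraph \<Rightarrow> 'v set \<Rightarrow> 'v set \<Rightarrow> 'v set \<Rightarrow> 'v set \<Rightarrow> ('v \<Rightarrow> ereal) \<Rightarrow> 'v set option \<Rightarrow> bool" where
  "find_min_cost_sep G X Y I R w res \<longleftrightarrow>
     (let H = step4 I (step2 X Y (step1 G X Y I)); c = step3 G X Y R w
      in \<exists>C. min_vertex_cut H c Xm Ym C \<and>
           res = (if sum c C < \<infinity> then Some ({v. Node v \<in> C} \<union> I) else None))"

text \<open>
  Programs of a random access machine that handles real costs. All variables and two-dimensional
  arrays hold either natural numbers or reals. The only operations on natural numbers are
  successor and predecessor, so one instruction exceeds the largest number stored so far by at
  most a constant, and unit cost does not hide any computation with long numbers. The operations
  on reals are
  \<open>+\<close>, \<open>-\<close> and comparison. The only real constants are 0 and 1, since an arbitrary real constant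
  could store infinitely much advice.

  Every instruction and every test takes one unit of time, regardless of the size of the
  expressions in it. As that size is fixed by the program, this changes the time of a program by
  a constant factor only.
\<close>

type_synonym name = string

record store =
  nvar :: "name \<Rightarrow> nat"
  narr :: "name \<Rightarrow> nat \<Rightarrow> nat \<Rightarrow> nat"
  rvar :: "name \<Rightarrow> real"
  rarr :: "name \<Rightarrow> nat \<Rightarrow> nat \<Rightarrow> real"

datatype nexp = NConst nat | NVar name | NArr name nexp nexp | NSuc nexp | NPred nexp

datatype rexp = RZero | ROne | RVar name | RArr name nexp nexp | RAdd rexp rexp | RSub rexp rexp

datatype bexp = NLess nexp nexp | NEq nexp nexp | RLess rexp rexp | REq rexp rexp
  | BNot bexp | BAnd bexp bexp

datatype com = Skip
  | NAssign name nexp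
  | NStore name nexp nexp nexp
  | RAssign name rexp
  | RStore name nexp nexp rexp
  | Seq com com
  | Cond bexp com com
  | While bexp com

primrec nval :: "nexp \<Rightarrow> store \<Rightarrow> nat" where
  "nval (NConst k) s = k"
| "nval (NVar x) s = nvar s x"
| "nval (NArr a i j) s = narr s a (nval i s) (nval j s)"
| "nval (NSuc e) s = Suc (nval e s)"
| "nval (NPred e) s = nval e s - 1"

primrec rval :: "rexp \<Rightarrow> store \<Rightarrow> real" where
  "rval RZero s = 0"
| "rval ROne s = 1"
| "rval (RVar x) s = rvar s x"
| "rval (RArr a i j) s = rarr s a (nval i s) (nval j s)"
| "rval (RAdd d e) s = rval d s + rval e s"
| "rval (RSub d e) s = rval d s - rval e s"

primrec bval :: "bexp \<Rightarrow> store \<Rightarrow> bool" where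
  "bval (NLess d e) s \<longleftrightarrow> nval d s < nval e s"
| "bval (NEq d e) s \<longleftrightarrow> nval d s = nval e s"
| "bval (RLess d e) s \<longleftrightarrow> rval d s < rval e s"
| "bval (REq d e) s \<longleftrightarrow> rval d s = rval e s"
| "bval (BNot b) s \<longleftrightarrow> \<not> bval b s"
| "bval (BAnd a b) s \<longleftrightarrow> bval a s \<and> bval b s"

definition upd2 :: "(name \<Rightarrow> nat \<Rightarrow> nat \<Rightarrow> 'a) \<Rightarrow> name \<Rightarrow> nat \<Rightarrow> nat \<Rightarrow> 'a \<Rightarrow> name \<Rightarrow> nat \<Rightarrow> nat \<Rightarrow> 'a"
  where "upd2 A a i j x = A(a := (A a)(i := (A a i)(j := x)))"

text \<open>\<open>exec c s t s'\<close>: started in \<open>s\<close>, the program \<open>c\<close> terminates in \<open>s'\<close> after exactly \<open>t\<close> time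
  units.\<close>

inductive exec :: "com \<Rightarrow> store \<Rightarrow> nat \<Rightarrow> store \<Rightarrow> bool" where
  exec_Skip: "exec Skip s 1 s"
| exec_NAssign: "exec (NAssign x e) s 1 (s\<lparr>nvar := (nvar s)(x := nval e s)\<rparr>)"
| exec_NStore:
    "exec (NStore a i j e) s 1 (s\<lparr>narr := upd2 (narr s) a (nval i s) (nval j s) (nval e s)\<rparr>)"
| exec_RAssign: "exec (RAssign x e) s 1 (s\<lparr>rvar := (rvar s)(x := rval e s)\<rparr>)"
| exec_RStore:
    "exec (RStore a i j e) s 1 (s\<lparr>rarr := upd2 (rarr s) a (nval i s) (nval j s) (rval e s)\<rparr>)"
| exec_Seq: "exec c s t s' \<Longrightarrow> exec d s' t' s'' \<Longrightarrow> exec (Seq c d) s (t + t') s''"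
| exec_CondTrue: "bval b s \<Longrightarrow> exec c s t s' \<Longrightarrow> exec (Cond b c d) s (Suc t) s'"
| exec_CondFalse: "\<not> bval b s \<Longrightarrow> exec d s t s' \<Longrightarrow> exec (Cond b c d) s (Suc t) s'"
| exec_WhileFalse: "\<not> bval b s \<Longrightarrow> exec (While b c) s 1 s"
| exec_WhileTrue: "bval b s \<Longrightarrow> exec c s t s' \<Longrightarrow> exec (While b c) s' t' s'' \<Longrightarrow>
    exec (While b c) s (Suc (t + t')) s''"

inductive_cases exec_elims:
  "exec Skip s t s'" "exec (NAssign x e) s t s'" "exec (NStore a i j e) s t s'"
  "exec (RAssign x r) s t s'" "exec (RStore a i j r) s t s'" "exec (Seq c d) s t s'"
  "exec (Cond b c d) s t s'"
inductive_cases exec_WhileE: "exec (While b c) s t s'"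

lemma exec_deterministic:
  "exec c s t s' \<Longrightarrow> exec c s u u' \<Longrightarrow> u = t \<and> u' = s'"
proof (induction arbitrary: u u' rule: exec.induct)
  case exec_WhileFalse
  then show ?case by (auto elim: exec_WhileE)
next
  case (exec_WhileTrue b s c t s' t' s'')
  from exec_WhileTrue.prems exec_WhileTrue.hyps(1) obtain t1 s1 t2
    where "exec c s t1 s1" "exec (While b c) s1 t2 u'" "u = Suc (t1 + t2)"
    by (auto elim: exec_WhileE)
  with exec_WhileTrue.IH show ?case by blast
qed (fastforce elim!: exec_elims)+

text \<open>The nodes are numbered by a list \<open>vs\<close>: the machine represents node \<open>vs ! i\<close> by the number
  \<open>i\<close>. Graphs are given by adjacency matrices and sets by their characteristic vectors. A cost
  function is given by a vector of reals; where infinite values are possible and not known from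
  \<open>R\<close>, a second vector marks them (\<open>real_of_ereal \<infinity> = 0\<close>). No assumption is made on
  the remaining contents of the store.\<close>

definition holds_rel :: "'a list \<Rightarrow> name \<Rightarrow> ('a \<times> 'a) set \<Rightarrow> store \<Rightarrow> bool" where
  "holds_rel vs a E s \<longleftrightarrow>
     (\<forall>i<length vs. \<forall>j<length vs. narr s a i j = of_bool ((vs ! i, vs ! j) \<in> E))"

definition holds_set :: "'a list \<Rightarrow> name \<Rightarrow> 'a set \<Rightarrow> store \<Rightarrow> bool" where
  "holds_set vs a S s \<longleftrightarrow> (\<forall>i<length vs. narr s a i 0 = of_bool (vs ! i \<in> S))"

definition holds_reals :: "'a list \<Rightarrow> name \<Rightarrow> ('a \<Rightarrow> ereal) \<Rightarrow> store \<Rightarrow> bool" where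
  "holds_reals vs a c s \<longleftrightarrow> (\<forall>i<length vs. rarr s a i 0 = real_of_ereal (c (vs ! i)))"

definition holds_input :: "'v list \<Rightarrow> 'v mgraph \<Rightarrow> 'v set \<Rightarrow> 'v set \<Rightarrow> 'v set \<Rightarrow> 'v set \<Rightarrow>
    ('v \<Rightarrow> ereal) \<Rightarrow> store \<Rightarrow> bool" where
  "holds_input vs G X Y I R w s \<longleftrightarrow> nvar s ''n'' = length vs \<and>
     holds_rel vs ''dir'' (dir G) s \<and> holds_rel vs ''und'' (und G) s \<and>
     holds_rel vs ''bid'' (bid G) s \<and>
     holds_set vs ''X'' X s \<and> holds_set vs ''Y'' Y s \<and> holds_set vs ''I'' I s \<and>
     holds_set vs ''R'' R s \<and> holds_reals vs ''w'' w s"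

definition holds_ugraph :: "'a list \<Rightarrow> 'a ugraph \<Rightarrow> store \<Rightarrow> bool" where
  "holds_ugraph us H s \<longleftrightarrow>
     holds_set us ''node'' (unodes H) s \<and> holds_rel us ''edge'' (uedges H) s"

definition holds_costs :: "'a list \<Rightarrow> ('a \<Rightarrow> ereal) \<Rightarrow> store \<Rightarrow> bool" where
  "holds_costs us c s \<longleftrightarrow> holds_set us ''inf'' {x. c x = \<infinity>} s \<and> holds_reals us ''cost'' c s"

definition holds_result :: "'v list \<Rightarrow> 'v set option \<Rightarrow> store \<Rightarrow> bool" where
  "holds_result vs res s \<longleftrightarrow> (case res of
       None \<Rightarrow> nvar s ''found'' = 0
     | Some Z \<Rightarrow> nvar s ''found'' = 1 \<and> holds_set vs ''Z'' Z s)"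

definition ext_list :: "'v list \<Rightarrow> 'v ext list" where
  "ext_list vs = map Node vs @ [Xm, Ym]"

text \<open>The programs \<open>P1\<close>, \dots, \<open>P5\<close>, run one after the other, carry out the five steps of the
  algorithm: the store holds the outcome of each step when the program for that step terminates.
  The whole run takes time at most \<open>t\<close>. Programs are deterministic (\<open>exec_deterministic\<close>), so
  this run is the only one.\<close>

definition runs_find_min_cost_sep ::
  "com \<Rightarrow> com \<Rightarrow> com \<Rightarrow> com \<Rightarrow> com \<Rightarrow> 'v list \<Rightarrow> 'v mgraph \<Rightarrow> 'v set \<Rightarrow> 'v set \<Rightarrow> 'v set \<Rightarrow> 'v set \<Rightarrow>
    ('v \<Rightarrow> ereal) \<Rightarrow> store \<Rightarrow> nat \<Rightarrow> bool" where
  "runs_find_min_cost_sep P1 P2 P3 P4 P5 vs G X Y I R w s t \<longleftrightarrow>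
     (let us = ext_list vs;
          H1 = step1 G X Y I; H2 = step2 X Y H1; c = step3 G X Y R w; H4 = step4 I H2
      in \<exists>t1 s1 t2 s2 t3 s3 t4 s4 t5 s5 res.
           exec P1 s t1 s1 \<and> holds_ugraph vs H1 s1 \<and>
           exec P2 s1 t2 s2 \<and> holds_ugraph us H2 s2 \<and>
           exec P3 s2 t3 s3 \<and> holds_ugraph us H2 s3 \<and> holds_costs us c s3 \<and>
           exec P4 s3 t4 s4 \<and> holds_ugraph us H4 s4 \<and> holds_costs us c s4 \<and>
           exec P5 s4 t5 s5 \<and> find_min_cost_sep G X Y I R w res \<and> holds_result vs res s5 \<and>
           t1 + t2 + t3 + t4 + t5 \<le> t)"

end

theory Submission
  imports Defs "HOL-Real_Asymp.Real_Asymp"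
begin

text \<open>
  Correctness of the reduction. The non-colliders of an \<open>m\<close>-connecting path are linked by collider
  paths, and the whole path lies in the anterior set of its ends and of \<open>Z\<close>; so a vertex cut of the
  augmented graph separates. Conversely, a path of the augmented graph that avoids \<open>Z\<close> expands to a
  walk whose non-colliders avoid \<open>Z\<close>. A collider of this walk that is not an ancestor of \<open>Z\<close> has a
  directed path to \<open>X\<close> or \<open>Y\<close> that avoids \<open>Z\<close>, along which the walk can be rerouted; and an active
  walk can be shortened to an active path.

  Running time. The anterior set and the bidirected components come from Warshall's algorithm, and
  two nodes are joined by a collider path iff they are adjacent or point into the same bidirected
  component. The minimum vertex cut is a minimum cut of the network in which every node is split,
  found by a push-relabel method with current arcs that only lifts vertices to height \<open>N\<close>, the number
  of vertices of the network. It works in passes over all vertices. Without a relabelling, a pass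
  lowers the maximal height of the vertices with excess, so there are \<open>O(N\<^sup>2)\<close> passes. In the end,
  pigeonhole yields a height between \<open>0\<close> and \<open>N\<close> that no vertex has, and the vertices above it form
  the source side of a minimum cut.
\<close>

section \<open>Walks, separation and augmentation\<close>

text \<open>Costs shape the reduction. A competitor cheaper than a finite separator is itself
  finite, hence lies in \<open>R\<close> and is disjoint from \<open>X\<close> and \<open>Y\<close>;
  only such separators have to yield cuts. Their nodes outside the anterior set may be dropped
  because costs on \<open>R\<close> are positive. Conversely, a cut together with \<open>I\<close>
  stays inside the anterior set, which is closed under anteriors, so a single graph serves for all
  candidates. The time bound shapes the last step. The graph may be dense and the costs are
  arbitrary reals, so bounds like the square of the number of vertices times the number of edges, or
  in the size of the flow, are of no use. A discharge makes at most one push that does not saturate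
  its arc, and a pass makes at most one discharge per vertex; all other pushes and scans are paid by
  the current arcs. Excess stranded at height \<open>N\<close> is never returned to the source,
  since the excess of the sink alone certifies a minimum cut. Infinite costs become a number above
  the sum of the finite ones, and tables replace index arithmetic, as the machine can only count up
  and down.\<close>

lemma rtrancl_imp_distinct_walk:
  assumes "(u, w) \<in> E\<^sup>*"
  shows "\<exists>p. p \<noteq> [] \<and> hd p = u \<and> last p = w \<and> distinct p \<and> successively (\<lambda>a b. (a, b) \<in> E) p"
  using assms
proof (induction rule: rtrancl_induct)
  case base
  show ?case by (intro exI[of _ "[u]"]) simp
next
  case (step y z)
  then obtain p where p: "p \<noteq> []" "hd p = u" "last p = y" "distinct p"
    "successively (\<lambda>a b. (a, b) \<in> E) p" by blast
  show ?case
  proof (cases "z \<in> set p")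
    case True
    then obtain as bs where "p = as @ z # bs" by (meson split_list)
    with p show ?thesis
      by (intro exI[of _ "as @ [z]"])
        (auto simp: successively_append_iff successively_Cons hd_append split: if_splits)
  next
    case False
    with p step.hyps show ?thesis
      by (intro exI[of _ "p @ [z]"]) (auto simp: successively_append_iff)
  qed
qed

lemma successively_imp_rtrancl:
  assumes "p \<noteq> []" "successively (\<lambda>a b. (a, b) \<in> E) p"
  shows "(hd p, last p) \<in> E\<^sup>*"
  using assms
proof (induction p)
  case (Cons a p)
  then show ?case
    by (cases "p = []") (auto simp: successively_Cons intro: converse_rtrancl_into_rtrancl)
qed simp

lemma set_subset_if_successively:
  assumes "successively (\<lambda>a b. (a, b) \<in> E) p" "p \<noteq> []" "hd p \<in> S" "E \<subseteq> S \<times> S"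
  shows "set p \<subseteq> S"
  using assms(1-3)
proof (induction p)
  case (Cons a p)
  then show ?case using assms(4) by (cases "p = []") (auto simp: successively_Cons)
qed simp

text \<open>With both ends outside \<open>C\<close>, a path that avoids \<open>C\<close> is a path
  of the graph without \<open>C\<close>. Lists of distinct nodes are thus left behind in favour of
  induction over a closure, both for the cut graph and for the network.\<close>

lemma vertex_cut_iff:
  assumes "u \<in> unodes H" "w \<in> unodes H"
  shows "vertex_cut H u w C \<longleftrightarrow> C \<subseteq> unodes H - {u, w} \<and>
    (u, w) \<notin> (uedges H \<inter> (unodes H - C) \<times> (unodes H - C))\<^sup>*" (is "_ \<longleftrightarrow> _ \<and> (u, w) \<notin> ?E\<^sup>*")
proof (cases "C \<subseteq> unodes H - {u, w}")
  case True
  have "(\<exists>p. upath H u p w \<and> set p \<inter> C = {}) \<longleftrightarrow> (u, w) \<in> ?E\<^sup>*"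
  proof
    assume "\<exists>p. upath H u p w \<and> set p \<inter> C = {}"
    then obtain p where p: "upath H u p w" "set p \<inter> C = {}" by blast
    then have "successively (\<lambda>a b. (a, b) \<in> ?E) p"
      unfolding upath_def by (auto elim!: successively_mono)
    with p show "(u, w) \<in> ?E\<^sup>*" using successively_imp_rtrancl[of p ?E] by (auto simp: upath_def)
  next
    assume "(u, w) \<in> ?E\<^sup>*"
    then obtain p where p: "p \<noteq> []" "hd p = u" "last p = w" "distinct p"
      "successively (\<lambda>a b. (a, b) \<in> ?E) p" using rtrancl_imp_distinct_walk by metis
    have "set p \<subseteq> unodes H - C"
      using set_subset_if_successively[OF p(5,1), of "unodes H - C"] p(2) assms True by auto
    moreover have "successively (\<lambda>a b. (a, b) \<in> uedges H) p"
      using p(5) by (rule successively_mono) auto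
    ultimately show "\<exists>p. upath H u p w \<and> set p \<inter> C = {}"
      using p by (auto simp: upath_def)
  qed
  with True show ?thesis by (auto simp: vertex_cut_def)
qed (auto simp: vertex_cut_def)

section \<open>Conditions on the inner nodes of a path\<close>

fun triples :: "('a \<Rightarrow> 'a \<Rightarrow> 'a \<Rightarrow> bool) \<Rightarrow> 'a list \<Rightarrow> bool" where
  "triples Q (a # v # b # p) \<longleftrightarrow> Q a v b \<and> triples Q (v # b # p)"
| "triples Q _ \<longleftrightarrow> True"

text \<open>Whether an inner node is a collider depends on its two neighbours alone. Cutting at
  \<open>v\<close> therefore separates the condition into those of the two pieces and a single one
  at the seam, which is all that the surgery on walks has to check.\<close>

lemma triples_append:
  "triples Q (p @ v # q) \<longleftrightarrow> triples Q (p @ [v]) \<and> triples Q (v # q) \<and>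
     (p \<noteq> [] \<and> q \<noteq> [] \<longrightarrow> Q (last p) v (hd q))"
proof (induction p)
  case (Cons a p)
  show ?case
  proof (cases p)
    case Nil
    then show ?thesis by (cases q) auto
  next
    case (Cons b p')
    with Cons.IH show ?thesis by (cases p') auto
  qed
qed auto

lemma triples_rev: "triples Q (rev p) \<longleftrightarrow> triples (\<lambda>a v b. Q b v a) p"
proof (induction p)
  case (Cons a p)
  show ?case
  proof (cases p)
    case (Cons v q)
    show ?thesis
      using Cons.IH triples_append[of Q "rev q" v "[a]"] Cons
      by (cases q) (auto simp: last_rev)
  qed simp
qed simp

lemma triples_conv_nth:
  "triples Q p \<longleftrightarrow> (\<forall>i. Suc (Suc i) < length p \<longrightarrow> Q (p ! i) (p ! Suc i) (p ! Suc (Suc i)))"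
proof (induction Q p rule: triples.induct)
  case (1 Q a v b p)
  have *: "(\<forall>i. P i) \<longleftrightarrow> P 0 \<and> (\<forall>i. P (Suc i))" for P :: "nat \<Rightarrow> bool"
    by (metis nat.exhaust)
  show ?case by (subst *) (use 1 in simp)
qed auto

lemma triples_mono:
  assumes "triples Q p"
    and "\<And>a v b. a \<in> set p \<Longrightarrow> v \<in> set p \<Longrightarrow> b \<in> set p \<Longrightarrow> Q a v b \<Longrightarrow> Q' a v b"
  shows "triples Q' p"
  using assms by (induction Q p rule: triples.induct) auto

text \<open>A violated condition is handed over as a cut of the list at the offending node, ready
  for induction on the length: both pieces are shorter.\<close>

lemma not_triplesE:
  assumes "\<not> triples Q p"
  obtains q v r where "p = q @ v # r" "q \<noteq> []" "r \<noteq> []" "\<not> Q (last q) v (hd r)"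
  using assms
proof (induction Q p arbitrary: thesis rule: triples.induct)
  case (1 Q a v b p)
  show ?case
  proof (cases "Q a v b")
    case True
    with 1 obtain q x r where "v # b # p = q @ x # r" "q \<noteq> []" "r \<noteq> []" "\<not> Q (last q) x (hd r)"
      by auto
    then show ?thesis by (intro "1.prems"(1)[of "a # q" x r]) auto
  next
    case False
    then show ?thesis by (intro "1.prems"(1)[of "[a]" v "b # p"]) auto
  qed
qed auto

section \<open>Anteriors, ancestors and walks\<close>

lemma path_along_iff:
  assumes "mixed_graph G" "E \<subseteq> dir G \<union> und G"
  shows "(\<exists>p. path G u p w \<and> successively (\<lambda>a b. (a, b) \<in> E) p) \<longleftrightarrow>
    u \<in> nodes G \<and> w \<in> nodes G \<and> (u, w) \<in> E\<^sup>*" (is "?L \<longleftrightarrow> ?R")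
proof
  assume ?L
  then obtain p where "path G u p w" "successively (\<lambda>a b. (a, b) \<in> E) p" by blast
  then show ?R using successively_imp_rtrancl[of p E] by (auto simp: path_def)
next
  assume ?R
  then obtain p where p: "p \<noteq> []" "hd p = u" "last p = w" "distinct p"
    "successively (\<lambda>a b. (a, b) \<in> E) p" using rtrancl_imp_distinct_walk by metis
  have E: "E \<subseteq> nodes G \<times> nodes G" using assms unfolding mixed_graph_def by blast
  have "set p \<subseteq> nodes G"
    using set_subset_if_successively[OF p(5,1) _ E] p(2) \<open>?R\<close> by blast
  moreover have "successively (adjacent G) p"
    using p(5) by (rule successively_mono) (use assms(2) in \<open>auto simp: adjacent_def\<close>)
  ultimately show ?L using p by (auto simp: path_def)
qed

lemma anterior_iff:
  assumes "mixed_graph G"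
  shows "anterior G u w \<longleftrightarrow> u \<in> nodes G \<and> w \<in> nodes G \<and> (u, w) \<in> (dir G \<union> und G)\<^sup>*"
  using path_along_iff[OF assms, of "dir G \<union> und G" u w] by (simp add: anterior_def)

lemma ancestor_iff:
  assumes "mixed_graph G"
  shows "ancestor G u w \<longleftrightarrow> u \<in> nodes G \<and> w \<in> nodes G \<and> (u, w) \<in> (dir G)\<^sup>*"
  using path_along_iff[OF assms, of "dir G" u w] by (simp add: ancestor_def)

lemma adjacent_sym: "mixed_graph G \<Longrightarrow> adjacent G a b \<longleftrightarrow> adjacent G b a"
  by (auto simp: mixed_graph_def adjacent_def dest: symD)

lemma induced_simps [simp]:
  "nodes (induced G S) = nodes G \<inter> S" "dir (induced G S) = dir G \<inter> S \<times> S"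
  "und (induced G S) = und G \<inter> S \<times> S" "bid (induced G S) = bid G \<inter> S \<times> S"
  by (auto simp: induced_def)

lemma mixed_graph_induced: "mixed_graph G \<Longrightarrow> mixed_graph (induced G S)"
  by (fastforce simp: mixed_graph_def sym_def irrefl_def)

lemma arrowhead_induced: "arrowhead (induced G S) a b \<longleftrightarrow> arrowhead G a b \<and> a \<in> S \<and> b \<in> S"
  by (auto simp: arrowhead_def)

lemma adjacent_induced: "adjacent (induced G S) a b \<longleftrightarrow> adjacent G a b \<and> a \<in> S \<and> b \<in> S"
  by (auto simp: adjacent_def)

abbreviation meets :: "'v mgraph \<Rightarrow> 'v \<Rightarrow> 'v \<Rightarrow> 'v \<Rightarrow> bool" where
  "meets G a v b \<equiv> arrowhead G a v \<and> arrowhead G b v"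

text \<open>Concerns inner nodes only; that the ends avoid \<open>Z\<close> is stated separately
  where it matters. So the condition passes to pieces of a walk, whatever their ends are.\<close>

definition open_at :: "'v mgraph \<Rightarrow> 'v set \<Rightarrow> 'v \<Rightarrow> 'v \<Rightarrow> 'v \<Rightarrow> bool" where
  "open_at G Z a v b \<longleftrightarrow> (if meets G a v b then v \<in> An G Z else v \<notin> Z)"

definition walk :: "'v mgraph \<Rightarrow> 'v list \<Rightarrow> bool" where
  "walk G p \<longleftrightarrow> p \<noteq> [] \<and> set p \<subseteq> nodes G \<and> successively (adjacent G) p"

lemma collider_path_iff:
  "(\<forall>i. 0 < i \<and> Suc i < length p \<longrightarrow> collider G p i) \<longleftrightarrow> triples (meets G) p"
proof -
  have "(\<forall>i. 0 < i \<and> Suc i < length p \<longrightarrow> collider G p i) \<longleftrightarrow>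
    (\<forall>i. Suc (Suc i) < length p \<longrightarrow> collider G p (Suc i))"
    by (metis gr0_implies_Suc zero_less_Suc)
  then show ?thesis by (auto simp: triples_conv_nth collider_def)
qed

lemma augmented_edge_iff:
  "(u, w) \<in> uedges (augmented H) \<longleftrightarrow> u \<noteq> w \<and> (\<exists>p. walk H p \<and> distinct p \<and> hd p = u \<and> last p = w \<and>
     triples (meets H) p)"
  unfolding augmented_def path_def walk_def collider_path_iff by auto

lemma m_connected_iff:
  "m_connected G Z u w \<longleftrightarrow> (\<exists>p. walk G p \<and> distinct p \<and> hd p = u \<and> last p = w \<and> u \<notin> Z \<and> w \<notin> Z \<and>
     triples (open_at G Z) p)"
proof -
  have "(\<forall>i<length p. if collider G p i then p ! i \<in> An G Z else p ! i \<notin> Z) \<longleftrightarrow>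
    hd p \<notin> Z \<and> last p \<notin> Z \<and> triples (open_at G Z) p" (is "?L \<longleftrightarrow> ?R") if "p \<noteq> []" for p
  proof
    assume L: ?L
    then have "p ! 0 \<notin> Z" "p ! (length p - 1) \<notin> Z"
      using that by (auto simp: collider_def dest: spec[of _ 0] spec[of _ "length p - 1"])
    moreover have "open_at G Z (p ! i) (p ! Suc i) (p ! Suc (Suc i))" if "Suc (Suc i) < length p" for i
      using L[rule_format, of "Suc i"] that by (auto simp: collider_def open_at_def split: if_splits)
    ultimately show ?R using that by (simp add: triples_conv_nth hd_conv_nth last_conv_nth)
  next
    assume R: ?R
    show ?L
    proof (intro allI impI)
      fix i assume i: "i < length p"
      show "if collider G p i then p ! i \<in> An G Z else p ! i \<notin> Z"
      proof (cases "i = 0 \<or> Suc i = length p")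
        case True
        then have "p ! i = hd p \<or> p ! i = last p"
          using that by (metis diff_Suc_1 hd_conv_nth last_conv_nth)
        with R True show ?thesis by (auto simp: collider_def)
      next
        case False
        then obtain j where "i = Suc j" "Suc (Suc j) < length p"
          using i by (cases i) auto
        with R show ?thesis by (auto simp: triples_conv_nth open_at_def collider_def split: if_splits)
      qed
    qed
  qed
  then have "path G u p w \<and> (\<forall>i<length p. if collider G p i then p ! i \<in> An G Z else p ! i \<notin> Z) \<longleftrightarrow>
    walk G p \<and> distinct p \<and> hd p = u \<and> last p = w \<and> u \<notin> Z \<and> w \<notin> Z \<and> triples (open_at G Z) p" for p
    unfolding path_def walk_def by (cases "p = []") auto
  then show ?thesis unfolding m_connected_def by simp
qed

lemma walk_append: "walk G (p @ v # q) \<longleftrightarrow> walk G (p @ [v]) \<and> walk G (v # q)"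
  by (auto simp: walk_def successively_append_iff successively_Cons)

lemma walk_rev: "mixed_graph G \<Longrightarrow> walk G (rev p) \<longleftrightarrow> walk G p"
  unfolding walk_def by (auto simp: adjacent_sym elim: successively_mono)

section \<open>Active walks and active paths in ancestral graphs\<close>

locale ancestral =
  fixes G :: "'v mgraph"
  assumes ancestral: "ancestral_graph G"
begin

lemma mixed: "mixed_graph G"
  using ancestral by (simp add: ancestral_graph_def)

lemma edges_in_nodes: "dir G \<subseteq> nodes G \<times> nodes G" "und G \<subseteq> nodes G \<times> nodes G"
  "bid G \<subseteq> nodes G \<times> nodes G"
  using mixed by (auto simp: mixed_graph_def)

lemma finite_nodes: "finite (nodes G)"
  using mixed by (auto simp: mixed_graph_def)

lemma no_arrowhead_if_dir: "(a, b) \<in> dir G \<Longrightarrow> \<not> arrowhead G b a"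
  using ancestral edges_in_nodes unfolding ancestral_graph_def anterior_iff[OF mixed] by blast

lemma no_arrowhead_if_und: "(a, b) \<in> und G \<Longrightarrow> \<not> arrowhead G c a \<and> \<not> arrowhead G c b"
  using ancestral by (auto simp: ancestral_graph_def)

lemma tail_if_no_arrowhead:
  assumes "adjacent G a b" "\<not> arrowhead G b a"
  shows "(a, b) \<in> dir G \<union> und G"
  using assms mixed by (auto simp: adjacent_def arrowhead_def mixed_graph_def dest: symD)

text \<open>An arrowhead at \<open>v\<close> excludes undirected edges at \<open>v\<close>, so an
  edge without an arrowhead at \<open>v\<close> can only leave it. This keeps a walk directed once
  it has started so.\<close>

lemma dir_if_meets:
  assumes "adjacent G v x" "\<not> arrowhead G x v" "arrowhead G a v"
  shows "(v, x) \<in> dir G"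
  using tail_if_no_arrowhead[OF assms(1,2)] no_arrowhead_if_und assms(3) by blast

lemma An_iff: "v \<in> An G S \<longleftrightarrow> v \<in> nodes G \<and> (\<exists>w\<in>S \<inter> nodes G. (v, w) \<in> (dir G)\<^sup>*)"
  by (auto simp: An_def ancestor_iff[OF mixed])

lemma Ant_iff: "v \<in> Ant G S \<longleftrightarrow> v \<in> nodes G \<and> (\<exists>w\<in>S \<inter> nodes G. (v, w) \<in> (dir G \<union> und G)\<^sup>*)"
  by (auto simp: Ant_def anterior_iff[OF mixed])

lemma An_step: "(v, x) \<in> dir G \<Longrightarrow> x \<in> An G S \<Longrightarrow> v \<in> An G S"
  using edges_in_nodes by (auto simp: An_iff intro: converse_rtrancl_into_rtrancl)

lemma Ant_step: "(v, x) \<in> dir G \<union> und G \<Longrightarrow> x \<in> Ant G S \<Longrightarrow> v \<in> Ant G S"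
  using edges_in_nodes unfolding Ant_iff by (blast intro: converse_rtrancl_into_rtrancl)

lemma open_at_sym: "open_at G Z a v b \<longleftrightarrow> open_at G Z b v a"
  by (auto simp: open_at_def)

lemma triples_open_rev: "triples (open_at G Z) (rev p) \<longleftrightarrow> triples (open_at G Z) p"
  by (subst triples_rev, subst open_at_sym) simp

text \<open>Followed from \<open>v\<close>, the walk stays directed up to its last edge unless it
  meets a collider. An open collider is an ancestor of \<open>Z\<close>, and then so is
  \<open>v\<close>, which has a directed path to it.\<close>

lemma follow_directed:
  assumes "successively (adjacent G) (v # q)" "triples (open_at G Z) (v # q)" "q \<noteq> []"
    "(v, hd q) \<in> dir G"
  shows "v \<in> An G Z \<or> arrowhead G (last (butlast (v # q))) (last q)"
  using assms
proof (induction q arbitrary: v)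
  case (Cons x q)
  show ?case
  proof (cases q)
    case Nil
    with Cons show ?thesis by (auto simp: arrowhead_def)
  next
    case (Cons y q')
    have vx: "arrowhead G v x" using Cons.prems by (auto simp: arrowhead_def)
    show ?thesis
    proof (cases "arrowhead G y x")
      case True
      with vx Cons Cons.prems have "x \<in> An G Z" by (auto simp: open_at_def)
      with Cons.prems show ?thesis by (auto intro: An_step)
    next
      case False
      with vx Cons Cons.prems have "(x, y) \<in> dir G" by (auto intro: dir_if_meets)
      with Cons.IH[of x] Cons Cons.prems show ?thesis by (auto intro: An_step)
    qed
  qed
qed simp

text \<open>Only the triple at the new junction is in question. If it is no collider, then
  \<open>v\<close> was already a non-collider at one of its two occurrences. If it is a collider,
  then either the loop has an arrowhead at \<open>v\<close> at one of its ends, so that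
  \<open>v\<close> was an open collider before, or the loop leaves \<open>v\<close> along a directed
  edge; it cannot stay directed, since it would then return with an arrowhead, and so
  \<open>v\<close> is an ancestor of \<open>Z\<close> by \<open>follow_directed\<close>.\<close>

lemma walk_shortcut:
  assumes "walk G (p @ v # q @ v # r)" "triples (open_at G Z) (p @ v # q @ v # r)"
  shows "triples (open_at G Z) (p @ v # r)"
proof -
  let ?Q = "triples (open_at G Z)"
  have t: "?Q (p @ [v])" "?Q (v # q @ [v])" "?Q (v # r)"
    and j1: "p \<noteq> [] \<Longrightarrow> open_at G Z (last p) v (hd (q @ [v]))"
    and j2: "r \<noteq> [] \<Longrightarrow> open_at G Z (last (v # q)) v (hd r)"
    using assms(2) triples_append[of "open_at G Z" p v "q @ v # r"]
      triples_append[of "open_at G Z" "v # q" v r] by (cases q; auto)+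
  have w: "successively (adjacent G) (v # q @ [v])"
    using assms(1) unfolding walk_def
    by (auto simp: successively_append_iff successively_Cons hd_append split: if_splits)
  have "open_at G Z (last p) v (hd r)" if "p \<noteq> []" "r \<noteq> []"
  proof (cases "meets G (last p) v (hd r)")
    case True
    have "v \<in> An G Z"
    proof (cases "arrowhead G (hd (q @ [v])) v \<or> arrowhead G (last (v # q)) v")
      case True
      with \<open>meets G (last p) v (hd r)\<close> j1 j2 that show ?thesis by (auto simp: open_at_def)
    next
      case False
      have "adjacent G v (hd (q @ [v]))" using w by (cases q) auto
      with False True have "(v, hd (q @ [v])) \<in> dir G" by (auto intro: dir_if_meets)
      from follow_directed[OF w t(2) _ this] False show ?thesis
        by (auto simp: butlast_append)
    qed
    with True show ?thesis by (simp add: open_at_def)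
  next
    case False
    with j1 j2 that show ?thesis by (auto simp: open_at_def split: if_splits)
  qed
  with t show ?thesis by (simp add: triples_append[of _ p v r])
qed

lemma m_connected_if_walk:
  assumes "walk G p" "triples (open_at G Z) p" "hd p \<notin> Z" "last p \<notin> Z"
  shows "m_connected G Z (hd p) (last p)"
  using assms
proof (induction p rule: length_induct)
  case (1 p)
  show ?case
  proof (cases "distinct p")
    case True
    with 1 show ?thesis unfolding m_connected_iff by blast
  next
    case False
    then obtain as v bs cs where p: "p = as @ v # bs @ v # cs"
      using not_distinct_decomp[of p] by auto
    have "walk G (as @ v # cs)"
      using 1(2) unfolding p by (metis append_Cons append_assoc walk_append)
    moreover have "hd (as @ v # cs) = hd p" "last (as @ v # cs) = last p"
      by (auto simp: p hd_append)
    ultimately show ?thesis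
      using 1(1)[rule_format, of "as @ v # cs"] walk_shortcut[of as v bs cs Z] 1(2-) p by auto
  qed
qed

text \<open>The counterpart of \<open>follow_directed\<close> for anteriors. A node \<open>x\<close>
  entered without a collision is again left by an edge without an arrowhead at \<open>x\<close>:
  after an undirected edge no arrowhead can meet at \<open>x\<close>, and after a directed one it
  would make \<open>x\<close> a collider. Colliders are ancestors of \<open>Z\<close> and hence in
  \<open>Ant G S\<close>.\<close>

lemma tail_follow:
  assumes "successively (adjacent G) (v # q)" "triples (open_at G Z) (v # q)" "q \<noteq> []"
    "(v, hd q) \<in> dir G \<union> und G" "last q \<in> Ant G S" "Z \<inter> nodes G \<subseteq> S"
  shows "v \<in> Ant G S"
  using assms
proof (induction q arbitrary: v)
  case (Cons x q)
  show ?case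
  proof (cases q)
    case Nil
    with Cons show ?thesis by (auto intro: Ant_step)
  next
    case (Cons y q')
    have "x \<in> Ant G S"
    proof (cases "meets G v x y")
      case True
      with Cons Cons.prems have "x \<in> An G Z" by (auto simp: open_at_def)
      then show ?thesis
        using \<open>Z \<inter> nodes G \<subseteq> S\<close> rtrancl_mono[of "dir G" "dir G \<union> und G"]
        unfolding An_iff Ant_iff by blast
    next
      case False
      have "\<not> arrowhead G y x"
      proof
        assume yx: "arrowhead G y x"
        with False have "(v, x) \<in> und G" using Cons.prems by (auto simp: arrowhead_def)
        with yx show False using no_arrowhead_if_und by blast
      qed
      then have "(x, y) \<in> dir G \<union> und G"
        using Cons Cons.prems by (intro tail_if_no_arrowhead) auto
      with Cons.IH[of x] Cons Cons.prems show ?thesis by auto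
    qed
    with Cons.prems show ?thesis by (auto intro: Ant_step)
  qed
qed simp

text \<open>An inner node is an open collider, or one of its two edges has no arrowhead there; in
  the latter case \<open>tail_follow\<close> leads along that side towards the end of the
  path.\<close>

lemma active_path_in_Ant:
  assumes "walk G p" "triples (open_at G Z) p" "hd p \<in> S" "last p \<in> S" "Z \<inter> nodes G \<subseteq> S"
  shows "set p \<subseteq> Ant G S"
proof
  fix v assume "v \<in> set p"
  then obtain as bs where p: "p = as @ v # bs" by (meson split_list)
  have ends: "hd p \<in> Ant G S" "last p \<in> Ant G S"
    using assms unfolding walk_def Ant_iff by (auto simp: subset_iff)
  show "v \<in> Ant G S"
  proof (cases "as = [] \<or> bs = []")
    case True
    with ends p show ?thesis by auto
  next
    case False
    have w: "walk G (as @ [v])" "walk G (v # bs)" using assms(1) p by (metis walk_append)+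
    have t: "triples (open_at G Z) (as @ [v])" "triples (open_at G Z) (v # bs)"
      and o: "open_at G Z (last as) v (hd bs)"
      using assms(2) False unfolding p triples_append[of _ as v bs] by auto
    have w': "walk G (v # rev as)" using w(1) walk_rev[OF mixed, of "as @ [v]"] by simp
    have t': "triples (open_at G Z) (v # rev as)"
      using t(1) triples_open_rev[of Z "as @ [v]"] by simp
    consider "meets G (last as) v (hd bs)" | "\<not> arrowhead G (last as) v" | "\<not> arrowhead G (hd bs) v"
      by blast
    then show ?thesis
    proof cases
      case 1
      with o have "v \<in> An G Z" by (simp add: open_at_def)
      then show ?thesis
        using assms(5) rtrancl_mono[of "dir G" "dir G \<union> und G"]
        unfolding An_iff Ant_iff by blast
    next
      case 2
      with w' False have "(v, hd (rev as)) \<in> dir G \<union> und G"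
        by (intro tail_if_no_arrowhead) (auto simp: walk_def successively_Cons hd_rev)
      with False w' t' ends p show ?thesis
        by (intro tail_follow[of v "rev as" Z S]) (auto simp: walk_def assms(5) last_rev)
    next
      case 3
      with w(2) False have "(v, hd bs) \<in> dir G \<union> und G"
        by (intro tail_if_no_arrowhead) (auto simp: walk_def successively_Cons)
      with False w(2) t(2) ends p show ?thesis
        by (intro tail_follow[of v bs Z S]) (auto simp: walk_def assms(5))
    qed
  qed
qed

text \<open>\<open>Q\<close> abstracts from openness: all that matters is that an inner node in
  \<open>Z\<close> is a collider within \<open>H\<close>. Cutting at the non-colliders leaves
  collider paths, which are single edges of the augmented graph, and the cuts lie outside
  \<open>Z\<close>.\<close>

lemma augmented_reach_if_active:
  assumes "walk H p" "distinct p" "triples Q p" "hd p \<notin> Z" "last p \<notin> Z"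
    and Q: "\<And>a v b. Q a v b \<Longrightarrow> v \<in> Z \<Longrightarrow> meets H a v b"
  shows "(hd p, last p) \<in> (uedges (augmented H) \<inter> (nodes H - Z) \<times> (nodes H - Z))\<^sup>*"
    (is "_ \<in> ?E\<^sup>*")
  using assms(1-5)
proof (induction p rule: length_induct)
  case (1 p)
  show ?case
  proof (cases "triples (meets H) p")
    case True
    have "hd p \<in> nodes H" "last p \<in> nodes H"
      using "1.prems"(1) unfolding walk_def by (metis hd_in_set last_in_set subsetD)+
    moreover have "(hd p, last p) \<in> uedges (augmented H)" if "hd p \<noteq> last p"
      unfolding augmented_edge_iff using "1.prems"(1,2) True that by (intro conjI exI[of _ p]) auto
    ultimately show ?thesis using "1.prems"(4,5) by (cases "hd p = last p") auto
  next
    case False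
    then obtain q v r where p: "p = q @ v # r" "q \<noteq> []" "r \<noteq> []" "\<not> meets H (last q) v (hd r)"
      by (rule not_triplesE)
    have t: "triples Q (q @ [v])" "triples Q (v # r)" "v \<notin> Z"
      using "1.prems"(3) Q p(2-4) unfolding p(1) triples_append[of _ q v r] by auto
    have w: "walk H (q @ [v])" "walk H (v # r)" using "1.prems"(1) p(1) by (metis walk_append)+
    have "(hd (q @ [v]), last (q @ [v])) \<in> ?E\<^sup>*"
      using p(1,2,3) w(1) t(1,3) "1.prems"(2,4)
      by (intro "1.IH"[rule_format]) (auto simp: hd_append)
    moreover have "(hd (v # r), last (v # r)) \<in> ?E\<^sup>*"
      using p(1,2,3) w(2) t(2,3) "1.prems"(2,5)
      by (intro "1.IH"[rule_format]) auto
    moreover have "hd (q @ [v]) = hd p" "last (v # r) = last p" using p by auto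
    ultimately show ?thesis by simp
  qed
qed

lemma augmented_reach_if_m_connected:
  assumes "m_connected G Z x y" "x \<in> S" "y \<in> S" "Z \<inter> nodes G \<subseteq> S"
  defines "H \<equiv> induced G (Ant G S)"
  shows "(x, y) \<in> (uedges (augmented H) \<inter> (nodes H - Z) \<times> (nodes H - Z))\<^sup>*"
proof -
  obtain p where p: "walk G p" "distinct p" "hd p = x" "last p = y" "x \<notin> Z" "y \<notin> Z"
    "triples (open_at G Z) p" using assms(1) unfolding m_connected_iff by blast
  \<comment> \<open>Since the path lies in \<open>Ant G S\<close>, passing to the induced subgraph
    loses none of its edges and arrowheads.\<close>
  have A: "set p \<subseteq> Ant G S" using active_path_in_Ant[of p Z S] p assms by auto
  have w: "walk H p"
    using p(1) A unfolding walk_def H_def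
    by (auto simp: adjacent_induced elim!: successively_mono)
  have "triples (\<lambda>a v b. v \<in> Z \<longrightarrow> meets H a v b) p"
    using p(7) by (rule triples_mono) (use A in \<open>auto simp:
      H_def arrowhead_induced open_at_def split: if_splits\<close>)
  from augmented_reach_if_active[OF w p(2) this] show ?thesis using p by auto
qed

section \<open>Rerouting along directed paths\<close>

definition tied :: "'v set \<Rightarrow> 'v set \<Rightarrow> 'v \<Rightarrow> bool" where
  "tied Z S v \<longleftrightarrow> (\<exists>q. q \<noteq> [] \<and> hd q = v \<and> last q \<in> S \<and> set q \<subseteq> nodes G - Z \<and>
     successively (\<lambda>a b. (a, b) \<in> dir G) q)"

text \<open>The directed path is prepended node by node. The edge from the old end \<open>v\<close>
  to the new end \<open>u\<close> points away from \<open>v\<close>, so \<open>v\<close> becomes a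
  non-collider, and it lies outside \<open>Z\<close>.\<close>

lemma attach_tie:
  assumes "tied Z S (hd p)" "walk G p" "triples (open_at G Z) p"
  shows "\<exists>p'. walk G p' \<and> triples (open_at G Z) p' \<and> hd p' \<in> S - Z \<and> last p' = last p"
proof -
  obtain q where "q \<noteq> []" "hd q = hd p" "last q \<in> S" "set q \<subseteq> nodes G - Z"
    "successively (\<lambda>a b. (a, b) \<in> dir G) q" using assms(1) unfolding tied_def by blast
  then show ?thesis using assms(2,3)
  proof (induction q arbitrary: p)
    case (Cons v q)
    show ?case
    proof (cases q)
      case Nil
      with Cons.prems show ?thesis by (intro exI[of _ p]) auto
    next
      case (Cons u q')
      obtain ps where p: "p = v # ps" using Cons.prems by (cases p) (auto simp: walk_def)
      have vu: "(v, u) \<in> dir G" using Cons Cons.prems by auto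
      have "walk G (u # p)"
        using Cons.prems vu p Cons by (auto simp: walk_def adjacent_def)
      moreover have "triples (open_at G Z) (u # p)"
      proof -
        have "open_at G Z u v b" for b
          using no_arrowhead_if_dir[OF vu] Cons.prems by (simp add: open_at_def)
        with Cons.prems(7) p show ?thesis by (cases ps) auto
      qed
      ultimately show ?thesis
        using Cons.IH[of "u # p"] Cons.prems Cons p by auto
    qed
  qed simp
qed

text \<open>At a closed collider tied to \<open>X\<close>, everything before it is discarded, as it
  can serve as the new left end; dually for \<open>Y\<close>. Then all inner nodes are open, and
  attaching the two directed paths moves the ends into \<open>X\<close> and \<open>Y\<close>.
  Attachment works at the head of a list, hence the reversals.\<close>

lemma m_connected_if_tied_walk:
  assumes "walk G p" "tied Z X (hd p)" "tied Z Y (last p)"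
    "triples (\<lambda>a v b. if meets G a v b then v \<in> An G Z \<or> tied Z X v \<or> tied Z Y v else v \<notin> Z) p"
  shows "\<exists>x\<in>X. \<exists>y\<in>Y. m_connected G Z x y"
proof -
  let ?Q = "\<lambda>a v b. if meets G a v b then v \<in> An G Z \<or> tied Z X v \<or> tied Z Y v else v \<notin> Z"
  have "\<exists>p. walk G p \<and> tied Z X (hd p) \<and> tied Z Y (last p) \<and> triples (open_at G Z) p"
    using assms
  proof (induction p rule: length_induct)
    case (1 p)
    show ?case
    proof (cases "triples (open_at G Z) p")
      case False
      then obtain q v r where p: "p = q @ v # r" "q \<noteq> []" "r \<noteq> []" "\<not> open_at G Z (last q) v (hd r)"
        by (rule not_triplesE)
      have t: "triples ?Q (q @ [v])" "triples ?Q (v # r)" "?Q (last q) v (hd r)"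
        using "1.prems"(4) p(2-4) unfolding p(1) triples_append[of _ q v r] by auto
      have w: "walk G (q @ [v])" "walk G (v # r)" using "1.prems"(1) p(1) by (metis walk_append)+
      consider "tied Z X v" | "tied Z Y v" using t(3) p(4) by (auto simp: open_at_def split: if_splits)
      then show ?thesis
      proof cases
        case 1
        show ?thesis using p t w 1 "1.prems" by (intro "1.IH"[rule_format, of "v # r"]) auto
      next
        case 2
        show ?thesis using p t w 2 "1.prems" by (intro "1.IH"[rule_format, of "q @ [v]"]) auto
      qed
    qed (use 1 in blast)
  qed
  then obtain p where p: "walk G p" "tied Z X (hd p)" "tied Z Y (last p)" "triples (open_at G Z) p"
    by blast
  then obtain p1 where p1: "walk G p1" "triples (open_at G Z) p1" "hd p1 \<in> X - Z" "last p1 = last p"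
    using attach_tie by metis
  have "p1 \<noteq> []" using p1 by (simp add: walk_def)
  have "tied Z Y (hd (rev p1))" using p1(4) p(3) \<open>p1 \<noteq> []\<close> by (simp add: hd_rev)
  moreover have "walk G (rev p1)" using p1(1) by (simp add: walk_rev[OF mixed])
  moreover have "triples (open_at G Z) (rev p1)" using p1(2) by (simp add: triples_open_rev)
  ultimately obtain p2 where p2: "walk G p2" "triples (open_at G Z) p2" "hd p2 \<in> Y - Z"
    "last p2 = last (rev p1)"
    using attach_tie by metis
  have "p2 \<noteq> []" using p2 by (simp add: walk_def)
  have "m_connected G Z (hd (rev p2)) (last (rev p2))"
    using p2 p1 \<open>p1 \<noteq> []\<close> \<open>p2 \<noteq> []\<close>
    by (intro m_connected_if_walk) (auto simp: walk_rev[OF mixed] triples_open_rev hd_rev last_rev)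
  with p2 p1 \<open>p1 \<noteq> []\<close> \<open>p2 \<noteq> []\<close> show ?thesis by (auto simp: hd_rev last_rev)
qed

text \<open>At a node with an arrowhead the next edge cannot be undirected; being directed, it puts
  an arrowhead at the next node, and so on.\<close>

lemma dir_rtrancl_if_arrowhead:
  assumes "(v, w) \<in> (dir G \<union> und G)\<^sup>*" "arrowhead G c v"
  shows "(v, w) \<in> (dir G)\<^sup>*"
proof -
  have "(v, w) \<in> (dir G)\<^sup>* \<and> (\<exists>c. arrowhead G c w)"
    using assms
  proof (induction rule: rtrancl_induct)
    case (step y z)
    then have "(y, z) \<in> dir G" using no_arrowhead_if_und by blast
    with step show ?case by (auto simp: arrowhead_def)
  qed auto
  then show ?thesis ..
qed

text \<open>As a collider, \<open>v\<close> reaches \<open>X\<close>, \<open>Y\<close> or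
  \<open>I\<close> by directed edges alone. This path avoids \<open>Z\<close>, or else
  \<open>v\<close> would be an ancestor of \<open>Z\<close>; in particular it does not end in
  \<open>I\<close>.\<close>

lemma collider_tied:
  assumes "v \<in> Ant G (X \<union> Y \<union> I)" "I \<subseteq> Z" "arrowhead G c v" "v \<notin> An G Z"
  shows "tied Z X v \<or> tied Z Y v"
proof -
  obtain w where w: "w \<in> X \<union> Y \<union> I" "v \<in> nodes G" "(v, w) \<in> (dir G \<union> und G)\<^sup>*"
    using assms(1) unfolding Ant_iff by blast
  from dir_rtrancl_if_arrowhead[OF w(3) assms(3)] obtain q where
    q: "q \<noteq> []" "hd q = v" "last q = w" "successively (\<lambda>a b. (a, b) \<in> dir G) q"
    using rtrancl_imp_distinct_walk by metis
  have n: "set q \<subseteq> nodes G"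
    using set_subset_if_successively[OF q(4,1), of "nodes G"] q(2) w edges_in_nodes by auto
  have "u \<notin> Z" if u: "u \<in> set q" for u
  proof
    assume "u \<in> Z"
    obtain as bs where "q = as @ u # bs" using u by (meson split_list)
    with q have "(hd (as @ [u]), last (as @ [u])) \<in> (dir G)\<^sup>*"
      by (intro successively_imp_rtrancl) (auto simp: successively_append_iff split: if_splits)
    with q \<open>q = as @ u # bs\<close> have "(v, u) \<in> (dir G)\<^sup>*" by (auto simp: hd_append split: if_splits)
    with \<open>u \<in> Z\<close> u n w assms(4) show False unfolding An_iff by blast
  qed
  then have "set q \<subseteq> nodes G - Z" using n by auto
  moreover have "w \<in> set q" using q by auto
  ultimately have "w \<in> X \<or> w \<in> Y" using w(1) assms(2) by auto
  with q \<open>set q \<subseteq> nodes G - Z\<close> show ?thesis unfolding tied_def by blast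
qed

text \<open>Collider paths are joined at nodes outside \<open>Z\<close>. Their colliders lie in the
  anterior set but need not be ancestors of \<open>Z\<close>; rerouting at these may change the
  ends, so the conclusion is about some pair rather than about \<open>x\<close> and
  \<open>y\<close>.\<close>

lemma m_connected_if_augmented_reach:
  assumes "(x, y) \<in> (uedges (augmented H) \<inter> (nodes H - Z) \<times> (nodes H - Z))\<^sup>*"
    and H: "H = induced G (Ant G (X \<union> Y \<union> I))"
    and "x \<in> X" "y \<in> Y" "x \<in> nodes G - Z" "y \<in> nodes G - Z" "I \<subseteq> Z"
  shows "\<exists>x\<in>X. \<exists>y\<in>Y. m_connected G Z x y"
proof -
  let ?Q = "\<lambda>a v b. meets G a v b \<or> v \<notin> Z"
  let ?A = "Ant G (X \<union> Y \<union> I)"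
  have "\<exists>p. walk G p \<and> hd p = x \<and> last p = y \<and> set p \<subseteq> ?A \<and> triples ?Q p \<and> last p \<notin> Z"
    using assms(1)
  proof (induction rule: rtrancl_induct)
    case base
    show ?case using assms by (intro exI[of _ "[x]"]) (auto simp: walk_def Ant_iff)
  next
    case (step u w)
    then obtain p where p: "walk G p" "hd p = x" "last p = u" "set p \<subseteq> ?A" "triples ?Q p" "u \<notin> Z"
      by blast
    have "(u, w) \<in> uedges (augmented H)" "w \<notin> Z" using step.hyps(2) by auto
    then obtain q where q: "walk H q" "hd q = u" "last q = w" "triples (meets H) q"
      by (auto simp: augmented_edge_iff)
    obtain q' where q': "q = u # q'" using q(1,2) by (cases q) (auto simp: walk_def)
    obtain p' where p': "p = p' @ [u]" using p(1,3) by (cases p rule: rev_cases) (auto simp: walk_def)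
    have "set q \<subseteq> nodes G" "set q \<subseteq> ?A" using q(1) unfolding walk_def H by auto
    moreover have "successively (adjacent G) q"
      using q(1) unfolding walk_def H by (auto simp: adjacent_induced elim!: successively_mono)
    ultimately have w: "walk G (u # q')" and A: "set (u # q') \<subseteq> ?A" by (auto simp: walk_def q')
    have "triples ?Q (u # q')" using q(4) unfolding q'
      by (rule triples_mono) (auto simp: H arrowhead_induced)
    with p have "triples ?Q (p' @ u # q')" unfolding p' by (subst triples_append) auto
    moreover have "walk G (p' @ u # q')" using w p(1) unfolding p' by (subst walk_append) auto
    moreover have "hd (p' @ u # q') = x" "set (p' @ u # q') \<subseteq> ?A" using p A unfolding p'
      by (auto simp: hd_append split: if_splits)
    moreover have "last (p' @ u # q') = w" using q(3) unfolding q' by simp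
    ultimately show ?case using \<open>w \<notin> Z\<close> by blast
  qed
  then obtain p where p: "walk G p" "hd p = x" "last p = y" "set p \<subseteq> ?A" "triples ?Q p" by blast
  have "triples (\<lambda>a v b. if meets G a v b then v \<in> An G Z \<or> tied Z X v \<or> tied Z Y v else v \<notin> Z) p"
    using p(5) by (rule triples_mono)
      (use p(4) collider_tied[OF _ \<open>I \<subseteq> Z\<close>, of _ X Y] in \<open>auto simp: subset_iff\<close>)
  moreover have "tied Z X x" unfolding tied_def by (rule exI[of _ "[x]"]) (use assms in auto)
  moreover have "tied Z Y y" unfolding tied_def by (rule exI[of _ "[y]"]) (use assms in auto)
  ultimately show ?thesis using m_connected_if_tied_walk[of p Z X Y] p(1-3) by metis
qed

end

section \<open>Correctness of the reduction to vertex cuts\<close>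

lemma (in ancestral) Ant_superset: "S \<inter> nodes G \<subseteq> Ant G S"
proof
  fix v assume "v \<in> S \<inter> nodes G"
  then show "v \<in> Ant G S" unfolding Ant_iff by (intro conjI bexI[of _ v]) simp_all
qed

lemma (in ancestral) Ant_Ant: "Ant G (Ant G S) = Ant G S"
proof
  show "Ant G (Ant G S) \<subseteq> Ant G S"
  proof
    fix v assume "v \<in> Ant G (Ant G S)"
    then obtain u where "v \<in> nodes G" "u \<in> Ant G S" "(v, u) \<in> (dir G \<union> und G)\<^sup>*"
      unfolding Ant_iff[of v "Ant G S"] by blast
    then show "v \<in> Ant G S" unfolding Ant_iff[of _ S] by (meson rtrancl_trans)
  qed
  show "Ant G S \<subseteq> Ant G (Ant G S)"
    using Ant_superset[of "Ant G S"] by (auto simp: Ant_def anterior_iff[OF mixed])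
qed

locale separation_problem = ancestral G for G :: "'v mgraph" +
  fixes X Y I R :: "'v set" and w :: "'v \<Rightarrow> ereal"
  assumes input: "sep_input G X Y I R w"
begin

definition A :: "'v set" where
  "A = Ant G (X \<union> Y \<union> I)"

definition cut_graph :: "'v ext ugraph" where
  "cut_graph = step4 I (step2 X Y (step1 G X Y I))"

abbreviation cost :: "'v ext \<Rightarrow> ereal" where
  "cost \<equiv> step3 G X Y R w"

lemma input_simps: "X \<subseteq> nodes G" "Y \<subseteq> nodes G" "R \<subseteq> nodes G" "X \<inter> Y = {}" "X \<inter> R = {}" "Y \<inter> R = {}"
  "X \<noteq> {}" "Y \<noteq> {}" "I \<subseteq> R" "\<And>u. u \<in> R \<Longrightarrow> 0 < w u \<and> w u < \<infinity>"
  "\<And>u. u \<in> nodes G \<Longrightarrow> u \<notin> R \<Longrightarrow> w u = \<infinity>"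
  using input by (auto simp: sep_input_def)

lemma A_simps: "A \<subseteq> nodes G" "X \<subseteq> A" "Y \<subseteq> A" "I \<subseteq> A" "nodes G \<inter> A = A"
  using input_simps Ant_superset[of "X \<union> Y \<union> I"] unfolding A_def by (auto simp: Ant_iff)

abbreviation H1 :: "'v ugraph" where
  "H1 \<equiv> augmented (induced G A)"

lemma step1_eq: "step1 G X Y I = H1"
  by (simp add: step1_def A_def)

lemma unodes_H1: "unodes H1 = A"
  by (simp add: augmented_def A_simps)

lemma uedges_H1: "uedges H1 \<subseteq> A \<times> A"
proof -
  have "u \<in> A \<and> v \<in> A" if "(u, v) \<in> uedges H1" for u v
  proof -
    obtain p where "p \<noteq> []" "hd p = u" "last p = v" "set p \<subseteq> A"
      using \<open>(u, v) \<in> uedges H1\<close> by (auto simp: augmented_def path_def)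
    then show ?thesis using hd_in_set last_in_set by blast
  qed
  then show ?thesis by auto
qed

lemma unodes_cut_graph: "unodes cut_graph = Node ` (A - I) \<union> {Xm, Ym}"
  by (auto simp: cut_graph_def step4_def step2_def step1_eq unodes_H1)

lemma uedges_cut_graph: "uedges cut_graph =
    {(Node a, Node b) | a b. (a, b) \<in> uedges H1 \<and> a \<notin> I \<and> b \<notin> I} \<union>
    {(Xm, Node x) | x. x \<in> X} \<union> {(Node x, Xm) | x. x \<in> X} \<union>
    {(Ym, Node y) | y. y \<in> Y} \<union> {(Node y, Ym) | y. y \<in> Y}"
  using input_simps by (auto simp: cut_graph_def step4_def step2_def step1_eq)

abbreviation avoiding :: "'v set \<Rightarrow> ('v \<times> 'v) set" where
  "avoiding Z \<equiv> uedges H1 \<inter> (A - Z) \<times> (A - Z)"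

lemma vertex_cut_cut_graph_iff:
  assumes "C \<subseteq> unodes cut_graph - {Xm, Ym}"
  defines "Z \<equiv> {v. Node v \<in> C} \<union> I"
  shows "vertex_cut cut_graph Xm Ym C \<longleftrightarrow> (\<forall>x\<in>X - Z. \<forall>y\<in>Y - Z. (x, y) \<notin> (avoiding Z)\<^sup>*)"
proof -
  let ?E = "uedges cut_graph \<inter> (unodes cut_graph - C) \<times> (unodes cut_graph - C)"
  have "(Xm, Ym) \<in> ?E\<^sup>* \<longleftrightarrow> (\<exists>x\<in>X - Z. \<exists>y\<in>Y - Z. (x, y) \<in> (avoiding Z)\<^sup>*)" (is "_ \<longleftrightarrow> ?P")
  proof
    assume "(Xm, Ym) \<in> ?E\<^sup>*"
    \<comment> \<open>A walk in the cut graph may return to \<open>Xm\<close> or run through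
      \<open>Ym\<close>, so the invariant has three cases; \<open>?P\<close> absorbs all that
      happens once \<open>Ym\<close> has been reached.\<close>
    then have "?P \<or> Ym = (Xm :: 'v ext) \<or> (\<exists>v. Ym = Node v \<and> (\<exists>x\<in>X - Z. (x, v) \<in> (avoiding Z)\<^sup>*))"
    proof (induction rule: rtrancl_induct)
      case (step a b)
      have ab: "(a, b) \<in> uedges cut_graph" "a \<in> unodes cut_graph - C" "b \<in> unodes cut_graph - C"
        using step.hyps by auto
      from step.IH consider ?P | "a = Xm" |
        v x where "a = Node v" "x \<in> X - Z" "(x, v) \<in> (avoiding Z)\<^sup>*" by blast
      then show ?case
      proof cases
        case 2
        with ab obtain x where x: "b = Node x" "x \<in> X - Z"
          by (auto simp: uedges_cut_graph unodes_cut_graph Z_def)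
        then have "\<exists>x'\<in>X - Z. (x', x) \<in> (avoiding Z)\<^sup>*" by blast
        with x show ?thesis by blast
      next
        case 3
        from ab(2) 3 have v: "v \<in> A - Z" by (auto simp: unodes_cut_graph Z_def)
        show ?thesis
        proof (cases b)
          case (Node u)
          with ab 3 have "(v, u) \<in> avoiding Z"
            by (auto simp: uedges_cut_graph unodes_cut_graph Z_def)
          with 3 have "(x, u) \<in> (avoiding Z)\<^sup>*" by (auto intro: rtrancl_into_rtrancl)
          with 3 Node show ?thesis by blast
        next
          case Ym
          with ab 3 v have "v \<in> Y - Z" by (auto simp: uedges_cut_graph)
          with 3 show ?thesis by blast
        qed simp
      qed auto
    qed auto
    then show ?P by simp
  next
    assume ?P
    then obtain x y where xy: "x \<in> X - Z" "y \<in> Y - Z" "(x, y) \<in> (avoiding Z)\<^sup>*" by blast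
    from xy(3) have "(Node x, Node y) \<in> ?E\<^sup>*"
    proof (induction rule: rtrancl_induct)
      case (step u v)
      then have "(Node u, Node v) \<in> ?E"
        by (auto simp: uedges_cut_graph unodes_cut_graph Z_def)
      with step.IH show ?case by (rule rtrancl_into_rtrancl)
    qed simp
    moreover have "(Xm, Node x) \<in> ?E" "(Node y, Ym) \<in> ?E"
      using xy assms A_simps input_simps by (auto simp: uedges_cut_graph unodes_cut_graph Z_def)
    ultimately show "(Xm, Ym) \<in> ?E\<^sup>*"
      by (meson converse_rtrancl_into_rtrancl rtrancl_into_rtrancl)
  qed
  moreover have "Xm \<in> unodes cut_graph" "Ym \<in> unodes cut_graph"
    by (auto simp: unodes_cut_graph)
  ultimately show ?thesis using vertex_cut_iff[of Xm cut_graph Ym C] assms(1) by auto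
qed

text \<open>Nodes of \<open>Z\<close> outside \<open>A\<close> do not occur in the cut graph, so
  intersecting with \<open>A\<close> opens no new path. Disjointness from \<open>X\<close> and
  \<open>Y\<close> keeps all ends available.\<close>

lemma cut_if_separator:
  assumes "m_separator G X Y Z" "I \<subseteq> Z" "Z \<inter> (X \<union> Y) = {}"
  shows "vertex_cut cut_graph Xm Ym (Node ` (Z \<inter> A - I))"
proof -
  have Z: "{v. Node v \<in> Node ` (Z \<inter> A - I)} \<union> I = Z \<inter> A"
    using assms(2) A_simps by auto
  have "(x, y) \<notin> (avoiding Z)\<^sup>*" if "x \<in> X" "y \<in> Y" for x y
  proof
    assume "(x, y) \<in> (avoiding Z)\<^sup>*"
    then have "\<exists>x\<in>X. \<exists>y\<in>Y. m_connected G Z x y"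
      using that assms input_simps
      by (intro m_connected_if_augmented_reach[of x y "induced G A"])
        (auto simp: A_simps A_def[symmetric])
    with assms(1) show False by (auto simp: m_separator_def)
  qed
  moreover have "avoiding (Z \<inter> A) = avoiding Z" by auto
  ultimately show ?thesis
    by (subst vertex_cut_cut_graph_iff) (unfold Z, auto simp: unodes_cut_graph)
qed

text \<open>The cut and \<open>I\<close> lie in \<open>A\<close>, and \<open>A\<close> is closed
  under anteriors. With \<open>A\<close> itself in the place of \<open>S\<close>, an active path
  therefore runs inside the graph in which the cut was made.\<close>

lemma separator_if_cut:
  assumes "vertex_cut cut_graph Xm Ym C"
  shows "m_separator G X Y ({v. Node v \<in> C} \<union> I)" (is "m_separator G X Y ?Z")
proof -
  have C: "C \<subseteq> unodes cut_graph - {Xm, Ym}" using assms by (simp add: vertex_cut_def)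
  then have Z: "?Z \<subseteq> A" using A_simps by (auto simp: unodes_cut_graph)
  have "\<not> m_connected G ?Z x y" if xy: "x \<in> X" "y \<in> Y" for x y
  proof
    assume con: "m_connected G ?Z x y"
    have "(x, y) \<in> (avoiding ?Z)\<^sup>*"
    proof -
      have "Ant G A = A" unfolding A_def by (rule Ant_Ant)
      moreover have "x \<in> A" "y \<in> A" "?Z \<inter> nodes G \<subseteq> A" using xy A_simps(2,3) Z by auto
      ultimately show ?thesis using augmented_reach_if_m_connected[OF con, of A] A_simps(5) by simp
    qed
    moreover have "x \<notin> ?Z" "y \<notin> ?Z" using con by (auto simp: m_connected_iff)
    ultimately show False
      using assms xy unfolding vertex_cut_cut_graph_iff[OF C] by blast
  qed
  with Z A_simps(1) show ?thesis by (auto simp: m_separator_def)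
qed

lemma cost_finite_iff:
  assumes "v \<in> nodes G"
  shows "cost (Node v) < \<infinity> \<longleftrightarrow> v \<in> R" "v \<in> R \<Longrightarrow> cost (Node v) = w v"
  using assms input_simps by (auto simp: step3_def)

lemma finite_sum_iff:
  assumes "Z \<subseteq> nodes G"
  shows "sum w Z < \<infinity> \<longleftrightarrow> Z \<subseteq> R"
proof -
  have "finite Z" using assms finite_nodes by (rule finite_subset)
  then have "sum w Z = \<infinity> \<longleftrightarrow> (\<exists>v\<in>Z. w v = \<infinity>)" by (simp add: sum_Pinfty)
  moreover have "w v = \<infinity> \<longleftrightarrow> v \<notin> R" if "v \<in> Z" for v
    using that assms input_simps(10,11)[of v] by auto
  ultimately show ?thesis by (metis ereal_infty_less(1) subset_iff)
qed

lemma cut_cost: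
  assumes "vertex_cut cut_graph Xm Ym C"
  shows "sum cost C = sum (\<lambda>v. cost (Node v)) {v. Node v \<in> C}"
proof -
  have "C = Node ` {v. Node v \<in> C}"
    using assms by (auto simp: vertex_cut_def unodes_cut_graph)
  then show ?thesis by (metis (no_types, lifting) sum.reindex_cong ext.inject(1) inj_onI)
qed

lemma cost_of_separator_cut:
  assumes "Z \<subseteq> R"
  shows "sum cost (Node ` (Z \<inter> A - I)) \<le> sum w (Z - I)"
proof -
  have "finite Z" using assms input_simps(3) finite_nodes by (meson finite_subset)
  have "sum cost (Node ` (Z \<inter> A - I)) = sum (\<lambda>v. cost (Node v)) (Z \<inter> A - I)"
    by (subst sum.reindex) (auto simp: inj_on_def)
  also have "\<dots> = sum w (Z \<inter> A - I)"
    using assms input_simps(3) cost_finite_iff(2) by (intro sum.cong) auto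
  also have "\<dots> \<le> sum w (Z - I)"
    using assms \<open>finite Z\<close> input_simps(10) by (intro sum_mono2) (auto simp: less_imp_le)
  finally show ?thesis .
qed

theorem find_min_cost_sep_correct:
  assumes "find_min_cost_sep G X Y I R w res"
  shows "solves_min_cost_sep G X Y I R w res"
proof -
  obtain C where C: "min_vertex_cut cut_graph cost Xm Ym C"
    and res: "res = (if sum cost C < \<infinity> then Some ({v. Node v \<in> C} \<union> I) else None)"
    using assms unfolding find_min_cost_sep_def Let_def cut_graph_def by blast
  have cut: "vertex_cut cut_graph Xm Ym C" using C by (simp add: min_vertex_cut_def)
  \<comment> \<open>The share of \<open>I\<close> is left out on both sides, since the nodes of
    \<open>I\<close> are no longer in the cut graph.\<close>
  have min: "sum cost C \<le> sum w (Z - I)" if "m_separator G X Y Z" "I \<subseteq> Z" "Z \<subseteq> R" for Z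
  proof -
    have "sum cost C \<le> sum cost (Node ` (Z \<inter> A - I))"
    proof -
      have "Z \<inter> (X \<union> Y) = {}" using that(3) input_simps(5,6) by blast
      from cut_if_separator[OF that(1,2) this] C show ?thesis by (simp add: min_vertex_cut_def)
    qed
    with cost_of_separator_cut[OF that(3)] show ?thesis by simp
  qed
  have finI: "finite I" "sum w I < \<infinity>"
    using input_simps(3,9) finite_nodes finite_sum_iff[of I] by (meson finite_subset subset_trans)+
  show ?thesis
  proof (cases "sum cost C < \<infinity>")
    case True
    define D where "D = {v. Node v \<in> C}"
    have DA: "D \<subseteq> A - I" using cut by (auto simp: D_def vertex_cut_def unodes_cut_graph)
    then have "finite D" using A_simps(1) finite_nodes finite_subset by (metis Diff_subset order_trans)
    have "cost (Node v) \<noteq> \<infinity>" if "v \<in> D" for v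
      using True that \<open>finite D\<close> sum_Pinfty[of "\<lambda>v. cost (Node v)" D]
      unfolding cut_cost[OF cut] D_def[symmetric] by auto
    then have DR: "D \<subseteq> R"
      using DA A_simps(1) cost_finite_iff(1) by (metis DiffD1 ereal_infty_less(1) subset_iff)
    have sumC: "sum cost C = sum w D"
      unfolding cut_cost[OF cut] D_def[symmetric]
      using DR input_simps(3) cost_finite_iff(2) by (intro sum.cong) auto
    have "\<not> sum w Z' < sum w (D \<union> I)" if Z': "m_separator G X Y Z'" "I \<subseteq> Z'" for Z'
    proof
      assume less: "sum w Z' < sum w (D \<union> I)"
      have Zn: "Z' \<subseteq> nodes G" using Z' by (simp add: m_separator_def)
      then have "finite Z'" using finite_nodes by (rule finite_subset)
      \<comment> \<open>Only separators inside \<open>R\<close> have been compared with the cut; a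
        cheaper competitor has finite cost and is therefore one of them.\<close>
      have "sum w Z' < \<infinity>" using less by (cases "sum w Z' = \<infinity>") auto
      then have "Z' \<subseteq> R" using finite_sum_iff[OF Zn] by simp
      have "sum w (D \<union> I) = sum w D + sum w I"
        using DA \<open>finite D\<close> finI by (intro sum.union_disjoint) auto
      also have "\<dots> \<le> sum w (Z' - I) + sum w I"
        using min[OF Z' \<open>Z' \<subseteq> R\<close>] sumC by (intro add_right_mono) simp
      also have "\<dots> = sum w Z'"
        using sum.subset_diff[OF Z'(2) \<open>finite Z'\<close>, of w] by simp
      finally show False using less by simp
    qed
    moreover have "m_separator G X Y (D \<union> I)" using separator_if_cut[OF cut] by (simp add: D_def)
    ultimately show ?thesis
      using True DR input_simps(9)
      by (auto simp: res solves_min_cost_sep_def I_minimum_def D_def[symmetric])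
  next
    case False
    \<comment> \<open>An admissible answer would have finite cost and induce a cut of finite
      cost.\<close>
    have "\<not> (I_minimum G X Y I w Z \<and> I \<subseteq> Z \<and> Z \<subseteq> R)" for Z
    proof
      assume Z: "I_minimum G X Y I w Z \<and> I \<subseteq> Z \<and> Z \<subseteq> R"
      then have "sum cost C \<le> sum w (Z - I)" by (intro min) (auto simp: I_minimum_def)
      moreover have "sum w (Z - I) < \<infinity>" using Z input_simps(3) finite_sum_iff[of "Z - I"] by auto
      ultimately show False using False by (metis order_le_less_trans)
    qed
    with False show ?thesis by (auto simp: res solves_min_cost_sep_def)
  qed
qed

end

section \<open>Edges of the augmented graph via bidirected components\<close>

text \<open>The list is shortened until it is free of repetitions and avoids \<open>u\<close> and
  \<open>w\<close>. If \<open>u\<close> occurs in it, everything up to \<open>u\<close> can go,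
  because the edge after \<open>u\<close> is bidirected and points into the next node; if nothing
  follows, \<open>w\<close> points into \<open>u\<close> and the two are adjacent. The same holds
  for \<open>w\<close> from the other end.\<close>

lemma reach_via_bid_imp_augmented:
  assumes "vs \<noteq> []" "successively (\<lambda>a b. (a, b) \<in> bid H) vs" "arrowhead H u (hd vs)"
    "arrowhead H w (last vs)" "u \<noteq> w" "mixed_graph H"
  shows "(u, w) \<in> uedges (augmented H)"
  using assms(1-4)
proof (induction vs rule: length_induct)
  case (1 vs)
  have symb: "(a, b) \<in> bid H \<longleftrightarrow> (b, a) \<in> bid H" for a b
    using assms(6) by (auto simp: mixed_graph_def dest: symD)
  have nodes: "a \<in> nodes H \<and> b \<in> nodes H" if "arrowhead H a b" for a b
    using assms(6) that by (auto simp: mixed_graph_def arrowhead_def)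
  have adj: "adjacent H a b" "adjacent H b a" if "arrowhead H a b" for a b
    using that symb by (auto simp: adjacent_def arrowhead_def)
  have bid_arr: "arrowhead H a b" "arrowhead H b a" if "(a, b) \<in> bid H" for a b
    using that symb by (auto simp: arrowhead_def)
  have edge: "(u, w) \<in> uedges (augmented H)" if "adjacent H u w" "u \<in> nodes H" "w \<in> nodes H"
    unfolding augmented_edge_iff using that assms(5)
    by (intro conjI exI[of _ "[u, w]"]) (auto simp: walk_def)
  consider "\<not> distinct vs" | "u \<in> set vs" | "w \<in> set vs" | "distinct vs" "u \<notin> set vs" "w \<notin> set vs"
    by blast
  then show ?case
  proof cases
    case 1
    then obtain as v bs cs where vs: "vs = as @ v # bs @ v # cs"
      using not_distinct_decomp[of vs] by auto
    with "1.prems" show ?thesis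
      by (intro "1.IH"[rule_format, of "as @ v # cs"])
        (auto simp: successively_append_iff successively_Cons hd_append split: if_splits)
  next
    case 2
    then obtain as bs where vs: "vs = as @ u # bs" by (meson split_list)
    show ?thesis
    proof (cases bs)
      case Nil
      with vs "1.prems" adj nodes show ?thesis by (intro edge) auto
    next
      case (Cons b bs')
      with vs "1.prems" bid_arr show ?thesis
        by (intro "1.IH"[rule_format, of bs]) (auto simp: successively_append_iff)
    qed
  next
    case 3
    then obtain as bs where vs: "vs = as @ w # bs" by (meson split_list)
    show ?thesis
    proof (cases as rule: rev_cases)
      case Nil
      with vs "1.prems" adj nodes show ?thesis by (intro edge) auto
    next
      case (snoc as' a)
      with vs "1.prems" bid_arr show ?thesis
        by (intro "1.IH"[rule_format, of as]) (auto simp: successively_append_iff hd_append)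
    qed
  next
    case 4
    have m: "triples (meets H) (vs @ [w])" "triples (meets H) (u # vs @ [w])"
    proof -
      have "triples (meets H) (u # vs @ [w])"
        using "1.prems"
      proof (induction vs arbitrary: u)
        case (Cons v vs)
        show ?case
        proof (cases vs)
          case Nil
          with Cons.prems show ?thesis by auto
        next
          case (Cons v' vs')
          with Cons.prems bid_arr have "arrowhead H v' v" "arrowhead H v v'" by auto
          with Cons.prems Cons.IH[of v] Cons show ?thesis by auto
        qed
      qed simp
      then show "triples (meets H) (u # vs @ [w])" "triples (meets H) (vs @ [w])"
        by (cases vs; auto; cases "tl vs"; auto)+
    qed
    have "set vs \<subseteq> nodes H"
      using set_subset_if_successively[OF "1.prems"(2,1), of "nodes H"] nodes "1.prems"(3) assms(6)
      by (auto simp: mixed_graph_def)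
    moreover have "successively (adjacent H) (u # vs @ [w])"
      using "1.prems" adj
      by (auto simp: successively_append_iff successively_Cons adjacent_def elim!: successively_mono)
    ultimately show ?thesis
      unfolding augmented_edge_iff using 4 m(2) assms(5) nodes "1.prems"(3,4)
      by (intro conjI exI[of _ "u # vs @ [w]"]) (auto simp: walk_def)
  qed
qed

text \<open>Consecutive colliders point at each other, so the inner edges of a collider path are
  bidirected. The edges thus reduce to one closure and two compositions of relations, all computable
  in cubic time.\<close>

lemma uedges_augmented:
  assumes "mixed_graph H" and "\<And>a b. arrowhead H a b \<Longrightarrow> arrowhead H b a \<Longrightarrow> (a, b) \<in> bid H"
  shows "(u, w) \<in> uedges (augmented H) \<longleftrightarrow> u \<noteq> w \<and> (adjacent H u w \<or>
    (\<exists>a b. arrowhead H u a \<and> (a, b) \<in> (bid H)\<^sup>* \<and> arrowhead H w b))"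
proof
  assume "(u, w) \<in> uedges (augmented H)"
  then obtain p where p: "u \<noteq> w" "walk H p" "hd p = u" "last p = w" "triples (meets H) p"
    by (auto simp: augmented_edge_iff)
  obtain q where pq: "p = u # q" using p by (cases p) (auto simp: walk_def)
  obtain vs where q: "q = vs @ [w]" using p pq by (cases q rule: rev_cases) (auto split: if_splits)
  have "(\<exists>a b. arrowhead H u a \<and> (a, b) \<in> (bid H)\<^sup>* \<and> arrowhead H w b)" if "vs \<noteq> []"
  proof -
    have "triples (meets H) (u # vs @ [w])" using p pq q by simp
    then have "arrowhead H u (hd vs) \<and> (hd vs, last vs) \<in> (bid H)\<^sup>* \<and> arrowhead H w (last vs)"
      using that
    proof (induction vs arbitrary: u)
      case (Cons v vs)
      show ?case
      proof (cases vs)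
        case Nil
        with Cons.prems show ?thesis by auto
      next
        case (Cons v' vs')
        with Cons.prems Cons.IH[of v] have IH: "arrowhead H v v'" "(v', last vs) \<in> (bid H)\<^sup>*"
          "arrowhead H w (last vs)" and u: "arrowhead H u v" "arrowhead H v' v" by auto
        have "(v, v') \<in> bid H" using IH(1) u(2) by (rule assms(2))
        with IH u Cons show ?thesis by (auto intro: converse_rtrancl_into_rtrancl)
      qed
    qed simp
    then show ?thesis by blast
  qed
  moreover have "adjacent H u w" if "vs = []" using p pq q that by (auto simp: walk_def)
  ultimately show "u \<noteq> w \<and> (adjacent H u w \<or>
    (\<exists>a b. arrowhead H u a \<and> (a, b) \<in> (bid H)\<^sup>* \<and> arrowhead H w b))" using p(1) by blast
next
  assume *: "u \<noteq> w \<and> (adjacent H u w \<or>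
    (\<exists>a b. arrowhead H u a \<and> (a, b) \<in> (bid H)\<^sup>* \<and> arrowhead H w b))"
  show "(u, w) \<in> uedges (augmented H)"
  proof (cases "adjacent H u w")
    case True
    then have "u \<in> nodes H" "w \<in> nodes H" using assms by (auto simp: mixed_graph_def adjacent_def)
    with True * show ?thesis unfolding augmented_edge_iff
      by (intro conjI exI[of _ "[u, w]"]) (auto simp: walk_def)
  next
    case False
    with * obtain a b where ab: "arrowhead H u a" "(a, b) \<in> (bid H)\<^sup>*" "arrowhead H w b" by blast
    then obtain vs where "vs \<noteq> []" "hd vs = a" "last vs = b" "successively (\<lambda>a b. (a, b) \<in> bid H) vs"
      using rtrancl_imp_distinct_walk by metis
    with ab * assms(1) show ?thesis by (intro reach_via_bid_imp_augmented[of vs]) auto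
  qed
qed

section \<open>Timed program verification\<close>

text \<open>Existence of a run is total correctness, as programs are deterministic. The
  postcondition also sees the running time, so that time and result are derived together.\<close>

definition wp :: "com \<Rightarrow> store \<Rightarrow> (store \<Rightarrow> nat \<Rightarrow> bool) \<Rightarrow> bool" where
  "wp c s Q \<longleftrightarrow> (\<exists>t s'. exec c s t s' \<and> Q s' t)"

lemma wp_simps [simp]:
  "wp Skip s Q \<longleftrightarrow> Q s 1"
  "wp (NAssign x e) s Q \<longleftrightarrow> Q (s\<lparr>nvar := (nvar s)(x := nval e s)\<rparr>) 1"
  "wp (NStore a i j e) s Q \<longleftrightarrow>
     Q (s\<lparr>narr := upd2 (narr s) a (nval i s) (nval j s) (nval e s)\<rparr>) 1"
  "wp (RAssign x r) s Q \<longleftrightarrow> Q (s\<lparr>rvar := (rvar s)(x := rval r s)\<rparr>) 1"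
  "wp (RStore a i j r) s Q \<longleftrightarrow>
     Q (s\<lparr>rarr := upd2 (rarr s) a (nval i s) (nval j s) (rval r s)\<rparr>) 1"
  "wp (Seq c d) s Q \<longleftrightarrow> wp c s (\<lambda>s' t. wp d s' (\<lambda>s'' t'. Q s'' (t + t')))"
  unfolding wp_def by (fastforce intro: exec.intros elim: exec_elims)+

lemma wp_Cond [simp]:
  "wp (Cond b c d) s Q \<longleftrightarrow>
     (if bval b s then wp c s (\<lambda>s' t. Q s' (Suc t)) else wp d s (\<lambda>s' t. Q s' (Suc t)))"
  unfolding wp_def
  by (cases "bval b s") (fastforce intro: exec_CondTrue exec_CondFalse elim: exec_elims)+

text \<open>\<open>nw\<close>, \<open>aw\<close>, \<open>rw\<close> and \<open>raw\<close> collect the variables and arrays of naturals, and the variables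
  and arrays of reals, that a program may write.\<close>

primrec nw :: "com \<Rightarrow> name set" where
  "nw Skip = {}" | "nw (NAssign x e) = {x}" | "nw (NStore a i j e) = {}" | "nw (RAssign x r) = {}"
| "nw (RStore a i j r) = {}" | "nw (Seq c d) = nw c \<union> nw d" | "nw (Cond b c d) = nw c \<union> nw d"
| "nw (While b c) = nw c"

primrec aw :: "com \<Rightarrow> name set" where
  "aw Skip = {}" | "aw (NAssign x e) = {}" | "aw (NStore a i j e) = {a}" | "aw (RAssign x r) = {}"
| "aw (RStore a i j r) = {}" | "aw (Seq c d) = aw c \<union> aw d" | "aw (Cond b c d) = aw c \<union> aw d"
| "aw (While b c) = aw c"

primrec rw :: "com \<Rightarrow> name set" where
  "rw Skip = {}" | "rw (NAssign x e) = {}" | "rw (NStore a i j e) = {}" | "rw (RAssign x r) = {x}"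
| "rw (RStore a i j r) = {}" | "rw (Seq c d) = rw c \<union> rw d" | "rw (Cond b c d) = rw c \<union> rw d"
| "rw (While b c) = rw c"

primrec raw :: "com \<Rightarrow> name set" where
  "raw Skip = {}" | "raw (NAssign x e) = {}" | "raw (NStore a i j e) = {}" | "raw (RAssign x r) = {}"
| "raw (RStore a i j r) = {a}" | "raw (Seq c d) = raw c \<union> raw d" | "raw (Cond b c d) = raw c \<union> raw d"
| "raw (While b c) = raw c"

definition unchanged :: "com \<Rightarrow> store \<Rightarrow> store \<Rightarrow> bool" where
  "unchanged c s s' \<longleftrightarrow> (\<forall>x. x \<notin> nw c \<longrightarrow> nvar s' x = nvar s x) \<and> (\<forall>x. x \<notin> aw c \<longrightarrow> narr s' x = narr s x) \<and>
     (\<forall>x. x \<notin> rw c \<longrightarrow> rvar s' x = rvar s x) \<and> (\<forall>x. x \<notin> raw c \<longrightarrow> rarr s' x = rarr s x)"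

lemma upd2_simps [simp]:
  "upd2 A a i j x a = (A a)(i := (A a i)(j := x))"
  "b \<noteq> a \<Longrightarrow> upd2 A a i j x b = A b"
  by (auto simp: upd2_def)

lemma exec_unchanged: "exec c s t s' \<Longrightarrow> unchanged c s s'"
  by (induction rule: exec.induct) (auto simp: unchanged_def)

lemma unchanged_refl: "unchanged c s s"
  by (simp add: unchanged_def)

lemma unchanged_trans: "unchanged c s s' \<Longrightarrow> unchanged c s' s'' \<Longrightarrow> unchanged c s s''"
  by (simp add: unchanged_def)

text \<open>The second premise gets \<open>unchanged\<close> for free. Each use of this rule thereby
  acts as a frame rule, and specifications need to mention only what a program writes.\<close>

lemma wp_mono:
  assumes "wp c s Q" "\<And>s' t. Q s' t \<Longrightarrow> unchanged c s s' \<Longrightarrow> Q' s' t"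
  shows "wp c s Q'"
  using assms exec_unchanged unfolding wp_def by blast

text \<open>The measure \<open>\<mu>\<close> pays for the running time, so it serves both as a termination argument and
  as the potential of an amortised analysis.\<close>

lemma wp_While:
  assumes "Inv s"
    and step: "\<And>s'. Inv s' \<Longrightarrow> bval b s' \<Longrightarrow> unchanged c s s' \<Longrightarrow>
      wp c s' (\<lambda>s'' t. Inv s'' \<and> t + 1 + \<mu> s'' \<le> \<mu> s')"
  shows "wp (While b c) s (\<lambda>s' t. Inv s' \<and> \<not> bval b s' \<and> t + \<mu> s' \<le> \<mu> s + 1)"
proof -
  have "wp (While b c) s' (\<lambda>s'' t. Inv s'' \<and> \<not> bval b s'' \<and> t + \<mu> s'' \<le> \<mu> s' + 1)"
    if "Inv s'" "unchanged c s s'" for s'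
    using that
  proof (induction "\<mu> s'" arbitrary: s' rule: less_induct)
    case less
    show ?case
    proof (cases "bval b s'")
      case True
      obtain t s'' where c: "exec c s' t s''" "Inv s''" "t + 1 + \<mu> s'' \<le> \<mu> s'"
        using step[OF less.prems(1) True less.prems(2)] by (auto simp: wp_def)
      have "wp (While b c) s'' (\<lambda>s t. Inv s \<and> \<not> bval b s \<and> t + \<mu> s \<le> \<mu> s'' + 1)"
        using c less.prems by (intro less.hyps) (auto intro: unchanged_trans exec_unchanged)
      then obtain t' s3 where "exec (While b c) s'' t' s3" "Inv s3" "\<not> bval b s3" "t' + \<mu> s3 \<le> \<mu> s'' + 1"
        by (auto simp: wp_def)
      with c True show ?thesis unfolding wp_def
        by (intro exI[of _ "Suc (t + t')"] exI[of _ s3]) (auto intro: exec_WhileTrue)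
    next
      case False
      with less.prems show ?thesis unfolding wp_def
        using exec_WhileFalse[OF False, of c] by (intro exI[of _ 1] exI[of _ s']) auto
    qed
  qed
  with assms(1) unchanged_refl show ?thesis by blast
qed

definition hoare :: "(store \<Rightarrow> bool) \<Rightarrow> com \<Rightarrow> nat \<Rightarrow> (store \<Rightarrow> bool) \<Rightarrow> bool" where
  "hoare P c k Q \<longleftrightarrow> (\<forall>s. P s \<longrightarrow> wp c s (\<lambda>s' t. Q s' \<and> t \<le> k))"

lemma hoareI:
  assumes "\<And>s. P s \<Longrightarrow> wp c s (\<lambda>s' t. Q s' \<and> t \<le> k)"
    and "\<And>s s'. P s \<Longrightarrow> unchanged c s s' \<Longrightarrow> Q s' \<Longrightarrow> Q' s'"
  shows "hoare P c k Q'"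
  unfolding hoare_def by (intro allI impI, rule wp_mono, erule assms(1)) (use assms(2) in blast)

lemma hoare_Seq:
  assumes "hoare P c k Q" "hoare Q d l R"
  shows "hoare P (Seq c d) (k + l) R"
proof -
  have "wp c s (\<lambda>s' t. wp d s' (\<lambda>s'' t'. R s'' \<and> t + t' \<le> k + l))" if "P s" for s
  proof (rule wp_mono)
    show "wp c s (\<lambda>s' t. Q s' \<and> t \<le> k)" using assms(1) that by (simp add: hoare_def)
    fix s' t assume "Q s' \<and> t \<le> k"
    moreover from this have "wp d s' (\<lambda>s'' t'. R s'' \<and> t' \<le> l)" using assms(2) by (simp add: hoare_def)
    ultimately show "wp d s' (\<lambda>s'' t'. R s'' \<and> t + t' \<le> k + l)" by (auto elim: wp_mono)
  qed
  then show ?thesis by (simp add: hoare_def)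
qed

section \<open>Counting loops and programs on matrices\<close>

abbreviation setn :: "name \<Rightarrow> nat \<Rightarrow> store \<Rightarrow> store" where
  "setn x k s \<equiv> s\<lparr>nvar := (nvar s)(x := k)\<rparr>"

definition For :: "name \<Rightarrow> name \<Rightarrow> com \<Rightarrow> com" where
  "For x y c = Seq (NAssign x (NConst 0))
     (While (NLess (NVar x) (NVar y)) (Seq c (NAssign x (NSuc (NVar x)))))"

lemma writes_For [simp]: "nw (For x y c) = insert x (nw c)" "aw (For x y c) = aw c"
  "rw (For x y c) = rw c" "raw (For x y c) = raw c"
  by (auto simp: For_def)

text \<open>Each iteration pays \<open>k\<close> from its own budget, the rest from the potential
  \<open>\<phi>\<close>. Of the constants, \<open>k + 2\<close> adds the loop test and the
  increment, and the final 2 is the initial assignment and the failing test. The invariant refers to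
  the state after the increment, hence \<open>setn\<close>.\<close>

lemma wp_For_amortised:
  assumes n: "nvar s y = n" and names: "x \<noteq> y" "x \<notin> nw c" "y \<notin> nw c"
    and init: "Inv 0 (setn x 0 s)"
    and step: "\<And>i s'. i < n \<Longrightarrow> nvar s' x = i \<Longrightarrow> nvar s' y = n \<Longrightarrow> Inv i s' \<Longrightarrow> unchanged (For x y c) s s' \<Longrightarrow>
      wp c s' (\<lambda>s'' t. Inv (Suc i) (setn x (Suc i) s'') \<and> t + \<phi> (setn x (Suc i) s'') \<le> \<phi> s' + k)"
  shows "wp (For x y c) s (\<lambda>s' t. Inv n s' \<and> t + \<phi> s' \<le> \<phi> (setn x 0 s) + n * (k + 2) + 2)"
proof -
  let ?b = "NLess (NVar x) (NVar y)" and ?c = "Seq c (NAssign x (NSuc (NVar x)))"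
  let ?s = "setn x 0 s"
  let ?J = "\<lambda>s'. nvar s' x \<le> n \<and> nvar s' y = n \<and> Inv (nvar s' x) s'"
  let ?m = "\<lambda>s'. \<phi> s' + (n - nvar s' x) * (k + 2)"
  have "wp (While ?b ?c) ?s (\<lambda>s' t. ?J s' \<and> \<not> bval ?b s' \<and> t + ?m s' \<le> ?m ?s + 1)"
  proof (rule wp_While)
    show "?J ?s" using n names init by simp
  next
    fix s' assume J: "?J s'" and b: "bval ?b s'" and u: "unchanged ?c ?s s'"
    have "unchanged (For x y c) s s'" using u names unfolding unchanged_def For_def by simp
    with J b have "wp c s' (\<lambda>s'' t. Inv (Suc (nvar s' x)) (setn x (Suc (nvar s' x)) s'') \<and>
        t + \<phi> (setn x (Suc (nvar s' x)) s'') \<le> \<phi> s' + k)"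
      by (intro step) auto
    then have "wp c s' (\<lambda>s'' t. ?J (setn x (Suc (nvar s'' x)) s'') \<and>
        t + 1 + 1 + ?m (setn x (Suc (nvar s'' x)) s'') \<le> ?m s')"
    proof (rule wp_mono)
      fix s'' t
      assume *: "Inv (Suc (nvar s' x)) (setn x (Suc (nvar s' x)) s'') \<and>
          t + \<phi> (setn x (Suc (nvar s' x)) s'') \<le> \<phi> s' + k" and "unchanged c s' s''"
      then have eq: "nvar s'' x = nvar s' x" "nvar s'' y = nvar s' y"
        using names by (auto simp: unchanged_def)
      have "(n - nvar s' x) * (k + 2) = (n - Suc (nvar s' x)) * (k + 2) + (k + 2)"
        using J b by (simp add: Suc_diff_Suc[symmetric])
      moreover have "?m (setn x (Suc (nvar s'' x)) s'') =
          \<phi> (setn x (Suc (nvar s' x)) s'') + (n - Suc (nvar s' x)) * (k + 2)"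
        using eq by simp
      ultimately have "t + 1 + 1 + ?m (setn x (Suc (nvar s'' x)) s'') \<le> ?m s'"
        using * by linarith
      moreover have "?J (setn x (Suc (nvar s'' x)) s'')"
        using * eq J b names by simp
      ultimately show "?J (setn x (Suc (nvar s'' x)) s'') \<and>
        t + 1 + 1 + ?m (setn x (Suc (nvar s'' x)) s'') \<le> ?m s'"
        by blast
    qed
    then show "wp ?c s' (\<lambda>s'' t. ?J s'' \<and> t + 1 + ?m s'' \<le> ?m s')" by simp
  qed
  then have "wp (While ?b ?c) ?s (\<lambda>s' t. Inv n s' \<and> 1 + t + \<phi> s' \<le> \<phi> ?s + n * (k + 2) + 2)"
    by (rule wp_mono) auto
  then show ?thesis by (simp add: For_def)
qed

lemma wp_For:
  assumes "nvar s y = n" "x \<noteq> y" "x \<notin> nw c" "y \<notin> nw c" "Inv 0 (setn x 0 s)"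
    and "\<And>i s'. i < n \<Longrightarrow> nvar s' x = i \<Longrightarrow> nvar s' y = n \<Longrightarrow> Inv i s' \<Longrightarrow> unchanged (For x y c) s s' \<Longrightarrow>
      wp c s' (\<lambda>s'' t. Inv (Suc i) (setn x (Suc i) s'') \<and> t \<le> k)"
  shows "wp (For x y c) s (\<lambda>s' t. Inv n s' \<and> t \<le> n * (k + 2) + 2)"
  using wp_For_amortised[of s y n x c Inv "\<lambda>_. 0" k] assms by simp

definition Exists :: "name \<Rightarrow> name \<Rightarrow> name \<Rightarrow> bexp \<Rightarrow> com" where
  "Exists x k y b = Seq (NAssign x (NConst 0)) (For k y (Cond b (NAssign x (NConst 1)) Skip))"

lemma writes_Exists [simp]: "nw (Exists x k y b) = {k, x}" "aw (Exists x k y b) = {}"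
  "rw (Exists x k y b) = {}" "raw (Exists x k y b) = {}"
  by (auto simp: Exists_def)

lemma wp_Exists:
  assumes n: "nvar s y = n" and names: "x \<noteq> y" "x \<noteq> k" "k \<noteq> y"
    and b: "\<And>i s'. i < n \<Longrightarrow> nvar s' k = i \<Longrightarrow> unchanged (Exists x k y b) s s' \<Longrightarrow> bval b s' \<longleftrightarrow> P i"
  shows "wp (Exists x k y b) s (\<lambda>s' t. nvar s' x = of_bool (\<exists>i<n. P i) \<and> t \<le> n * 4 + 3)"
proof -
  let ?c = "For k y (Cond b (NAssign x (NConst 1)) Skip)"
  have "wp ?c (setn x 0 s) (\<lambda>s' t. nvar s' x = of_bool (\<exists>i<n. P i) \<and> t \<le> n * (2 + 2) + 2)"
  proof (rule wp_For[where Inv = "\<lambda>j s'. nvar s' x = of_bool (\<exists>i<j. P i)"])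
    fix i s' assume i: "i < n" "nvar s' k = i" and inv: "nvar s' x = of_bool (\<exists>j<i. P j)"
      and u: "unchanged ?c (setn x 0 s) s'"
    have "bval b s' \<longleftrightarrow> P i" using i u by (intro b) (auto simp: unchanged_def Exists_def)
    with inv names show "wp (Cond b (NAssign x (NConst 1)) Skip) s' (\<lambda>s'' t.
        nvar (setn k (Suc i) s'') x = of_bool (\<exists>j<Suc i. P j) \<and> t \<le> 2)"
      by (auto simp: less_Suc_eq)
  qed (use n names in auto)
  then have "wp ?c (setn x 0 s) (\<lambda>s' t. nvar s' x = of_bool (\<exists>i<n. P i) \<and> 1 + t \<le> n * 4 + 3)"
    by (rule wp_mono) auto
  then show ?thesis by (simp add: Exists_def)
qed

definition Fill1 :: "name \<Rightarrow> name \<Rightarrow> name \<Rightarrow> com \<Rightarrow> nexp \<Rightarrow> com" where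
  "Fill1 i y a c e = For i y (Seq c (NStore a (NVar i) (NConst 0) e))"

lemma writes_Fill1 [simp]: "nw (Fill1 i y a c e) = insert i (nw c)" "aw (Fill1 i y a c e) = insert a (aw c)"
  "rw (Fill1 i y a c e) = rw c" "raw (Fill1 i y a c e) = raw c"
  by (auto simp: Fill1_def)

text \<open>The body may rely on the entries from \<open>p\<close> on being old, so a vector can be
  overwritten by a function of itself.\<close>

lemma wp_Fill1:
  assumes n: "nvar s y = n" and names: "i \<noteq> y" "i \<notin> nw c" "y \<notin> nw c" "a \<notin> aw c"
    and c: "\<And>p s'. p < n \<Longrightarrow> nvar s' i = p \<Longrightarrow> nvar s' y = n \<Longrightarrow> unchanged (Fill1 i y a c e) s s' \<Longrightarrow>
      (\<And>q. \<not> q < p \<Longrightarrow> narr s' a q 0 = narr s a q 0) \<Longrightarrow>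
      wp c s' (\<lambda>s'' t. nval e s'' = F p \<and> t \<le> k)"
  shows "wp (Fill1 i y a c e) s (\<lambda>s' t. (\<forall>p<n. narr s' a p 0 = F p) \<and> t \<le> n * (k + 3) + 2)"
proof -
  let ?Inv = "\<lambda>p (s' :: store). \<forall>q. narr s' a q 0 = (if q < p then F q else narr s a q 0)"
  have "wp (Fill1 i y a c e) s (\<lambda>s' t. ?Inv n s' \<and> t \<le> n * (k + 1 + 2) + 2)"
    unfolding Fill1_def
  proof (rule wp_For[where Inv = ?Inv])
    fix p s' assume p: "p < n" "nvar s' i = p" "nvar s' y = n" and inv: "?Inv p s'"
      and u: "unchanged (For i y (Seq c (NStore a (NVar i) (NConst 0) e))) s s'"
    have "wp c s' (\<lambda>s'' t. nval e s'' = F p \<and> t \<le> k)"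
      using u inv by (intro c[OF p]) (auto simp: Fill1_def)
    then have "wp c s' (\<lambda>s'' t. wp (NStore a (NVar i) (NConst 0) e) s'' (\<lambda>s3 t'.
      ?Inv (Suc p) (setn i (Suc p) s3) \<and> t + t' \<le> k + 1))"
      by (rule wp_mono) (use inv p names in \<open>auto simp: unchanged_def less_Suc_eq\<close>)
    then show "wp (Seq c (NStore a (NVar i) (NConst 0) e)) s' (\<lambda>s'' t.
      ?Inv (Suc p) (setn i (Suc p) s'') \<and> t \<le> k + 1)" by simp
  qed (use n names in auto)
  then show ?thesis by (rule wp_mono) (auto simp: numeral_3_eq_3)
qed

definition Fill2 :: "name \<Rightarrow> name \<Rightarrow> name \<Rightarrow> name \<Rightarrow> com \<Rightarrow> nexp \<Rightarrow> com" where
  "Fill2 i j y a c e = For i y (For j y (Seq c (NStore a (NVar i) (NVar j) e)))"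

lemma writes_Fill2 [simp]: "nw (Fill2 i j y a c e) = {i, j} \<union> nw c"
  "aw (Fill2 i j y a c e) = insert a (aw c)"
  "rw (Fill2 i j y a c e) = rw c" "raw (Fill2 i j y a c e) = raw c"
  by (auto simp: Fill2_def)

text \<open>The body is told exactly which entries are new and which are old. Warshall's update in
  place depends on this, as it reads entries of both kinds.\<close>

lemma wp_Fill2:
  assumes n: "nvar s y = n"
    and names: "i \<noteq> j" "i \<noteq> y" "j \<noteq> y" "i \<notin> nw c" "j \<notin> nw c" "y \<notin> nw c" "a \<notin> aw c"
    and c: "\<And>p q s'. p < n \<Longrightarrow> q < n \<Longrightarrow> nvar s' i = p \<Longrightarrow> nvar s' j = q \<Longrightarrow> nvar s' y = n \<Longrightarrow>
      unchanged (Fill2 i j y a c e) s s' \<Longrightarrow>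
      (\<And>p' q'. narr s' a p' q' =
        (if p' < n \<and> q' < n \<and> (p' < p \<or> p' = p \<and> q' < q) then F p' q' else narr s a p' q')) \<Longrightarrow>
      wp c s' (\<lambda>s'' t. nval e s'' = F p q \<and> t \<le> k)"
  shows "wp (Fill2 i j y a c e) s (\<lambda>s' t. (\<forall>p<n. \<forall>q<n. narr s' a p q = F p q) \<and>
    t \<le> n * (n * (k + 3) + 4) + 2)"
proof -
  let ?Inv = "\<lambda>p q (s' :: store). \<forall>p' q'. narr s' a p' q' =
    (if p' < n \<and> q' < n \<and> (p' < p \<or> p' = p \<and> q' < q) then F p' q' else narr s a p' q')"
  let ?b = "Seq c (NStore a (NVar i) (NVar j) e)"
  have "wp (Fill2 i j y a c e) s (\<lambda>s' t. ?Inv n 0 s' \<and> t \<le> n * ((n * (k + 1 + 2) + 2) + 2) + 2)"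
    unfolding Fill2_def
  proof (rule wp_For[where Inv = "\<lambda>p. ?Inv p 0"])
    fix p s' assume p: "p < n" "nvar s' i = p" "nvar s' y = n" and inv: "?Inv p 0 s'"
      and u: "unchanged (For i y (For j y ?b)) s s'"
    have "wp (For j y ?b) s' (\<lambda>s'' t. (nvar s'' i = p \<and> ?Inv p n s'') \<and> t \<le> n * (k + 1 + 2) + 2)"
    proof (rule wp_For[where Inv = "\<lambda>q s''. nvar s'' i = p \<and> ?Inv p q s''"])
      fix q s'' assume q: "q < n" "nvar s'' j = q" "nvar s'' y = n"
        and inv': "nvar s'' i = p \<and> ?Inv p q s''" and u': "unchanged (For j y ?b) s' s''"
      have "wp c s'' (\<lambda>s'' t. nval e s'' = F p q \<and> t \<le> k)"
      proof (rule c)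
        show "unchanged (Fill2 i j y a c e) s s''"
          using u u' by (auto simp: unchanged_def Fill2_def)
      qed (use p q inv' in auto)
      then have "wp c s'' (\<lambda>s3 t. wp (NStore a (NVar i) (NVar j) e) s3 (\<lambda>s4 t'.
          (nvar (setn j (Suc q) s4) i = p \<and> ?Inv p (Suc q) (setn j (Suc q) s4)) \<and> t + t' \<le> k + 1))"
        by (rule wp_mono)
          (use inv' p(1) q names in \<open>auto simp: unchanged_def less_Suc_eq\<close>)
      then show "wp ?b s'' (\<lambda>s3 t.
          (nvar (setn j (Suc q) s3) i = p \<and> ?Inv p (Suc q) (setn j (Suc q) s3)) \<and> t \<le> k + 1)"
        by simp
    qed (use p inv names in auto)
    then show "wp (For j y ?b) s' (\<lambda>s'' t. ?Inv (Suc p) 0 (setn i (Suc p) s'') \<and> t \<le> n * (k + 1 + 2) + 2)"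
      by (rule wp_mono) (auto simp: less_Suc_eq)
  qed (use n names in auto)
  then show ?thesis by (rule wp_mono) (auto simp: numeral_eq_Suc)
qed

text \<open>\<open>NEq\<close> is equality of natural numbers, not inequality: the entry is tested
  for being 1.\<close>

abbreviation tst :: "name \<Rightarrow> nexp \<Rightarrow> nexp \<Rightarrow> bexp" where
  "tst a i j \<equiv> NEq (NArr a i j) (NConst 1)"

abbreviation rel :: "name \<Rightarrow> name \<Rightarrow> name \<Rightarrow> bexp" where
  "rel a x y \<equiv> tst a (NVar x) (NVar y)"

abbreviation mem :: "name \<Rightarrow> name \<Rightarrow> bexp" where
  "mem a x \<equiv> tst a (NVar x) (NConst 0)"

abbreviation BOr :: "bexp \<Rightarrow> bexp \<Rightarrow> bexp" where
  "BOr b c \<equiv> BNot (BAnd (BNot b) (BNot c))"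

abbreviation SetIf :: "name \<Rightarrow> bexp \<Rightarrow> com" where
  "SetIf x b \<equiv> Cond b (NAssign x (NConst 1)) (NAssign x (NConst 0))"

section \<open>Transitive closure by Warshall's algorithm\<close>

fun warshall :: "(nat \<Rightarrow> nat \<Rightarrow> bool) \<Rightarrow> nat \<Rightarrow> nat \<Rightarrow> nat \<Rightarrow> bool" where
  "warshall R 0 i j \<longleftrightarrow> R i j"
| "warshall R (Suc k) i j \<longleftrightarrow> warshall R k i j \<or> warshall R k i k \<and> warshall R k k j"

text \<open>Paths with inner nodes below \<open>k\<close> can be joined at such a node. Joining at
  the node added last is what the recursion provides, since the new disjunct adds nothing to its row
  and its column.\<close>

lemma warshall_trans:
  "m < k \<Longrightarrow> warshall R k i m \<Longrightarrow> warshall R k m j \<Longrightarrow> warshall R k i j"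
proof (induction k arbitrary: i j)
  case (Suc k)
  then show ?case by (cases "m = k") (auto simp: less_Suc_eq)
qed simp

lemma warshall_mono: "R i j \<Longrightarrow> warshall R k i j"
  by (induction k) auto

text \<open>The recursion starts from \<open>R\<close> and never adds empty paths, so these must
  come from reflexivity of \<open>R\<close>.\<close>

lemma warshall_iff_rtrancl:
  assumes "\<And>i. i < n \<Longrightarrow> R i i" "i < n" "j < n"
  shows "warshall R n i j \<longleftrightarrow> (i, j) \<in> {(p, q). p < n \<and> q < n \<and> R p q}\<^sup>*" (is "_ \<longleftrightarrow> _ \<in> ?E\<^sup>*")
proof
  have "(p, q) \<in> ?E\<^sup>*" if "warshall R k p q" "k \<le> n" "p < n" "q < n" for k p q
    using that
  proof (induction k arbitrary: p q)
    case (Suc k)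
    then show ?case by (auto intro: rtrancl_trans[of _ k])
  qed auto
  then show "warshall R n i j \<Longrightarrow> (i, j) \<in> ?E\<^sup>*" using assms by blast
next
  assume "(i, j) \<in> ?E\<^sup>*"
  then show "warshall R n i j"
  proof (induction rule: rtrancl_induct)
    case base
    show ?case using assms by (auto intro: warshall_mono)
  next
    case (step p q)
    then show ?case by (auto intro: warshall_trans[of p] warshall_mono)
  qed
qed

definition Warshall :: "name \<Rightarrow> com" where
  "Warshall a = For ''k'' ''n'' (Fill2 ''i'' ''j'' ''n'' a
     (SetIf ''x'' (BOr (rel a ''i'' ''j'')
       (BAnd (rel a ''i'' ''k'') (rel a ''k'' ''j'')))) (NVar ''x''))"

lemma writes_Warshall [simp]: "nw (Warshall a) = {''k'', ''i'', ''j'', ''x''}" "aw (Warshall a) = {a}"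
  "rw (Warshall a) = {}" "raw (Warshall a) = {}"
  by (auto simp: Warshall_def)

lemma wp_Warshall:
  assumes n: "nvar s ''n'' = n" and R: "\<forall>p<n. \<forall>q<n. narr s a p q = of_bool (R p q)"
  shows "wp (Warshall a) s (\<lambda>s' t. (\<forall>p<n. \<forall>q<n. narr s' a p q = of_bool (warshall R n p q)) \<and>
    t \<le> n * (n * (n * 5 + 4) + 4) + 2)"
proof -
  let ?Inv = "\<lambda>k (s' :: store). \<forall>p<n. \<forall>q<n. narr s' a p q = of_bool (warshall R k p q)"
  let ?c = "SetIf ''x'' (BOr (rel a ''i'' ''j'')
       (BAnd (rel a ''i'' ''k'') (rel a ''k'' ''j'')))"
  have "wp (Warshall a) s (\<lambda>s' t. ?Inv n s' \<and> t \<le> n * ((n * (n * (2 + 3) + 4) + 2) + 2) + 2)"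
    unfolding Warshall_def
  proof (rule wp_For[where Inv = ?Inv])
    fix k s' assume k: "k < n" "nvar s' ''k'' = k" "nvar s' ''n'' = n" and inv: "?Inv k s'"
    have "wp (Fill2 ''i'' ''j'' ''n'' a ?c (NVar ''x'')) s' (\<lambda>s'' t.
        (\<forall>p<n. \<forall>q<n. narr s'' a p q = of_bool (warshall R (Suc k) p q)) \<and> t \<le> n * (n * (2 + 3) + 4) + 2)"
    proof (rule wp_Fill2)
      fix p q s'' assume pq: "p < n" "q < n" "nvar s'' ''i'' = p" "nvar s'' ''j'' = q"
        and u: "unchanged (Fill2 ''i'' ''j'' ''n'' a ?c (NVar ''x'')) s' s''"
        and a: "\<And>p' q'. narr s'' a p' q' = (if p' < n \<and> q' < n \<and> (p' < p \<or> p' = p \<and> q' < q)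
          then of_bool (warshall R (Suc k) p' q') else narr s' a p' q')"
      have "nvar s'' ''k'' = k" using u k by (simp add: unchanged_def)
      \<comment> \<open>phase \<open>k\<close> leaves row and column \<open>k\<close> as they are, so the update can be done in place\<close>
      moreover have "narr s'' a p q = of_bool (warshall R k p q)"
        "narr s'' a p k = of_bool (warshall R k p k)" "narr s'' a k q = of_bool (warshall R k k q)"
        using inv k(1) pq(1,2) by (auto simp: a)
      ultimately show "wp ?c s'' (\<lambda>s3 t. nval (NVar ''x'') s3 = of_bool (warshall R (Suc k) p q) \<and> t \<le> 2)"
        using pq by auto
    qed (use k in auto)
    then show "wp (Fill2 ''i'' ''j'' ''n'' a ?c (NVar ''x'')) s' (\<lambda>s'' t.
        ?Inv (Suc k) (setn ''k'' (Suc k) s'') \<and> t \<le> n * (n * (2 + 3) + 4) + 2)"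
      by (rule wp_mono) auto
  qed (use n R in auto)
  then show ?thesis by (rule wp_mono) (auto simp: algebra_simps)
qed

text \<open>\<open>E\<close> does not leave \<open>vs\<close>, so a walk can be traced through the
  indices. The diagonal is added on that side because Warshall's recursion needs a reflexive
  start.\<close>

lemma rtrancl_index:
  assumes "distinct vs" "E \<subseteq> set vs \<times> set vs" "i < length vs" "j < length vs"
  shows "(i, j) \<in> {(p, q). p < length vs \<and> q < length vs \<and> (p = q \<or> (vs ! p, vs ! q) \<in> E)}\<^sup>* \<longleftrightarrow>
    (vs ! i, vs ! j) \<in> E\<^sup>*" (is "_ \<in> ?F\<^sup>* \<longleftrightarrow> _")
proof
  assume "(i, j) \<in> ?F\<^sup>*"
  then show "(vs ! i, vs ! j) \<in> E\<^sup>*"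
    by (induction rule: rtrancl_induct) (auto intro: rtrancl_into_rtrancl)
next
  assume "(vs ! i, vs ! j) \<in> E\<^sup>*"
  then have "\<exists>q<length vs. vs ! j = vs ! q \<and> (i, q) \<in> ?F\<^sup>*"
  proof (induction rule: rtrancl_induct)
    case base
    show ?case using assms by auto
  next
    case (step y z)
    then obtain q where q: "q < length vs" "y = vs ! q" "(i, q) \<in> ?F\<^sup>*" by auto
    from step.hyps(2) assms(2) have "z \<in> set vs" by auto
    then obtain r where "r < length vs" "z = vs ! r" by (metis in_set_conv_nth)
    with step.hyps q(1,2) have "(q, r) \<in> ?F" by auto
    with q(3) have "(i, r) \<in> ?F\<^sup>*" by (rule rtrancl_into_rtrancl)
    with \<open>r < length vs\<close> \<open>z = vs ! r\<close> show ?case by blast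
  qed
  then obtain q where "q < length vs" "vs ! j = vs ! q" "(i, q) \<in> ?F\<^sup>*" by blast
  moreover from this assms(1,4) have "q = j" by (simp add: nth_eq_iff_index_eq)
  ultimately show "(i, j) \<in> ?F\<^sup>*" by simp
qed

section \<open>Steps 1 to 4\<close>

lemma wp_Seq:
  assumes "wp c s (\<lambda>s' t. Q s' \<and> t \<le> k)"
    and "\<And>s'. Q s' \<Longrightarrow> unchanged c s s' \<Longrightarrow> wp d s' (\<lambda>s'' t. Q' s'' \<and> t \<le> l)"
  shows "wp (Seq c d) s (\<lambda>s'' t. Q' s'' \<and> t \<le> k + l)"
proof -
  have "wp c s (\<lambda>s' t. wp d s' (\<lambda>s'' t'. Q' s'' \<and> t + t' \<le> k + l))"
    using assms(1)
  proof (rule wp_mono)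
    fix s' t assume "Q s' \<and> t \<le> k" "unchanged c s s'"
    then show "wp d s' (\<lambda>s'' t'. Q' s'' \<and> t + t' \<le> k + l)"
      using assms(2)[of s'] by (auto elim: wp_mono)
  qed
  then show ?thesis by simp
qed

definition FillB :: "name \<Rightarrow> name \<Rightarrow> bexp \<Rightarrow> com" where
  "FillB y a b = Fill2 ''i'' ''j'' y a (SetIf ''x'' b) (NVar ''x'')"

lemma writes_FillB [simp]: "nw (FillB y a b) = {''i'', ''j'', ''x''}" "aw (FillB y a b) = {a}"
  "rw (FillB y a b) = {}" "raw (FillB y a b) = {}"
  by (auto simp: FillB_def)

text \<open>The test may read the entry that is about to be overwritten; the edge matrix is extended
  and thinned out in place.\<close>

lemma wp_FillB:
  assumes n: "nvar s y = n" and y: "y \<notin> {''i'', ''j'', ''x''}"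
    and b: "\<And>p q s'. p < n \<Longrightarrow> q < n \<Longrightarrow> nvar s' ''i'' = p \<Longrightarrow> nvar s' ''j'' = q \<Longrightarrow>
      unchanged (FillB y a b) s s' \<Longrightarrow> narr s' a p q = narr s a p q \<Longrightarrow> bval b s' \<longleftrightarrow> P p q"
  shows "wp (FillB y a b) s (\<lambda>s' t. (\<forall>p<n. \<forall>q<n. narr s' a p q = of_bool (P p q)) \<and>
    t \<le> n * (n * 5 + 4) + 2)"
proof -
  have "wp (FillB y a b) s (\<lambda>s' t. (\<forall>p<n. \<forall>q<n. narr s' a p q = of_bool (P p q)) \<and>
    t \<le> n * (n * (2 + 3) + 4) + 2)"
    unfolding FillB_def
  proof (rule wp_Fill2)
    fix p q s'
    assume pq: "p < n" "q < n" "nvar s' ''i'' = p" "nvar s' ''j'' = q"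
      "unchanged (Fill2 ''i'' ''j'' y a (SetIf ''x'' b) (NVar ''x'')) s s'"
      and a: "\<And>p' q'. narr s' a p' q' = (if p' < n \<and> q' < n \<and> (p' < p \<or> p' = p \<and> q' < q)
        then of_bool (P p' q') else narr s a p' q')"
    from pq a[of p q] have "bval b s' \<longleftrightarrow> P p q" by (intro b) (auto simp: FillB_def)
    then show "wp (SetIf ''x'' b) s' (\<lambda>s'' t. nval (NVar ''x'') s'' = of_bool (P p q) \<and> t \<le> 2)"
      by simp
  qed (use n y in auto)
  then show ?thesis by simp
qed

lemma ex_index: "(\<exists>k<length vs. P (vs ! k)) \<longleftrightarrow> (\<exists>v\<in>set vs. P v)"
  by (metis in_set_conv_nth)

lemma wp_closure:
  assumes "nvar s ''n'' = length vs" "distinct vs" "E \<subseteq> set vs \<times> set vs"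
    and b: "\<And>p q s'. p < length vs \<Longrightarrow> q < length vs \<Longrightarrow> nvar s' ''i'' = p \<Longrightarrow> nvar s' ''j'' = q \<Longrightarrow>
      unchanged (FillB ''n'' a b) s s' \<Longrightarrow> bval b s' \<longleftrightarrow> p = q \<or> (vs ! p, vs ! q) \<in> E"
    and n: "n = length vs"
  shows "wp (Seq (FillB ''n'' a b) (Warshall a)) s (\<lambda>s' t. holds_rel vs a (E\<^sup>*) s' \<and>
    t \<le> (n * (n * 5 + 4) + 2) + (n * (n * (n * 5 + 4) + 4) + 2))"
proof (rule wp_Seq)
  let ?P = "\<lambda>p q. p = q \<or> (vs ! p, vs ! q) \<in> E"
  show "wp (FillB ''n'' a b) s (\<lambda>s' t. (\<forall>p<n. \<forall>q<n. narr s' a p q = of_bool (?P p q)) \<and>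
    t \<le> n * (n * 5 + 4) + 2)"
    by (rule wp_FillB) (use assms in auto)
  fix s' assume s': "\<forall>p<n. \<forall>q<n. narr s' a p q = of_bool (?P p q)" "unchanged (FillB ''n'' a b) s s'"
  have "wp (Warshall a) s' (\<lambda>s' t. (\<forall>p<n. \<forall>q<n. narr s' a p q = of_bool (warshall ?P n p q)) \<and>
    t \<le> n * (n * (n * 5 + 4) + 4) + 2)"
    by (rule wp_Warshall) (use s' assms(1) n in \<open>auto simp: unchanged_def\<close>)
  then show "wp (Warshall a) s' (\<lambda>s' t. holds_rel vs a (E\<^sup>*) s' \<and>
    t \<le> n * (n * (n * 5 + 4) + 4) + 2)"
    by (rule wp_mono)
      (use warshall_iff_rtrancl[of n ?P] rtrancl_index[OF assms(2,3)] in \<open>simp add: holds_rel_def n\<close>)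
qed

section \<open>Programs and time bounds for steps 1 to 4\<close>

abbreviation anterior_test :: bexp where
  "anterior_test \<equiv> BOr (NEq (NVar ''i'') (NVar ''j'')) (BOr (rel ''dir'' ''i'' ''j'') (rel
     ''und'' ''i'' ''j''))"

definition Anteriors :: com where
  "Anteriors = Seq (FillB ''n'' ''anc'' anterior_test)
    (Warshall ''anc'')"

abbreviation node_test :: bexp where
  "node_test \<equiv> BAnd (rel ''anc'' ''i'' ''k'') (BOr (mem ''X'' ''k'') (BOr (mem ''Y'' ''k'')
     (mem ''I'' ''k'')))"

definition Node_Set :: com where
  "Node_Set = Fill1 ''i'' ''n'' ''node'' (Exists ''x'' ''k'' ''n'' node_test) (NVar ''x'')"

abbreviation both_nodes :: bexp where
  "both_nodes \<equiv> BAnd (mem ''node'' ''i'') (mem ''node'' ''j'')"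

abbreviation district_test :: bexp where
  "district_test \<equiv> BOr (NEq (NVar ''i'') (NVar ''j'')) (BAnd both_nodes (rel ''bid'' ''i''
     ''j''))"

text \<open>A district is a connected component under bidirected edges, here of the subgraph induced
  on the anterior set.\<close>

definition Districts :: com where
  "Districts = Seq (FillB ''n'' ''con'' district_test) (Warshall ''con'')"

abbreviation arrowhead_test :: bexp where
  "arrowhead_test \<equiv> BAnd both_nodes (BOr (rel ''dir'' ''i'' ''j'') (rel ''bid'' ''i''
     ''j''))"

definition Arrowheads :: com where
  "Arrowheads = FillB ''n'' ''arr'' arrowhead_test"

abbreviation half_path_test :: bexp where
  "half_path_test \<equiv> BAnd (rel ''arr'' ''i'' ''k'') (rel ''con'' ''k'' ''j'')"

text \<open>The ends of collider paths are related by a product of three relations. Storing the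
  product of the first two avoids a doubly nested search for every pair of ends, which would take
  time of order \<open>n ^ 4\<close>.\<close>

definition Half_Paths :: com where
  "Half_Paths = Fill2 ''i'' ''j'' ''n'' ''mid'' (Exists ''x'' ''k'' ''n'' half_path_test) (NVar ''x'')"

abbreviation collider_path_test :: bexp where
  "collider_path_test \<equiv> BAnd (rel ''mid'' ''i'' ''k'') (rel ''arr'' ''j'' ''k'')"

abbreviation edge_test :: bexp where
  "edge_test \<equiv> BAnd (BNot (NEq (NVar ''i'') (NVar ''j''))) (BOr (NEq (NVar ''x'') (NConst
     1)) (BAnd both_nodes (BOr (BOr (rel ''dir'' ''i'' ''j'') (rel ''dir'' ''j'' ''i'')) (BOr (rel
     ''und'' ''i'' ''j'') (rel ''bid'' ''i'' ''j'')))))"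

definition Edges :: com where
  "Edges = Fill2 ''i'' ''j'' ''n'' ''edge'' (Seq (Exists ''x'' ''k'' ''n'' collider_path_test)
     (SetIf ''x'' edge_test)) (NVar ''x'')"

definition Step1 :: com where
  "Step1 = Seq Anteriors (Seq Node_Set (Seq Districts (Seq Arrowheads (Seq Half_Paths Edges))))"

definition time1 :: "nat \<Rightarrow> nat" where
  "time1 n = (n * (n * 5 + 4) + 2) + (n * (n * (n * 5 + 4) + 4) + 2) + ((n * (n * 4 + 6) + 2) +
     ((n * (n * 5 + 4) + 2) + (n * (n * (n * 5 + 4) + 4) + 2) + ((n * (n * 5 + 4) + 2) +
     ((n * (n * (n * 4 + 6) + 4) + 2) + (n * (n * (n * 4 + 8) + 4) + 2)))))"

text \<open>Indices \<open>n\<close> and \<open>n + 1\<close> stand for \<open>Xm\<close> and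
  \<open>Ym\<close>. The comparisons with \<open>n\<close> guard all uses of the old arrays, whose
  contents beyond the given nodes are arbitrary.\<close>

abbreviation extended_edge_test :: bexp where
  "extended_edge_test \<equiv> BOr (BAnd (BAnd (NLess (NVar ''i'') (NVar ''n'')) (NLess (NVar
     ''j'') (NVar ''n''))) (rel ''edge'' ''i'' ''j'')) (BOr (BAnd (NLess (NVar ''j'') (NVar
     ''n'')) (BOr (BAnd (NEq (NVar ''i'') (NVar ''n'')) (mem ''X'' ''j'')) (BAnd (NEq (NVar ''i'')
     (NSuc (NVar ''n''))) (mem ''Y'' ''j'')))) (BAnd (NLess (NVar ''i'') (NVar ''n'')) (BOr (BAnd
     (NEq (NVar ''j'') (NVar ''n'')) (mem ''X'' ''i'')) (BAnd (NEq (NVar ''j'') (NSuc (NVar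
     ''n''))) (mem ''Y'' ''i'')))))"

definition Step2 :: com where
  "Step2 = Seq (NAssign ''m'' (NSuc (NSuc (NVar ''n''))))
    (Seq (NStore ''node'' (NVar ''n'') (NConst 0) (NConst 1))
    (Seq (NStore ''node'' (NSuc (NVar ''n'')) (NConst 0) (NConst 1))
    (FillB ''m'' ''edge'' extended_edge_test)))"

definition time2 :: "nat \<Rightarrow> nat" where
  "time2 m = 3 + (m * (m * 5 + 4) + 2)"

abbreviation infinite_test :: bexp where
  "infinite_test \<equiv> BNot (BAnd (NLess (NVar ''i'') (NVar ''n'')) (BAnd (BAnd (BNot (mem
     ''X'' ''i'')) (BNot (mem ''Y'' ''i''))) (mem ''R'' ''i'')))"

text \<open>Infinite costs are stored as 0 because \<open>real_of_ereal \<infinity> = 0\<close>. The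
  indices of \<open>Xm\<close> and \<open>Ym\<close> are not below \<open>n\<close> and so fall
  under the infinite case.\<close>

definition Step3 :: com where
  "Step3 = Seq (Fill1 ''i'' ''m'' ''inf'' (SetIf ''x'' infinite_test) (NVar ''x''))
    (For ''i'' ''m'' (Cond (mem ''inf'' ''i'')
       (RStore ''cost'' (NVar ''i'') (NConst 0) RZero)
       (RStore ''cost'' (NVar ''i'') (NConst 0) (RArr ''w'' (NVar ''i'') (NConst 0)))))"

definition time3 :: "nat \<Rightarrow> nat" where
  "time3 m = (m * 5 + 2) + (m * 4 + 2)"

abbreviation kept_edge_test :: bexp where
  "kept_edge_test \<equiv> BAnd (rel ''edge'' ''i'' ''j'') (BAnd (BNot (BAnd (NLess (NVar ''i'')
     (NVar ''n'')) (mem ''I'' ''i''))) (BNot (BAnd (NLess (NVar ''j'') (NVar ''n'')) (mem ''I''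
     ''j''))))"

abbreviation kept_node_test :: bexp where
  "kept_node_test \<equiv> BAnd (mem ''node'' ''i'') (BNot (BAnd (NLess (NVar ''i'') (NVar ''n''))
     (mem ''I'' ''i'')))"

definition Step4 :: com where
  "Step4 = Seq (FillB ''m'' ''edge'' kept_edge_test)
    (Fill1 ''i'' ''m'' ''node'' (SetIf ''x'' kept_node_test) (NVar ''x''))"

definition time4 :: "nat \<Rightarrow> nat" where
  "time4 m = (m * (m * 5 + 4) + 2) + (m * 5 + 2)"

lemma writes_Step1 [simp]: "nw Step1 = {''i'', ''j'', ''k'', ''x''}"
  "aw Step1 = {''anc'', ''node'', ''con'', ''arr'', ''mid'', ''edge''}" "rw Step1 = {}" "raw Step1 = {}"
  by (auto simp: Step1_def Anteriors_def Node_Set_def Districts_def Arrowheads_def Half_Paths_def Edges_def)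

lemma writes_Step2 [simp]: "nw Step2 = {''m'', ''i'', ''j'', ''x''}" "aw Step2 = {''node'', ''edge''}"
  "rw Step2 = {}" "raw Step2 = {}"
  by (auto simp: Step2_def)

lemma writes_Step3 [simp]: "nw Step3 = {''i'', ''x''}" "aw Step3 = {''inf''}" "rw Step3 = {}"
  "raw Step3 = {''cost''}"
  by (auto simp: Step3_def)

lemma writes_Step4 [simp]: "nw Step4 = {''i'', ''j'', ''x''}" "aw Step4 = {''node'', ''edge''}"
  "rw Step4 = {}"
  "raw Step4 = {}"
  by (auto simp: Step4_def)

section \<open>Verification of steps 1 to 4\<close>

locale encoded_problem = separation_problem G X Y I R w
  for G :: "'v mgraph" and X Y I R w +
  fixes vs :: "'v list" and n :: nat
  assumes vs: "distinct vs" "set vs = nodes G"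
  defines "n \<equiv> length vs"
begin

abbreviation H :: "'v mgraph" where "H \<equiv> induced G A"

definition inp :: "store \<Rightarrow> bool" where
  "inp s \<longleftrightarrow> holds_input vs G X Y I R w s"

lemma inp_unchanged:
  assumes "inp s" "unchanged c s s'" "''n'' \<notin> nw c" "''w'' \<notin> raw c"
    "aw c \<inter> {''dir'', ''und'', ''bid'', ''X'', ''Y'', ''I'', ''R''} = {}"
  shows "inp s'"
proof -
  have "narr s' a = narr s a" if "a \<in> {''dir'', ''und'', ''bid'', ''X'', ''Y'', ''I'', ''R''}" for a
    using that assms(2,5) by (auto simp: unchanged_def)
  then show ?thesis using assms(1-4)
    by (simp add: inp_def holds_input_def holds_rel_def holds_set_def holds_reals_def unchanged_def)
qed

lemma keep_inp:
  assumes "wp c s (\<lambda>s' t. Q s' \<and> t \<le> k)" "inp s" "''n'' \<notin> nw c" "''w'' \<notin> raw c"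
    "aw c \<inter> {''dir'', ''und'', ''bid'', ''X'', ''Y'', ''I'', ''R''} = {}"
  shows "wp c s (\<lambda>s' t. (inp s' \<and> Q s') \<and> t \<le> k)"
  using assms(1) by (rule wp_mono) (use inp_unchanged[OF assms(2) _ assms(3-5)] in blast)

lemma hoare_inp:
  assumes "\<And>s. inp s \<Longrightarrow> B s \<Longrightarrow> wp c s (\<lambda>s' t. Q s' \<and> t \<le> k)" "''n'' \<notin> nw c" "''w'' \<notin> raw c"
    "aw c \<inter> {''dir'', ''und'', ''bid'', ''X'', ''Y'', ''I'', ''R''} = {}"
  shows "hoare (\<lambda>s. inp s \<and> B s) c k (\<lambda>s. inp s \<and> Q s)"
  using keep_inp[OF assms(1) _ assms(2-4)] by (simp add: hoare_def)

lemma inp_simps: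
  assumes "inp s"
  shows "nvar s ''n'' = n"
    "\<And>i j. i < n \<Longrightarrow> j < n \<Longrightarrow> narr s ''dir'' i j = of_bool ((vs ! i, vs ! j) \<in> dir G)"
    "\<And>i j. i < n \<Longrightarrow> j < n \<Longrightarrow> narr s ''und'' i j = of_bool ((vs ! i, vs ! j) \<in> und G)"
    "\<And>i j. i < n \<Longrightarrow> j < n \<Longrightarrow> narr s ''bid'' i j = of_bool ((vs ! i, vs ! j) \<in> bid G)"
    "\<And>i. i < n \<Longrightarrow> narr s ''X'' i 0 = of_bool (vs ! i \<in> X)"
    "\<And>i. i < n \<Longrightarrow> narr s ''Y'' i 0 = of_bool (vs ! i \<in> Y)"
    "\<And>i. i < n \<Longrightarrow> narr s ''I'' i 0 = of_bool (vs ! i \<in> I)"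
    "\<And>i. i < n \<Longrightarrow> narr s ''R'' i 0 = of_bool (vs ! i \<in> R)"
    "\<And>i. i < n \<Longrightarrow> rarr s ''w'' i 0 = real_of_ereal (w (vs ! i))"
  using assms by (auto simp: inp_def holds_input_def holds_rel_def holds_set_def holds_reals_def n_def)

lemma wp_Anteriors:
  assumes "inp s"
  shows "wp Anteriors s (\<lambda>s' t. holds_rel vs ''anc'' ((dir G \<union> und G)\<^sup>*) s' \<and>
    t \<le> (n * (n * 5 + 4) + 2) + (n * (n * (n * 5 + 4) + 4) + 2))"
  unfolding Anteriors_def
proof (rule wp_closure)
  fix p q s'
  assume "p < length vs" "q < length vs" "nvar s' ''i'' = p" "nvar s' ''j'' = q"
    and u: "unchanged (FillB ''n'' ''anc'' anterior_test) s s'"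
  moreover from inp_unchanged[OF assms u] have "inp s'" by simp
  ultimately show "bval anterior_test s' \<longleftrightarrow>
    p = q \<or> (vs ! p, vs ! q) \<in> dir G \<union> und G"
    by (simp add: inp_simps n_def)
qed (use assms vs edges_in_nodes in \<open>auto simp: inp_simps n_def\<close>)

lemma wp_Node_Set:
  assumes "inp s" "holds_rel vs ''anc'' ((dir G \<union> und G)\<^sup>*) s"
  shows "wp Node_Set s (\<lambda>s' t. holds_set vs ''node'' A s' \<and> t \<le> n * (n * 4 + 6) + 2)"
proof -
  have "wp Node_Set s (\<lambda>s' t. (\<forall>p<n. narr s' ''node'' p 0 = of_bool (vs ! p \<in> A)) \<and>
    t \<le> n * ((n * 4 + 3) + 3) + 2)"
    unfolding Node_Set_def
  proof (rule wp_Fill1)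
    fix p s' assume p: "p < n" "nvar s' ''i'' = p" "nvar s' ''n'' = n"
      and u: "unchanged (Fill1 ''i'' ''n'' ''node'' (Exists ''x'' ''k'' ''n'' node_test) (NVar ''x'')) s s'"
    have "wp (Exists ''x'' ''k'' ''n'' node_test) s' (\<lambda>s' t. nvar s' ''x'' = of_bool (\<exists>k<n.
      (vs ! p, vs ! k) \<in> (dir G \<union> und G)\<^sup>* \<and> vs ! k \<in> X \<union> Y \<union> I) \<and> t \<le> n * 4 + 3)"
    proof (rule wp_Exists)
      fix k s'' assume k: "k < n" "nvar s'' ''k'' = k" and u':
        "unchanged (Exists ''x'' ''k'' ''n'' node_test) s' s''"
      have "inp s'" using assms(1) u by (rule inp_unchanged) auto
      then have "inp s''" using u' by (rule inp_unchanged) auto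
      moreover have "narr s'' ''anc'' p k = of_bool ((vs ! p, vs ! k) \<in> (dir G \<union> und G)\<^sup>*)"
        using assms(2) u u' p k by (simp add: unchanged_def holds_rel_def n_def)
      moreover have "nvar s'' ''i'' = p" using u' p by (simp add: unchanged_def)
      ultimately show "bval node_test s'' \<longleftrightarrow> (vs ! p, vs ! k) \<in> (dir G \<union> und G)\<^sup>* \<and> vs ! k \<in> X \<union> Y \<union> I"
        using k by (simp add: inp_simps)
    qed (use p in auto)
    moreover have "(\<exists>k<n. (vs ! p, vs ! k) \<in> (dir G \<union> und G)\<^sup>* \<and> vs ! k \<in> X \<union> Y \<union> I) \<longleftrightarrow> vs ! p \<in> A"
    proof -
      have "vs ! p \<in> nodes G" using p(1) vs(2) n_def nth_mem by metis
      then show ?thesis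
        unfolding n_def ex_index[of vs "\<lambda>v. (vs ! p, v) \<in> (dir G \<union> und G)\<^sup>* \<and>
          v \<in> X \<union> Y \<union> I"] A_def Ant_iff vs(2)
        by blast
    qed
    ultimately show "wp (Exists ''x'' ''k'' ''n'' node_test) s' (\<lambda>s'' t.
        nval (NVar ''x'') s'' = of_bool (vs ! p \<in> A) \<and> t \<le> n * 4 + 3)" by simp
  qed (use assms in \<open>auto simp: inp_simps\<close>)
  then show ?thesis by (rule wp_mono) (auto simp: holds_set_def n_def algebra_simps)
qed

lemma wp_Districts:
  assumes "inp s" "holds_set vs ''node'' A s"
  shows "wp Districts s (\<lambda>s' t. holds_rel vs ''con'' ((bid H)\<^sup>*) s' \<and>
    t \<le> (n * (n * 5 + 4) + 2) + (n * (n * (n * 5 + 4) + 4) + 2))"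
  unfolding Districts_def
proof (rule wp_closure)
  fix p q s'
  assume "p < length vs" "q < length vs" "nvar s' ''i'' = p" "nvar s' ''j'' = q"
    and u: "unchanged (FillB ''n'' ''con'' district_test) s s'"
  moreover from inp_unchanged[OF assms(1) u] have "inp s'" by simp
  moreover have "narr s' ''node'' = narr s ''node''" using u by (simp add: unchanged_def)
  ultimately show "bval district_test s' \<longleftrightarrow> p = q \<or> (vs ! p, vs ! q) \<in> bid H"
    using assms(2) by (auto simp: inp_simps n_def holds_set_def)
qed (use assms vs edges_in_nodes in \<open>auto simp: inp_simps n_def\<close>)

lemma wp_Arrowheads:
  assumes "inp s" "holds_set vs ''node'' A s"
  shows "wp Arrowheads s (\<lambda>s' t. holds_rel vs ''arr'' {(a, b). arrowhead H a b} s' \<and>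
    t \<le> n * (n * 5 + 4) + 2)"
proof -
  have "wp Arrowheads s (\<lambda>s' t. (\<forall>p<n. \<forall>q<n. narr s' ''arr'' p q = of_bool (arrowhead H (vs ! p)
    (vs ! q))) \<and>
    t \<le> n * (n * 5 + 4) + 2)"
    unfolding Arrowheads_def
  proof (rule wp_FillB)
    fix p q s'
    assume "p < n" "q < n" "nvar s' ''i'' = p" "nvar s' ''j'' = q"
      and u: "unchanged (FillB ''n'' ''arr'' arrowhead_test) s s'"
    moreover from inp_unchanged[OF assms(1) u] have "inp s'" by simp
    moreover have "narr s' ''node'' = narr s ''node''" using u by (simp add: unchanged_def)
    ultimately show "bval arrowhead_test s' \<longleftrightarrow> arrowhead H (vs ! p) (vs ! q)"
      using assms(2) by (auto simp: inp_simps holds_set_def n_def arrowhead_def)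
  qed (use assms in \<open>auto simp: inp_simps\<close>)
  then show ?thesis by (rule wp_mono) (auto simp: holds_rel_def n_def algebra_simps)
qed

lemma wp_Half_Paths:
  assumes "inp s" "holds_rel vs ''arr'' {(a, b). arrowhead H a b} s" "holds_rel vs ''con'' ((bid H)\<^sup>*) s"
  shows "wp Half_Paths s (\<lambda>s' t. holds_rel vs ''mid'' ({(a, b). arrowhead H a b} O (bid H)\<^sup>*) s' \<and>
    t \<le> n * (n * (n * 4 + 6) + 4) + 2)"
proof -
  have "wp Half_Paths s (\<lambda>s' t. (\<forall>p<n. \<forall>q<n. narr s' ''mid'' p q =
      of_bool ((vs ! p, vs ! q) \<in> {(a, b). arrowhead H a b} O (bid H)\<^sup>*)) \<and>
    t \<le> n * (n * ((n * 4 + 3) + 3) + 4) + 2)"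
    unfolding Half_Paths_def
  proof (rule wp_Fill2)
    fix p q s' assume p: "p < n" "q < n" "nvar s' ''i'' = p" "nvar s' ''j'' = q" "nvar s' ''n'' = n"
      and u: "unchanged (Fill2 ''i'' ''j'' ''n'' ''mid'' (Exists ''x'' ''k'' ''n'' half_path_test)
        (NVar ''x'')) s s'"
    have "wp (Exists ''x'' ''k'' ''n'' half_path_test) s' (\<lambda>s' t. nvar s' ''x'' = of_bool (\<exists>k<n.
      arrowhead H (vs ! p) (vs ! k) \<and> (vs ! k, vs ! q) \<in> (bid H)\<^sup>*) \<and> t \<le> n * 4 + 3)"
    proof (rule wp_Exists)
      fix k s'' assume k: "k < n" "nvar s'' ''k'' = k" and u':
        "unchanged (Exists ''x'' ''k'' ''n'' half_path_test) s' s''"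
      have "narr s'' ''arr'' p k = of_bool (arrowhead H (vs ! p) (vs ! k))"
        "narr s'' ''con'' k q = of_bool ((vs ! k, vs ! q) \<in> (bid H)\<^sup>*)"
        using assms u u' p k by (simp_all add: unchanged_def holds_rel_def n_def)
      moreover have "nvar s'' ''i'' = p" "nvar s'' ''j'' = q" using u' p by (simp_all add: unchanged_def)
      ultimately show "bval half_path_test s'' \<longleftrightarrow> arrowhead H (vs ! p) (vs ! k) \<and>
        (vs ! k, vs ! q) \<in> (bid H)\<^sup>*"
        using k by simp
    qed (use p in auto)
    moreover have "(\<exists>k<n. arrowhead H (vs ! p) (vs ! k) \<and> (vs ! k, vs ! q) \<in> (bid H)\<^sup>*) \<longleftrightarrow>
        (vs ! p, vs ! q) \<in> {(a, b). arrowhead H a b} O (bid H)\<^sup>*"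
      using edges_in_nodes
      unfolding n_def ex_index[of vs "\<lambda>v. arrowhead H (vs ! p) v \<and> (v, vs ! q) \<in> (bid H)\<^sup>*"] vs(2)
      by (auto simp: arrowhead_def)
    ultimately show "wp (Exists ''x'' ''k'' ''n'' half_path_test) s' (\<lambda>s'' t. nval (NVar ''x'') s'' =
        of_bool ((vs ! p, vs ! q) \<in> {(a, b). arrowhead H a b} O (bid H)\<^sup>*) \<and> t \<le> n * 4 + 3)" by simp
  qed (use assms in \<open>auto simp: inp_simps\<close>)
  then show ?thesis by (rule wp_mono) (auto simp: holds_rel_def n_def algebra_simps)
qed

text \<open>In an ancestral graph a directed edge excludes an arrowhead at its tail, so nodes with
  arrowheads at each other are joined by a bidirected edge, as \<open>uedges_augmented\<close>
  requires. The right-hand side is arranged as the programs evaluate it.\<close>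

lemma uedges_H1_iff:
  "(u, v) \<in> uedges H1 \<longleftrightarrow> u \<noteq> v \<and> ((\<exists>b. (u, b) \<in> {(a, b). arrowhead H a b} O (bid H)\<^sup>* \<and> arrowhead H v b) \<or>
     u \<in> A \<and> v \<in> A \<and> ((u, v) \<in> dir G \<or> (v, u) \<in> dir G \<or> (u, v) \<in> und G \<or> (u, v) \<in> bid G))"
proof -
  have "(a, b) \<in> bid H" if "arrowhead H a b" "arrowhead H b a" for a b
    using that no_arrowhead_if_dir by (auto simp: arrowhead_def)
  then show ?thesis
    by (subst uedges_augmented[OF mixed_graph_induced[OF mixed]]) (auto simp: adjacent_def)
qed

lemma wp_Edges:
  assumes "inp s" "holds_set vs ''node'' A s" "holds_rel vs ''arr'' {(a, b). arrowhead H a b} s"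
    "holds_rel vs ''mid'' ({(a, b). arrowhead H a b} O (bid H)\<^sup>*) s"
  shows "wp Edges s (\<lambda>s' t. holds_rel vs ''edge'' (uedges H1) s' \<and>
    t \<le> n * (n * (n * 4 + 8) + 4) + 2)"
proof -
  let ?M = "{(a, b). arrowhead H a b} O (bid H)\<^sup>*"
  let ?d = "SetIf ''x'' edge_test"
  let ?c = "Seq (Exists ''x'' ''k'' ''n'' collider_path_test) ?d"
  have "wp Edges s (\<lambda>s' t. (\<forall>p<n. \<forall>q<n. narr s' ''edge'' p q = of_bool ((vs ! p, vs ! q) \<in> uedges H1)) \<and>
    t \<le> n * (n * (((n * 4 + 3) + 2) + 3) + 4) + 2)"
    unfolding Edges_def
  proof (rule wp_Fill2)
    fix p q s' assume p: "p < n" "q < n" "nvar s' ''i'' = p" "nvar s' ''j'' = q" "nvar s' ''n'' = n"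
      and u: "unchanged (Fill2 ''i'' ''j'' ''n'' ''edge'' ?c (NVar ''x'')) s s'"
    have inp': "inp s'" using assms(1) u by (rule inp_unchanged) auto
    have eqs: "narr s' ''node'' = narr s ''node''" "narr s' ''mid'' = narr s ''mid''"
      "narr s' ''arr'' = narr s ''arr''" using u by (auto simp: unchanged_def)
    show "wp ?c s' (\<lambda>s'' t. nval (NVar ''x'') s'' = of_bool ((vs ! p, vs ! q) \<in> uedges H1) \<and>
      t \<le> (n * 4 + 3) + 2)"
    proof (rule wp_Seq)
      show "wp (Exists ''x'' ''k'' ''n'' collider_path_test) s' (\<lambda>s' t. nvar s' ''x'' = of_bool (\<exists>k<n.
        (vs ! p, vs ! k) \<in> ?M \<and> arrowhead H (vs ! q) (vs ! k)) \<and> t \<le> n * 4 + 3)"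
      proof (rule wp_Exists)
        fix k s'' assume k: "k < n" "nvar s'' ''k'' = k" and u':
          "unchanged (Exists ''x'' ''k'' ''n'' collider_path_test) s' s''"
        have "narr s'' ''mid'' p k = of_bool ((vs ! p, vs ! k) \<in> ?M)"
          "narr s'' ''arr'' q k = of_bool (arrowhead H (vs ! q) (vs ! k))"
          using assms(3,4) eqs u' p k by (simp_all add: unchanged_def holds_rel_def n_def)
        moreover have "nvar s'' ''i'' = p" "nvar s'' ''j'' = q" using u' p by (simp_all add: unchanged_def)
        ultimately show "bval collider_path_test s'' \<longleftrightarrow> (vs ! p, vs ! k) \<in> ?M \<and>
          arrowhead H (vs ! q) (vs ! k)"
          using k by simp
      qed (use p in auto)
      fix s'' assume x: "nvar s'' ''x'' = of_bool (\<exists>k<n. (vs ! p, vs ! k) \<in> ?M \<and>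
        arrowhead H (vs ! q) (vs ! k))"
        and u': "unchanged (Exists ''x'' ''k'' ''n'' collider_path_test) s' s''"
      have "inp s''" using inp' u' by (rule inp_unchanged) auto
      moreover have "nvar s'' ''i'' = p" "nvar s'' ''j'' = q" "narr s'' ''node'' = narr s ''node''"
        using u' p eqs by (simp_all add: unchanged_def)
      moreover have "(\<exists>k<n. (vs ! p, vs ! k) \<in> ?M \<and> arrowhead H (vs ! q) (vs ! k)) \<longleftrightarrow>
          (\<exists>b. (vs ! p, b) \<in> ?M \<and> arrowhead H (vs ! q) b)"
      proof -
        have "v \<in> nodes G" if "arrowhead H u v" for u v
          using that edges_in_nodes by (auto simp: arrowhead_def)
        then show ?thesis
          unfolding n_def ex_index[of vs "\<lambda>v. (vs ! p, v) \<in> ?M \<and> arrowhead H (vs ! q) v"] vs(2)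
          by blast
      qed
      moreover have "p = q \<longleftrightarrow> vs ! p = vs ! q"
        using vs(1) p(1,2) by (simp add: nth_eq_iff_index_eq n_def)
      moreover have "narr s ''node'' p 0 = of_bool (vs ! p \<in> A)"
        "narr s ''node'' q 0 = of_bool (vs ! q \<in> A)"
        using assms(2) p by (simp_all add: holds_set_def n_def)
      ultimately show "wp ?d s'' (\<lambda>s'' t. nval (NVar ''x'') s'' = of_bool
        ((vs ! p, vs ! q) \<in> uedges H1) \<and> t \<le> 2)"
        using p(1,2) x by (simp add: inp_simps uedges_H1_iff)
    qed
  qed (use assms in \<open>auto simp: inp_simps\<close>)
  then show ?thesis by (rule wp_mono) (auto simp: holds_rel_def n_def algebra_simps)
qed

lemma wp_Step1:
  assumes "inp s"
  shows "wp Step1 s (\<lambda>s' t. (inp s' \<and> holds_ugraph vs H1 s') \<and> t \<le> time1 n)"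
proof -
  let ?anc = "holds_rel vs ''anc'' ((dir G \<union> und G)\<^sup>*)" and ?node = "holds_set vs ''node'' A"
    and ?con = "holds_rel vs ''con'' ((bid H)\<^sup>*)" and ?arr =
      "holds_rel vs ''arr'' {(a, b). arrowhead H a b}"
    and ?mid = "holds_rel vs ''mid'' ({(a, b). arrowhead H a b} O (bid H)\<^sup>*)"
    and ?edge = "holds_rel vs ''edge'' (uedges H1)"
  have a: "hoare (\<lambda>s. inp s \<and> True) Anteriors ((n * (n * 5 + 4) + 2) + (n * (n *
    (n * 5 + 4) + 4) + 2)) (\<lambda>s. inp s \<and> ?anc s)"
    by (rule hoare_inp[OF wp_Anteriors]) (auto simp: Anteriors_def)
  have b: "hoare (\<lambda>s. inp s \<and> ?anc s) Node_Set (n * (n * 4 + 6) + 2) (\<lambda>s. inp s \<and> ?node s)"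
    by (rule hoare_inp[OF wp_Node_Set]) (auto simp: Node_Set_def)
  have c: "hoare (\<lambda>s. inp s \<and> ?node s) Districts ((n * (n * 5 + 4) + 2) + (n * (n * (n * 5 + 4) + 4) + 2))
      (\<lambda>s. inp s \<and> ?node s \<and> ?con s)"
    by (rule hoare_inp, rule wp_mono[OF wp_Districts]) (auto simp:
      Districts_def unchanged_def holds_set_def)
  have d: "hoare (\<lambda>s. inp s \<and> ?node s \<and> ?con s) Arrowheads (n * (n * 5 + 4) + 2)
      (\<lambda>s. inp s \<and> ?node s \<and> ?con s \<and> ?arr s)"
    by (rule hoare_inp, rule wp_mono[OF wp_Arrowheads]) (auto simp:
      Arrowheads_def unchanged_def holds_set_def holds_rel_def)
  have e: "hoare (\<lambda>s. inp s \<and> ?node s \<and> ?con s \<and> ?arr s) Half_Paths (n * (n * (n * 4 + 6) + 4) + 2)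
      (\<lambda>s. inp s \<and> ?node s \<and> ?arr s \<and> ?mid s)"
    by (rule hoare_inp, rule wp_mono[OF wp_Half_Paths]) (auto simp:
      Half_Paths_def unchanged_def holds_set_def holds_rel_def)
  have f: "hoare (\<lambda>s. inp s \<and> ?node s \<and> ?arr s \<and> ?mid s) Edges (n * (n * (n * 4 + 8) + 4) + 2)
      (\<lambda>s. inp s \<and> ?node s \<and> ?edge s)"
    by (rule hoare_inp, rule wp_mono[OF wp_Edges]) (auto simp: Edges_def unchanged_def holds_set_def)
  have "wp Step1 s (\<lambda>s' t. (inp s' \<and> ?node s' \<and> ?edge s') \<and> t \<le> time1 n)"
    using hoare_Seq[OF a hoare_Seq[OF b hoare_Seq[OF c hoare_Seq[OF d hoare_Seq[OF e f]]]]] assms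
    by (simp add: hoare_def Step1_def time1_def)
  then show ?thesis
    by (rule wp_mono) (auto simp: holds_ugraph_def unodes_H1)
qed

definition m :: nat where "m = n + 2"

abbreviation us :: "'v ext list" where "us \<equiv> ext_list vs"

lemma us_simps [simp]: "length us = m" "\<And>i. i < n \<Longrightarrow> us ! i = Node (vs ! i)" "us ! n = Xm" "us ! Suc n = Ym"
  by (auto simp: ext_list_def nth_append n_def m_def)

lemma less_m_cases: "i < m \<Longrightarrow> i < n \<or> i = n \<or> i = Suc n"
  by (auto simp: m_def)

lemma wp_Step2:
  assumes "inp s" "holds_ugraph vs H1 s"
  shows "wp Step2 s (\<lambda>s' t. (inp s' \<and> nvar s' ''m'' = m \<and> holds_ugraph us (step2 X Y H1) s') \<and> t \<le> time2 m)"
proof -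
  let ?P = "Seq (NAssign ''m'' (NSuc (NSuc (NVar ''n''))))
    (Seq (NStore ''node'' (NVar ''n'') (NConst 0) (NConst 1))
     (NStore ''node'' (NSuc (NVar ''n'')) (NConst 0) (NConst 1)))"
  \<comment> \<open>Sequencing is associative and takes no time of its own, so the three assignments
    can be treated as one block of cost 3.\<close>
  have wp_split_Step2: "wp Step2 s Q \<longleftrightarrow> wp (Seq ?P (FillB ''m'' ''edge'' extended_edge_test)) s Q" for Q
    unfolding Step2_def by (simp add: add.assoc)
  have "wp (Seq ?P (FillB ''m'' ''edge'' extended_edge_test)) s (\<lambda>s' t. (inp s' \<and> nvar s' ''m'' = m \<and>
      holds_ugraph us (step2 X Y H1) s') \<and> t \<le> 3 + (m * (m * 5 + 4) + 2))"
  proof (rule wp_Seq)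
    have "wp ?P s (\<lambda>s' t. nvar s' ''m'' = m \<and> narr s' ''node'' n 0 = 1 \<and> narr s' ''node'' (Suc n) 0 = 1 \<and>
      (\<forall>i<n. narr s' ''node'' i 0 = narr s ''node'' i 0) \<and> t \<le> 3)"
      using inp_simps(1)[OF assms(1)] by (simp add: m_def)
    then show "wp ?P s (\<lambda>s' t. (inp s' \<and> nvar s' ''m'' = m \<and>
        holds_set us ''node'' (unodes (step2 X Y H1)) s' \<and> holds_rel vs ''edge'' (uedges H1) s') \<and> t \<le> 3)"
    proof (rule wp_mono)
      fix s' t
      assume *: "nvar s' ''m'' = m \<and> narr s' ''node'' n 0 = 1 \<and> narr s' ''node'' (Suc n) 0 = 1 \<and>
        (\<forall>i<n. narr s' ''node'' i 0 = narr s ''node'' i 0) \<and> t \<le> 3" and u: "unchanged ?P s s'"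
      have "inp s'" using assms(1) u by (rule inp_unchanged) auto
      moreover have "holds_rel vs ''edge'' (uedges H1) s'"
        using assms(2) u by (simp add: holds_ugraph_def holds_rel_def unchanged_def)
      moreover have "holds_set us ''node'' (unodes (step2 X Y H1)) s'"
        using assms(2) * by (auto simp: holds_ugraph_def holds_set_def step2_def n_def[symmetric]
          dest!: less_m_cases)
      ultimately show "(inp s' \<and> nvar s' ''m'' = m \<and>
        holds_set us ''node'' (unodes (step2 X Y H1)) s' \<and> holds_rel vs ''edge'' (uedges H1) s') \<and> t \<le> 3"
        using * by blast
    qed
    fix s' assume s': "inp s' \<and> nvar s' ''m'' = m \<and>
        holds_set us ''node'' (unodes (step2 X Y H1)) s' \<and> holds_rel vs ''edge'' (uedges H1) s'"
    have "wp (FillB ''m'' ''edge'' extended_edge_test) s' (\<lambda>s'' t. (\<forall>p<m. \<forall>q<m. narr s'' ''edge'' p q =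
      of_bool ((us ! p, us ! q) \<in> uedges (step2 X Y H1))) \<and> t \<le> m * (m * 5 + 4) + 2)"
    proof (rule wp_FillB)
      fix p q s'' assume pq: "p < m" "q < m" "nvar s'' ''i'' = p" "nvar s'' ''j'' = q"
        and u: "unchanged (FillB ''m'' ''edge'' extended_edge_test) s' s''" and old:
          "narr s'' ''edge'' p q = narr s' ''edge'' p q"
      have "inp s''" using conjunct1[OF s'] u by (rule inp_unchanged) auto
      moreover have "narr s'' ''edge'' p q = of_bool ((vs ! p, vs ! q) \<in> uedges H1)" if "p < n" "q < n"
        using s' that old by (simp add: holds_rel_def n_def)
      ultimately show "bval extended_edge_test s'' \<longleftrightarrow> (us ! p, us ! q) \<in> uedges (step2 X Y H1)"
        using less_m_cases[OF pq(1)] less_m_cases[OF pq(2)] pq(3,4)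
        by (elim disjE) (simp_all add: inp_simps step2_def)
    qed (use s' in auto)
    then show "wp (FillB ''m'' ''edge'' extended_edge_test) s' (\<lambda>s'' t. (inp s'' \<and> nvar s'' ''m'' = m \<and>
      holds_ugraph us (step2 X Y H1) s'') \<and> t \<le> m * (m * 5 + 4) + 2)"
    proof (rule wp_mono)
      fix s'' t
      assume e: "(\<forall>p<m. \<forall>q<m. narr s'' ''edge'' p q =
        of_bool ((us ! p, us ! q) \<in> uedges (step2 X Y H1))) \<and> t \<le> m * (m * 5 + 4) + 2"
        and u: "unchanged (FillB ''m'' ''edge'' extended_edge_test) s' s''"
      have "inp s''" using conjunct1[OF s'] u by (rule inp_unchanged) auto
      with e u s' show "(inp s'' \<and> nvar s'' ''m'' = m \<and>
          holds_ugraph us (step2 X Y H1) s'') \<and> t \<le> m * (m * 5 + 4) + 2"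
        by (simp add: holds_ugraph_def holds_rel_def holds_set_def unchanged_def)
    qed
  qed
  then show ?thesis unfolding wp_split_Step2 by (simp add: time2_def)
qed

lemma cost_cases:
  "i < n \<Longrightarrow> cost (Node (vs ! i)) = (if vs ! i \<notin> X \<and> vs ! i \<notin> Y \<and> vs ! i \<in> R then w (vs ! i) else \<infinity>)"
  "cost Xm = \<infinity>" "cost Ym = \<infinity>"
proof -
  show "cost (Node (vs ! i)) = (if vs ! i \<notin> X \<and> vs ! i \<notin> Y \<and> vs ! i \<in> R then w (vs ! i) else \<infinity>)" if "i < n"
    using that vs(2) n_def nth_mem[of i vs] by (auto simp: step3_def)
qed (simp_all add: step3_def)

lemma wp_Step3:
  assumes "inp s" "nvar s ''m'' = m"
  shows "wp Step3 s (\<lambda>s' t. (inp s' \<and> holds_costs us cost s') \<and> t \<le> time3 m)"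
  unfolding Step3_def time3_def
proof (rule wp_Seq)
  let ?c = "Fill1 ''i'' ''m'' ''inf'' (SetIf ''x'' infinite_test) (NVar ''x'')"
  have fin: "w (vs ! i) \<noteq> \<infinity>" if "vs ! i \<in> R" for i using input_simps(10)[OF that] by auto
  have "wp ?c s (\<lambda>s' t. (\<forall>p<m. narr s' ''inf'' p 0 = of_bool (cost (us ! p) = \<infinity>)) \<and> t \<le> m * (2 + 3) + 2)"
  proof (rule wp_Fill1)
    fix p s' assume p: "p < m" "nvar s' ''i'' = p" and u: "unchanged ?c s s'"
    have "inp s'" using assms(1) u by (rule inp_unchanged) auto
    then have "bval infinite_test s' \<longleftrightarrow> cost (us ! p) = \<infinity>"
      using less_m_cases[OF p(1)] p(2) fin by (elim disjE) (auto simp: inp_simps cost_cases)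
    then show "wp (SetIf ''x'' infinite_test) s' (\<lambda>s'' t. nval (NVar ''x'') s'' = of_bool (cost
      (us ! p) = \<infinity>) \<and> t \<le> 2)"
      by simp
  qed (use assms in auto)
  then show "wp ?c s (\<lambda>s' t. (inp s' \<and> nvar s' ''m'' = m \<and>
    holds_set us ''inf'' {x. cost x = \<infinity>} s') \<and> t \<le> m * 5 + 2)"
    by (rule wp_mono[OF keep_inp[OF _ assms(1)]])
      (use assms(2) in \<open>auto simp: holds_set_def unchanged_def\<close>)
next
  let ?d = "Cond (mem ''inf'' ''i'')
       (RStore ''cost'' (NVar ''i'') (NConst 0) RZero)
       (RStore ''cost'' (NVar ''i'') (NConst 0) (RArr ''w'' (NVar ''i'') (NConst 0)))"
  fix s assume s: "inp s \<and> nvar s ''m'' = m \<and> holds_set us ''inf'' {x. cost x = \<infinity>} s"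
  have "wp (For ''i'' ''m'' ?d) s (\<lambda>s' t. (\<forall>p<m. rarr s' ''cost'' p 0 = real_of_ereal (cost
    (us ! p))) \<and> t \<le> m * (2 + 2) + 2)"
  proof (rule wp_For[where Inv = "\<lambda>i s'. \<forall>p<i. rarr s' ''cost'' p 0 = real_of_ereal (cost (us ! p))"])
    fix i s' assume i: "i < m" "nvar s' ''i'' = i"
      and inv: "\<forall>p<i. rarr s' ''cost'' p 0 = real_of_ereal (cost (us ! p))"
      and u: "unchanged (For ''i'' ''m'' ?d) s s'"
    have "inp s'" using conjunct1[OF s] u by (rule inp_unchanged) auto
    have "narr s' ''inf'' i 0 = of_bool (cost (us ! i) = \<infinity>)"
      using s u i(1) by (simp add: unchanged_def holds_set_def)
    show "wp ?d s' (\<lambda>s'' t. (\<forall>p<Suc i. rarr (setn ''i'' (Suc i) s'') ''cost'' p 0 =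
        real_of_ereal (cost (us ! p))) \<and> t \<le> 2)"
    proof -
      have "real_of_ereal (cost (us ! i)) = (if cost (us ! i) = \<infinity> then 0 else rarr s' ''w'' i 0)"
        using less_m_cases[OF i(1)] inp_simps(9)[OF \<open>inp s'\<close>]
        by (elim disjE) (simp_all add: cost_cases)
      with \<open>narr s' ''inf'' i 0 = of_bool (cost (us ! i) = \<infinity>)\<close> show ?thesis
        using i(2) inv by (auto simp: less_Suc_eq)
    qed
  qed (use s in auto)
  then show "wp (For ''i'' ''m'' ?d) s (\<lambda>s' t. (inp s' \<and> holds_costs us cost s') \<and> t \<le> m * 4 + 2)"
    by (rule wp_mono[OF keep_inp[OF _ conjunct1[OF s]]])
      (use s in \<open>auto simp: holds_costs_def holds_set_def holds_reals_def unchanged_def\<close>)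
qed

lemma wp_Step4:
  assumes "inp s" "nvar s ''m'' = m" "holds_ugraph us (step2 X Y H1) s"
  shows "wp Step4 s (\<lambda>s' t. (inp s' \<and> holds_ugraph us cut_graph s') \<and> t \<le> time4 m)"
  unfolding Step4_def time4_def
proof (rule wp_Seq)
  have cg: "cut_graph = step4 I (step2 X Y H1)" by (simp add: cut_graph_def step1_eq)
  have "wp (FillB ''m'' ''edge'' kept_edge_test) s (\<lambda>s'' t. (\<forall>p<m. \<forall>q<m. narr s'' ''edge'' p q =
      of_bool ((us ! p, us ! q) \<in> uedges cut_graph)) \<and> t \<le> m * (m * 5 + 4) + 2)"
  proof (rule wp_FillB)
    fix p q s' assume pq: "p < m" "q < m" "nvar s' ''i'' = p" "nvar s' ''j'' = q"
      and u: "unchanged (FillB ''m'' ''edge'' kept_edge_test) s s'" and old: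
        "narr s' ''edge'' p q = narr s ''edge'' p q"
    have "inp s'" using assms(1) u by (rule inp_unchanged) auto
    moreover have "narr s' ''edge'' p q = of_bool ((us ! p, us ! q) \<in> uedges (step2 X Y H1))"
      using assms(3) old pq by (simp add: holds_ugraph_def holds_rel_def)
    ultimately show "bval kept_edge_test s' \<longleftrightarrow> (us ! p, us ! q) \<in> uedges cut_graph"
      using less_m_cases[OF pq(1)] less_m_cases[OF pq(2)] pq(3,4)
      by (elim disjE) (auto simp: inp_simps step4_def cg)
  qed (use assms in auto)
  then show "wp (FillB ''m'' ''edge'' kept_edge_test) s (\<lambda>s' t. (inp s' \<and> nvar s' ''m'' = m \<and>
      holds_set us ''node'' (unodes (step2 X Y H1)) s' \<and>
        holds_rel us ''edge'' (uedges cut_graph) s') \<and> t \<le> m * (m * 5 + 4) + 2)"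
    by (rule wp_mono[OF keep_inp[OF _ assms(1)]])
      (use assms(2,3) in \<open>auto simp: holds_set_def holds_rel_def holds_ugraph_def unchanged_def\<close>)
next
  let ?c = "Fill1 ''i'' ''m'' ''node'' (SetIf ''x'' kept_node_test) (NVar ''x'')"
  have cg: "cut_graph = step4 I (step2 X Y H1)" by (simp add: cut_graph_def step1_eq)
  fix s assume s: "inp s \<and> nvar s ''m'' = m \<and>
      holds_set us ''node'' (unodes (step2 X Y H1)) s \<and> holds_rel us ''edge'' (uedges cut_graph) s"
  have "wp ?c s (\<lambda>s' t. (\<forall>p<m. narr s' ''node'' p 0 = of_bool (us ! p \<in> unodes cut_graph)) \<and>
    t \<le> m * (2 + 3) + 2)"
  proof (rule wp_Fill1)
    fix p s' assume p: "p < m" "nvar s' ''i'' = p" and u: "unchanged ?c s s'"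
      and old: "\<And>q. \<not> q < p \<Longrightarrow> narr s' ''node'' q 0 = narr s ''node'' q 0"
    have "inp s'" using conjunct1[OF s] u by (rule inp_unchanged) auto
    moreover have "narr s' ''node'' p 0 = of_bool (us ! p \<in> unodes (step2 X Y H1))"
      using s old[of p] p(1) by (simp add: holds_set_def)
    ultimately have "bval kept_node_test s' \<longleftrightarrow> us ! p \<in> unodes cut_graph"
      using less_m_cases[OF p(1)] p(2) by (elim disjE) (auto simp: inp_simps step4_def cg)
    then show "wp (SetIf ''x'' kept_node_test) s' (\<lambda>s'' t. nval (NVar ''x'') s'' = of_bool
      (us ! p \<in> unodes cut_graph) \<and> t \<le> 2)"
      by simp
  qed (use s in auto)
  then show "wp ?c s (\<lambda>s' t. (inp s' \<and> holds_ugraph us cut_graph s') \<and> t \<le> m * 5 + 2)"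
    by (rule wp_mono[OF keep_inp[OF _ conjunct1[OF s]]])
      (use s in \<open>auto simp: holds_set_def holds_rel_def holds_ugraph_def unchanged_def\<close>)
qed

end

section \<open>Preflows\<close>

locale flow_network =
  fixes N :: nat and cap :: "nat \<Rightarrow> nat \<Rightarrow> real" and src snk :: nat
  assumes src: "src < N" and snk: "snk < N" and src_snk: "src \<noteq> snk"
    and cap_nonneg: "\<And>u v. 0 \<le> cap u v" and cap_src: "cap src src = 0"
begin

text \<open>A preflow is represented by its residual capacities \<open>r\<close>: the net flow from \<open>u\<close> to \<open>v\<close> is
  \<open>cap u v - r u v = r v u - cap v u\<close>.\<close>

definition excess :: "(nat \<Rightarrow> nat \<Rightarrow> real) \<Rightarrow> nat \<Rightarrow> real" where
  "excess r v = (\<Sum>u<N. r v u - cap v u)"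

text \<open>Besides the flow this collects what makes the heights usable: they drop by at most one
  along residual arcs, and residual arcs before the current arc do not descend, so they admit no
  push.\<close>

definition preflow :: "(nat \<Rightarrow> nat \<Rightarrow> real) \<Rightarrow> (nat \<Rightarrow> nat) \<Rightarrow> (nat \<Rightarrow> nat) \<Rightarrow> bool" where
  "preflow r d cur \<longleftrightarrow>
    (\<forall>u<N. \<forall>v<N. 0 \<le> r u v \<and> r u v + r v u = cap u v + cap v u \<and> (0 < r u v \<longrightarrow> d u \<le> Suc (d v))) \<and>
    (\<forall>v<N. v \<noteq> src \<longrightarrow> 0 \<le> excess r v) \<and> d src = N \<and> d snk = 0 \<and>
    (\<forall>v<N. d v \<le> N \<and> cur v \<le> N \<and> (\<forall>u<cur v. 0 < r v u \<longrightarrow> d v \<le> d u))"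

lemma preflowD:
  assumes "preflow r d cur"
  shows "u < N \<Longrightarrow> v < N \<Longrightarrow> 0 \<le> r u v"
    "u < N \<Longrightarrow> v < N \<Longrightarrow> r u v + r v u = cap u v + cap v u"
    "u < N \<Longrightarrow> v < N \<Longrightarrow> 0 < r u v \<Longrightarrow> d u \<le> Suc (d v)"
    "v < N \<Longrightarrow> v \<noteq> src \<Longrightarrow> 0 \<le> excess r v" "d src = N" "d snk = 0"
    "v < N \<Longrightarrow> d v \<le> N" "v < N \<Longrightarrow> cur v \<le> N"
    "v < N \<Longrightarrow> u < cur v \<Longrightarrow> 0 < r v u \<Longrightarrow> d v \<le> d u"
  using assms unfolding preflow_def by blast+

lemma preflowI:
  assumes "\<And>u v. u < N \<Longrightarrow> v < N \<Longrightarrow> 0 \<le> r u v"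
    "\<And>u v. u < N \<Longrightarrow> v < N \<Longrightarrow> r u v + r v u = cap u v + cap v u"
    "\<And>u v. u < N \<Longrightarrow> v < N \<Longrightarrow> 0 < r u v \<Longrightarrow> d u \<le> Suc (d v)"
    "\<And>v. v < N \<Longrightarrow> v \<noteq> src \<Longrightarrow> 0 \<le> excess r v" "d src = N" "d snk = 0"
    "\<And>v. v < N \<Longrightarrow> d v \<le> N" "\<And>v. v < N \<Longrightarrow> cur v \<le> N"
    "\<And>u v. v < N \<Longrightarrow> u < cur v \<Longrightarrow> 0 < r v u \<Longrightarrow> d v \<le> d u"
  shows "preflow r d cur"
  using assms unfolding preflow_def by blast

definition push :: "(nat \<Rightarrow> nat \<Rightarrow> real) \<Rightarrow> nat \<Rightarrow> nat \<Rightarrow> real \<Rightarrow> nat \<Rightarrow> nat \<Rightarrow> real" where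
  "push r v u x = r(v := (r v)(u := r v u - x), u := (r u)(v := r u v + x))"

text \<open>Vertices at height \<open>N\<close> cannot reach the sink any more; as only a minimum cut is needed, they
  are left alone.\<close>

definition active :: "(nat \<Rightarrow> nat \<Rightarrow> real) \<Rightarrow> (nat \<Rightarrow> nat) \<Rightarrow> nat \<Rightarrow> bool" where
  "active r d v \<longleftrightarrow> v < N \<and> v \<noteq> src \<and> v \<noteq> snk \<and> d v < N \<and> 0 < excess r v"

lemma excess_push:
  assumes "v < N" "u < N" "u \<noteq> v"
  shows "excess (push r v u x) =
    (excess r)(v := excess r v - x, u := excess r u + x)"
proof
  fix w
  have 1: "(\<Sum>z<N. (if z = u then r v u - x else r v z) - cap v z) = excess r v - x"
  proof -
    have "(\<Sum>z<N. (if z = u then r v u - x else r v z) - cap v z) =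
      (\<Sum>z<N. (r v z - cap v z) - (if z = u then x else 0))"
      by (intro sum.cong) auto
    then show ?thesis using assms by (simp add: sum_subtractf excess_def sum.delta)
  qed
  have 2: "(\<Sum>z<N. (if z = v then r u v + x else r u z) - cap u z) = excess r u + x"
  proof -
    have "(\<Sum>z<N. (if z = v then r u v + x else r u z) - cap u z) =
      (\<Sum>z<N. (r u z - cap u z) + (if z = v then x else 0))"
      by (intro sum.cong) auto
    then show ?thesis using assms by (simp add: sum.distrib excess_def sum.delta)
  qed
  show "excess (push r v u x) w = ((excess r)(v := excess r v - x, u := excess r u + x)) w"
    using 1 2 assms by (auto simp: excess_def push_def fun_upd_def)
qed

text \<open>The only arc that may become residual leads from \<open>u\<close> back up to
  \<open>v\<close>. An ascending arc violates neither the validity of the heights nor the condition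
  on the arcs that \<open>u\<close> has already passed.\<close>

lemma preflow_push:
  assumes p: "preflow r d cur" and v: "v < N" "v \<noteq> src" and u: "u < N" "d v = Suc (d u)"
    and x: "0 \<le> x" "x \<le> r v u" "x \<le> excess r v"
  shows "preflow (push r v u x) d cur"
proof -
  have uv: "u \<noteq> v" using u(2) by auto
  show ?thesis
  proof (rule preflowI)
    fix w assume "w < N" "w \<noteq> src"
    then have "0 \<le> excess r w" by (rule preflowD(4)[OF p])
    then show "0 \<le> excess (push r v u x) w"
      using x unfolding excess_push[OF v(1) u(1) uv] by auto
  next
    fix a b assume "a < N" "b < N"
    note * = preflowD(1-3)[OF p this]
    show "0 \<le> push r v u x a b" "push r v u x a b + push r v u x b a = cap a b + cap b a"
      using * x uv by (cases "a = v \<and> b = u"; cases "a = u \<and> b = v"; auto simp: push_def)+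
    show "d a \<le> Suc (d b)" if "0 < push r v u x a b"
      using * that u x uv by (cases "a = v \<and> b = u"; cases "a = u \<and> b = v") (auto simp:
        push_def split: if_splits)
  next
    fix a b assume "a < N" "b < cur a" and r: "0 < push r v u x a b"
    note * = preflowD(9)[OF p this(1,2)]
    show "d a \<le> d b"
      using * r u x uv by (cases "a = v \<and> b = u"; cases "a = u \<and> b = v") (auto simp:
        push_def split: if_splits)
  qed (use preflowD[OF p] in auto)
qed

text \<open>The arc passed over is either not residual or, by validity of the heights and lack of an
  admissible descent, leads to a vertex at least as high as \<open>v\<close>.\<close>

lemma preflow_advance:
  assumes p: "preflow r d cur" and v: "v < N" "cur v < N"
    and not: "\<not> (0 < r v (cur v) \<and> d v = Suc (d (cur v)))"
  shows "preflow r d (cur(v := Suc (cur v)))"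
proof (rule preflowI)
  fix a b assume ab: "a < N" "b < (cur(v := Suc (cur v))) a" "0 < r a b"
  show "d a \<le> d b"
  proof (cases "b < cur a")
    case False
    with ab have "a = v" "b = cur v" by (auto split: if_splits)
    moreover from this ab v have "d v \<le> Suc (d (cur v))" by (intro preflowD(3)[OF p]) auto
    ultimately show ?thesis using not ab(3) by simp
  qed (use ab preflowD(9)[OF p] in blast)
qed (use v preflowD[OF p] in auto)

text \<open>With the pointer at \<open>N\<close>, all residual arcs of \<open>v\<close> lead to
  vertices at least as high, so a lift by one stays valid. Arcs into \<open>v\<close> that others
  have passed remain inadmissible because \<open>v\<close> only rises.\<close>

lemma preflow_relabel:
  assumes p: "preflow r d cur" and v: "v < N" "v \<noteq> src" "v \<noteq> snk" "d v < N" "cur v = N"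
  shows "preflow r (d(v := Suc (d v))) (cur(v := 0))"
proof (rule preflowI)
  fix a b assume ab: "a < N" "b < N" "0 < r a b"
  then have "d a \<le> Suc (d b)" by (rule preflowD(3)[OF p])
  moreover have "d v \<le> d b" if "a = v" using preflowD(9)[OF p v(1)] v(5) that ab by auto
  ultimately show "(d(v := Suc (d v))) a \<le> Suc ((d(v := Suc (d v))) b)" by auto
next
  fix a b assume ab: "a < N" "b < (cur(v := 0)) a" "0 < r a b"
  then have "a \<noteq> v" "b < cur a" by (auto split: if_splits)
  moreover from this ab have "d a \<le> d b" by (intro preflowD(9)[OF p]) auto
  ultimately show "(d(v := Suc (d v))) a \<le> (d(v := Suc (d v))) b" by auto
qed (use v preflowD[OF p] in \<open>auto simp: Suc_le_eq\<close>)

definition r0 :: "nat \<Rightarrow> nat \<Rightarrow> real" where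
  "r0 u v = (if u = src then 0 else if v = src then cap u src + cap src u else cap u v)"

lemma excess_r0:
  assumes "v \<noteq> src"
  shows "excess r0 v = cap src v"
proof -
  have "excess r0 v = (\<Sum>u<N. if u = src then cap src v else 0)"
    unfolding excess_def using assms by (intro sum.cong) (auto simp: r0_def)
  then show ?thesis using src by (simp add: sum.delta)
qed

text \<open>The source stands at height \<open>N\<close> above vertices at height 0; this is valid
  because \<open>r0\<close> saturates all its outgoing arcs.\<close>

lemma preflow_init: "preflow r0 (\<lambda>v. if v = src then N else 0) (\<lambda>_. 0)"
  by (rule preflowI) (use cap_nonneg cap_src src_snk excess_r0 in \<open>auto simp: r0_def\<close>)

section \<open>Potentials of the amortised analysis\<close>

definition total :: "(nat \<Rightarrow> nat) \<Rightarrow> nat" where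
  "total d = (\<Sum>v<N. d v)"

text \<open>The least strict bound, so that it is 0 exactly when no vertex is active.\<close>

definition level :: "(nat \<Rightarrow> nat \<Rightarrow> real) \<Rightarrow> (nat \<Rightarrow> nat) \<Rightarrow> nat" where
  "level r d = (LEAST B. \<forall>v. active r d v \<longrightarrow> d v < B)"

text \<open>\<open>passes\<close> bounds the number of remaining passes over all vertices, \<open>scans\<close> the number of
  remaining steps of the current-arc pointers.\<close>

definition passes :: "(nat \<Rightarrow> nat \<Rightarrow> real) \<Rightarrow> (nat \<Rightarrow> nat) \<Rightarrow> nat" where
  "passes r d = 2 * (N * N - total d) + level r d"

definition scans :: "(nat \<Rightarrow> nat) \<Rightarrow> (nat \<Rightarrow> nat) \<Rightarrow> nat" where
  "scans d cur = (\<Sum>v<N. (N + 1) * (N - d v) + (N - cur v))"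

lemma level_bound: "active r d v \<Longrightarrow> d v < level r d"
proof -
  have "\<forall>v. active r d v \<longrightarrow> d v < N" by (simp add: active_def)
  then have "\<forall>v. active r d v \<longrightarrow> d v < level r d" unfolding level_def by (rule LeastI)
  then show "active r d v \<Longrightarrow> d v < level r d" by blast
qed

lemma level_le: "(\<And>v. active r d v \<Longrightarrow> d v < B) \<Longrightarrow> level r d \<le> B"
  unfolding level_def by (intro Least_le) blast

lemma sum_remove_lessThan:
  fixes f :: "nat \<Rightarrow> nat"
  assumes "v < N"
  shows "(\<Sum>u<N. f u) = f v + (\<Sum>u\<in>{..<N} - {v}. f u)"
  using assms by (subst sum.remove[of _ v]) auto

lemma total_relabel: "v < N \<Longrightarrow> total (d(v := Suc (d v))) = Suc (total d)"
  unfolding total_def by (simp add: sum_remove_lessThan)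

lemma total_le: "preflow r d cur \<Longrightarrow> total d \<le> N * N"
  unfolding total_def using sum_bounded_above[of "{..<N}" d N] preflowD(7) by auto

lemma scans_advance: "v < N \<Longrightarrow> cur v < N \<Longrightarrow> Suc (scans d (cur(v := Suc (cur v)))) = scans d cur"
  unfolding scans_def by (simp add: sum_remove_lessThan Suc_diff_Suc)

text \<open>A lift of \<open>v\<close> releases \<open>N + 1\<close> units: \<open>N\<close> of them
  pay for the return of the pointer from \<open>N\<close> to 0, and one remains for the relabelling
  itself.\<close>

lemma scans_relabel:
  "v < N \<Longrightarrow> d v < N \<Longrightarrow> cur v = N \<Longrightarrow> Suc (scans (d(v := Suc (d v))) (cur(v := 0))) = scans d cur"
proof -
  assume v: "v < N" "d v < N" "cur v = N"
  have "(N + 1) * (N - d v) = (N + 1) * (N - Suc (d v)) + (N + 1)"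
    using v by (simp add: Suc_diff_Suc[symmetric])
  then show ?thesis using v unfolding scans_def by (simp add: sum_remove_lessThan)
qed

lemma scans_le: "scans d cur \<le> N * ((N + 1) * N + N)"
proof -
  have "scans d cur \<le> (\<Sum>v<N. (N + 1) * N + N)"
    unfolding scans_def by (intro sum_mono add_mono mult_le_mono) auto
  then show ?thesis by simp
qed

text \<open>Invariant of a pass that has dealt with the vertices below \<open>i\<close>. Without a relabelling, all
  excess moves down, so the bound \<open>B\<close> on the heights of active vertices drops by one; with
  relabellings, it grows by at most one.\<close>

definition pass_inv :: "nat \<Rightarrow> nat \<Rightarrow> nat \<Rightarrow> nat \<Rightarrow> (nat \<Rightarrow> nat \<Rightarrow> real) \<Rightarrow> (nat \<Rightarrow> nat) \<Rightarrow> bool" where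
  "pass_inv B D i flag r d \<longleftrightarrow> D \<le> total d \<and>
    (\<forall>v\<ge>i. active r d v \<longrightarrow> d v < B) \<and>
    (\<forall>v<i. active r d v \<longrightarrow> d v \<le> B \<and> (total d = D \<longrightarrow> Suc (d v) < B)) \<and>
    (if flag = 0 then \<forall>v<i. \<not> active r d v else 0 < B)"

lemma pass_inv_start: "pass_inv (level r d) (total d) 0 0 r d"
  by (auto simp: pass_inv_def level_bound)

lemma pass_inv_inactive: "pass_inv B D i flag r d \<Longrightarrow> \<not> active r d i \<Longrightarrow> pass_inv B D (Suc i) flag r d"
  by (auto simp: pass_inv_def less_Suc_eq Suc_le_eq)

text \<open>Vertices that become active lie one below \<open>d i\<close>, hence at least two below
  \<open>B\<close>. So they satisfy the stricter clause even if the pass has already dealt with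
  them.\<close>

lemma pass_inv_discharged:
  assumes "pass_inv B D i flag r d" "active r d i" "\<not> active r' d i"
    and "\<And>u. u \<noteq> i \<Longrightarrow> active r' d u \<Longrightarrow> active r d u \<or> Suc (d u) = d i"
  shows "pass_inv B D (Suc i) 1 r' d"
proof -
  have "d i < B" using assms(1,2) by (auto simp: pass_inv_def)
  moreover have "d v < B" if "Suc i \<le> v" "active r' d v" for v
    using assms(1) assms(4)[of v] that \<open>d i < B\<close> by (auto simp: pass_inv_def)
  moreover have "d v \<le> B \<and> (total d = D \<longrightarrow> Suc (d v) < B)" if "v < Suc i" "active r' d v" for v
  proof -
    have "v < i" using that assms(3) by (auto simp: less_Suc_eq)
    with assms(1) assms(4)[of v] that \<open>d i < B\<close> show ?thesis by (auto simp: pass_inv_def)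
  qed
  ultimately show ?thesis using assms(1) by (auto simp: pass_inv_def)
qed

text \<open>Once \<open>total\<close> exceeds \<open>D\<close> the stricter clause is void, and it
  suffices that \<open>i\<close>, which was below \<open>B\<close>, rises to at most
  \<open>B\<close>.\<close>

lemma pass_inv_relabelled:
  assumes "pass_inv B D i flag r d" "active r d i"
    and "\<And>u. u \<noteq> i \<Longrightarrow> active r' d u \<Longrightarrow> active r d u \<or> Suc (d u) = d i"
  shows "pass_inv B D (Suc i) 1 r' (d(i := Suc (d i)))" (is "pass_inv _ _ _ _ _ ?d")
proof -
  have i: "d i < B" "i < N" using assms(1,2) by (auto simp: pass_inv_def active_def)
  have t: "total ?d = Suc (total d)" using i(2) by (rule total_relabel)
  have act: "active r' ?d v \<longleftrightarrow> active r' d v" if "v \<noteq> i" for v using that by (simp add: active_def)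
  have "?d v < B" if "Suc i \<le> v" "active r' ?d v" for v
    using assms(1) assms(3)[of v] that act[of v] i by (auto simp: pass_inv_def)
  moreover have "?d v \<le> B" if "v < Suc i" "active r' ?d v" for v
    using assms(1) assms(3)[of v] that act[of v] i by (auto simp: pass_inv_def less_Suc_eq)
  ultimately show ?thesis using assms(1) i t by (auto simp: pass_inv_def)
qed

text \<open>Without a relabelling the level drops. With one it rises by at most one while
  \<open>total\<close> grows, and the factor 2 in \<open>passes\<close> outweighs the rise. Active
  vertices are below \<open>N\<close>, so the invariant at \<open>N\<close> covers all of
  them.\<close>

lemma passes_decrease:
  assumes "pass_inv (level r d) (total d) N flag r' d'" "flag \<noteq> 0" "preflow r' d' cur'"
  shows "passes r' d' < passes r d"
proof -
  let ?B = "level r d"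
  have B: "0 < ?B" using assms(1,2) by (simp add: pass_inv_def)
  have le: "total d' \<le> N * N" using assms(3) by (rule total_le)
  show ?thesis
  proof (cases "total d' = total d")
    case True
    have "level r' d' \<le> ?B - 1"
      using assms(1) True by (intro level_le) (auto simp: pass_inv_def active_def)
    with B True show ?thesis by (simp add: passes_def)
  next
    case False
    then have "total d < total d'" using assms(1) by (simp add: pass_inv_def)
    moreover have "level r' d' \<le> Suc ?B"
      using assms(1) by (intro level_le) (auto simp: pass_inv_def active_def less_Suc_eq_le)
    ultimately show ?thesis using le by (simp add: passes_def)
  qed
qed

lemma passes_le: "passes r d \<le> 2 * (N * N) + N"
  using level_le[of r d N] by (auto simp: passes_def active_def)

section \<open>Cuts, duality and the gap\<close>

definition cut_value :: "nat set \<Rightarrow> real" where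
  "cut_value S = (\<Sum>u\<in>S. \<Sum>v\<in>{..<N} - S. cap u v)"

text \<open>Net flow is antisymmetric and cancels inside the complement of \<open>S\<close>. What
  gathers there is what crosses from \<open>S\<close>, namely capacity minus residual
  capacity.\<close>

lemma sum_excess:
  assumes "preflow r d cur" "S \<subseteq> {..<N}"
  shows "(\<Sum>v\<in>{..<N} - S. excess r v) = cut_value S - (\<Sum>u\<in>S. \<Sum>v\<in>{..<N} - S. r u v)"
proof -
  let ?T = "{..<N} - S" and ?f = "\<lambda>v u. r v u - cap v u"
  have anti: "?f v u = - ?f u v" if "u < N" "v < N" for u v
  proof -
    have "r u v + r v u = cap u v + cap v u" using that by (rule preflowD(2)[OF assms(1)])
    then show ?thesis by simp
  qed
  have "(\<Sum>v\<in>?T. \<Sum>u\<in>?T. ?f v u) = (\<Sum>v\<in>?T. \<Sum>u\<in>?T. - ?f u v)"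
    by (intro sum.cong refl anti) auto
  also have "\<dots> = - (\<Sum>v\<in>?T. \<Sum>u\<in>?T. ?f v u)"
    by (subst sum.swap) (simp only: sum_negf)
  finally have 0: "(\<Sum>v\<in>?T. \<Sum>u\<in>?T. ?f v u) = 0" by linarith
  have "excess r v = (\<Sum>u\<in>?T. ?f v u) + (\<Sum>u\<in>S. ?f v u)" for v
    unfolding excess_def using assms(2) by (subst sum.subset_diff[of S]) auto
  then have "(\<Sum>v\<in>?T. excess r v) = (\<Sum>v\<in>?T. \<Sum>u\<in>S. ?f v u)"
    using 0 by (simp add: sum.distrib)
  also have "\<dots> = (\<Sum>u\<in>S. \<Sum>v\<in>?T. ?f v u)" by (rule sum.swap)
  also have "\<dots> = (\<Sum>u\<in>S. \<Sum>v\<in>?T. - ?f u v)"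
    using assms(2) by (intro sum.cong refl anti) auto
  also have "\<dots> = cut_value S - (\<Sum>u\<in>S. \<Sum>v\<in>?T. r u v)"
    by (simp add: cut_value_def sum_subtractf)
  finally show ?thesis .
qed

text \<open>Weak duality: the other vertices outside \<open>S\<close> have nonnegative excess, and
  residual capacity only reduces what crosses.\<close>

lemma excess_le_cut_value:
  assumes "preflow r d cur" "S \<subseteq> {..<N}" "src \<in> S" "snk \<notin> S"
  shows "excess r snk \<le> cut_value S"
proof -
  have "excess r snk \<le> (\<Sum>v\<in>{..<N} - S. excess r v)"
    using assms(2-4) snk preflowD(4)[OF assms(1)] by (intro member_le_sum) auto
  also have "\<dots> = cut_value S - (\<Sum>u\<in>S. \<Sum>v\<in>{..<N} - S. r u v)"
    using assms(1,2) by (rule sum_excess)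
  also have "\<dots> \<le> cut_value S"
    using assms(2) preflowD(1)[OF assms(1)] by (auto simp: subset_iff intro!: sum_nonneg)
  finally show ?thesis .
qed

text \<open>The heights from 0 to \<open>N\<close> outnumber the vertices by one, and the missing
  one is below \<open>N\<close> because the source occupies \<open>N\<close>.\<close>

lemma gap_exists:
  assumes "preflow r d cur"
  shows "\<exists>k<N. \<forall>v<N. d v \<noteq> k"
proof (rule ccontr)
  assume "\<not> ?thesis"
  then have "\<forall>k<N. \<exists>v<N. d v = k" by blast
  moreover have "d src = N" using preflowD(5)[OF assms] .
  ultimately have "{..N} \<subseteq> d ` {..<N}" using src by (force simp: le_less)
  then have "card {..N} \<le> card {..<N}" by (rule surj_card_le[rotated]) simp
  then show False by simp
qed

text \<open>A residual arc descends by at most one level and cannot jump over the gap, so all arcs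
  leaving \<open>S\<close> are saturated. Below the gap no vertex is active, so all excess outside
  \<open>S\<close> sits at the sink.\<close>

lemma gap_cut:
  assumes p: "preflow r d cur" and no: "\<And>v. \<not> active r d v" and k: "k < N" "\<And>v. v < N \<Longrightarrow> d v \<noteq> k"
  defines "S \<equiv> {v. v < N \<and> k < d v}"
  shows "src \<in> S" "snk \<notin> S" "excess r snk = cut_value S"
proof -
  have S: "S \<subseteq> {..<N}" by (auto simp: S_def)
  show s: "src \<in> S" using preflowD(5)[OF p] k src by (auto simp: S_def)
  show t: "snk \<notin> S" using preflowD(6)[OF p] by (auto simp: S_def)
  have "excess r v = 0" if "v \<in> {..<N} - S" "v \<noteq> snk" for v
  proof -
    have "v \<noteq> src" using that s by auto
    moreover have "d v < N" using that k by (auto simp: S_def)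
    ultimately have "\<not> 0 < excess r v" using no[of v] that by (auto simp: active_def)
    moreover have "0 \<le> excess r v" using that \<open>v \<noteq> src\<close> by (intro preflowD(4)[OF p]) auto
    ultimately show ?thesis by simp
  qed
  then have "(\<Sum>v\<in>{..<N} - S. excess r v) = excess r snk"
    using t snk by (subst sum.remove[of _ snk]) auto
  moreover have "r u v = 0" if "u \<in> S" "v \<in> {..<N} - S" for u v
  proof -
    have "k < d u" "d v < k" "u < N" "v < N"
      using that k(2)[of v] by (auto simp: S_def not_less le_less)
    moreover from this have "0 < r u v \<longrightarrow> d u \<le> Suc (d v)" "0 \<le> r u v" using preflowD(1,3)[OF p] by auto
    ultimately show ?thesis by auto
  qed
  then have "(\<Sum>u\<in>S. \<Sum>v\<in>{..<N} - S. r u v) = 0" by simp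
  ultimately show "excess r snk = cut_value S" using sum_excess[OF p S] by simp
qed

end

section \<open>Minimum vertex cuts as minimum cuts\<close>

text \<open>Node splitting: node \<open>us ! i\<close> becomes the vertices \<open>2 * i\<close> and \<open>2 * i + 1\<close>, joined by an edge
  whose capacity is the cost of the node. The number \<open>big\<close> stands for infinity.\<close>

locale cut_network =
  fixes us :: "'a list" and U :: "'a ugraph" and c :: "'a \<Rightarrow> ereal" and a b :: nat and m :: nat
  defines "m \<equiv> length us"
  assumes distinct: "distinct us" and nodes: "unodes U \<subseteq> set us"
    and edges: "uedges U \<subseteq> unodes U \<times> unodes U"
    and ab: "a < m" "b < m" "us ! a \<in> unodes U" "us ! b \<in> unodes U" "us ! a \<noteq> us ! b"
      "(us ! a, us ! b) \<notin> uedges U"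
    and cost_nonneg: "\<And>x. x \<in> set us \<Longrightarrow> 0 \<le> c x"
    and cost_ab: "c (us ! a) = \<infinity>" "c (us ! b) = \<infinity>"
begin

text \<open>Exceeds every sum of finite node costs. Infinite costs contribute nothing, as
  \<open>real_of_ereal \<infinity> = 0\<close>.\<close>

definition big :: real where
  "big = 1 + (\<Sum>i<m. real_of_ereal (c (us ! i)))"

definition cap :: "nat \<Rightarrow> nat \<Rightarrow> real" where
  "cap p q = (if even p \<and> odd q \<and> p div 2 = q div 2 \<and> p div 2 < m \<and> us ! (p div 2) \<in> unodes U
     then if c (us ! (p div 2)) = \<infinity> then big else real_of_ereal (c (us ! (p div 2)))
     else if odd p \<and> even q \<and> p div 2 < m \<and> q div 2 < m \<and> (us ! (p div 2), us ! (q div 2)) \<in> uedges U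
     then big else 0)"

lemma cost_real_nonneg: "i < m \<Longrightarrow> 0 \<le> real_of_ereal (c (us ! i))"
  using cost_nonneg by (simp add: m_def real_of_ereal_pos)

lemma big_pos: "0 < big"
  using sum_nonneg[of "{..<m}" "\<lambda>i. real_of_ereal (c (us ! i))"] cost_real_nonneg by (force simp: big_def)

lemma cap_node: "i < m \<Longrightarrow> us ! i \<in> unodes U \<Longrightarrow>
    cap (2 * i) (Suc (2 * i)) = (if c (us ! i) = \<infinity> then big else real_of_ereal (c (us ! i)))"
  by (simp add: cap_def)

lemma cap_edge: "i < m \<Longrightarrow> j < m \<Longrightarrow> (us ! i, us ! j) \<in> uedges U \<Longrightarrow> cap (Suc (2 * i)) (2 * j) = big"
  by (simp add: cap_def)

lemma cap_cases:
  assumes "cap p q \<noteq> 0"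
  obtains i where "i < m" "us ! i \<in> unodes U" "p = 2 * i" "q = Suc (2 * i)"
  | i j where "i < m" "j < m" "(us ! i, us ! j) \<in> uedges U" "p = Suc (2 * i)" "q = 2 * j"
proof -
  have half: "even x \<Longrightarrow> x = 2 * (x div 2)" "odd x \<Longrightarrow> x = Suc (2 * (x div 2))" for x :: nat
    by presburger+
  from assms consider "even p" "odd q" "p div 2 = q div 2" "p div 2 < m" "us ! (p div 2) \<in> unodes U"
    | "odd p" "even q" "p div 2 < m" "q div 2 < m" "(us ! (p div 2), us ! (q div 2)) \<in> uedges U"
    unfolding cap_def by (auto split: if_splits)
  then show thesis
  proof cases
    case 1
    have "q = Suc (2 * (p div 2))" unfolding 1(3) using 1(2) by (rule half(2))
    then show thesis by (rule that(1)[OF 1(4,5) half(1)[OF 1(1)]])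
  next
    case 2
    then show thesis using that(2)[OF 2(3-5) half(2)[OF 2(1)] half(1)[OF 2(2)]] by blast
  qed
qed

text \<open>The source is the entry of \<open>us ! a\<close> and the sink the exit of
  \<open>us ! b\<close>, so the ends are split as well. As their costs are infinite, their splitting
  arcs have capacity \<open>big\<close> and cross no cut of smaller value.\<close>

sublocale flow_network "2 * m" cap "2 * a" "Suc (2 * b)"
proof
  show "2 * a < 2 * m" "Suc (2 * b) < 2 * m" using ab by auto
  show "2 * a \<noteq> Suc (2 * b)" by presburger
  show "0 \<le> cap p q" for p q
    using big_pos cost_real_nonneg by (auto simp: cap_def)
  show "cap (2 * a) (2 * a) = 0" by (simp add: cap_def)
qed

lemma cap_le_cut_value:
  assumes "S \<subseteq> {..<2 * m}" "p \<in> S" "q < 2 * m" "q \<notin> S"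
  shows "cap p q \<le> cut_value S"
proof -
  have "finite S" using assms(1) finite_subset by blast
  have "cap p q \<le> (\<Sum>v\<in>{..<2 * m} - S. cap p v)"
    using assms cap_nonneg by (intro member_le_sum) auto
  also have "\<dots> \<le> cut_value S"
    unfolding cut_value_def using assms(2) \<open>finite S\<close> cap_nonneg
    by (intro member_le_sum[of p S "\<lambda>u. \<Sum>v\<in>{..<2 * m} - S. cap u v"] sum_nonneg) auto
  finally show ?thesis .
qed

lemma cut_value_pairs: "cut_value S = (\<Sum>(p, q)\<in>S \<times> ({..<2 * m} - S). cap p q)" if "S \<subseteq> {..<2 * m}"
  unfolding cut_value_def by (rule sum.cartesian_product)

definition split_nodes :: "nat set \<Rightarrow> nat set" where
  "split_nodes S = {i. i < m \<and> us ! i \<in> unodes U \<and> 2 * i \<in> S \<and> Suc (2 * i) \<notin> S}"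

lemma inj_on_nth: "J \<subseteq> {..<m} \<Longrightarrow> inj_on ((!) us) J"
  using distinct by (auto simp: inj_on_def m_def nth_eq_iff_index_eq subset_iff)

lemma sum_cost:
  assumes "J \<subseteq> {..<m}" "\<And>i. i \<in> J \<Longrightarrow> c (us ! i) \<noteq> \<infinity>"
  shows "sum c ((!) us ` J) = ereal (\<Sum>i\<in>J. real_of_ereal (c (us ! i)))"
proof -
  have "sum c ((!) us ` J) = (\<Sum>i\<in>J. c (us ! i))"
    using inj_on_nth[OF assms(1)] by (simp add: sum.reindex)
  also have "\<dots> = (\<Sum>i\<in>J. ereal (real_of_ereal (c (us ! i))))"
  proof (rule sum.cong)
    fix i assume "i \<in> J"
    then have "0 \<le> c (us ! i)" "c (us ! i) \<noteq> \<infinity>"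
      using assms cost_nonneg by (auto simp: m_def)
    then show "c (us ! i) = ereal (real_of_ereal (c (us ! i)))" by (cases "c (us ! i)") auto
  qed simp
  finally show ?thesis by simp
qed

text \<open>A cut of value below \<open>big\<close> crosses neither an edge of \<open>U\<close> nor
  a node of infinite cost. The splitting arcs of \<open>C\<close> are among the crossing arcs, which
  bounds the cost.\<close>

lemma vertex_cut_of_cut:
  assumes S: "S \<subseteq> {..<2 * m}" "2 * a \<in> S" "Suc (2 * b) \<notin> S" and less: "cut_value S < big"
  defines "C \<equiv> (!) us ` split_nodes S"
  shows "vertex_cut U (us ! a) (us ! b) C" "sum c C \<le> ereal (cut_value S)"
proof -
  have fin: "c (us ! i) \<noteq> \<infinity>" if "i \<in> split_nodes S" for i
  proof
    assume "c (us ! i) = \<infinity>"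
    then have "big \<le> cut_value S"
      using that cap_le_cut_value[OF S(1), of "2 * i" "Suc (2 * i)"] by (auto simp:
        split_nodes_def cap_node)
    with less show False by simp
  qed
  have J: "split_nodes S \<subseteq> {..<m}" by (auto simp: split_nodes_def)
  have C: "C \<subseteq> unodes U - {us ! a, us ! b}"
  proof -
    have "c x \<noteq> \<infinity>" if "x \<in> C" for x using that fin unfolding C_def by blast
    moreover have "C \<subseteq> unodes U" by (auto simp: C_def split_nodes_def)
    ultimately show ?thesis using cost_ab by blast
  qed
  have "(us ! a, us ! b) \<notin> (uedges U \<inter> (unodes U - C) \<times> (unodes U - C))\<^sup>*" (is "_ \<notin> ?E\<^sup>*")
  proof
    assume "(us ! a, us ! b) \<in> ?E\<^sup>*"
    \<comment> \<open>Each node reached has its entry on the source side. Its exit is there too,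
      since the node is not in \<open>C\<close>, and following an edge keeps to \<open>S\<close>,
      since crossing would cost \<open>big\<close>. At \<open>us ! b\<close> this puts a splitting
      arc of infinite cost into the cut.\<close>
    then have "\<exists>j<m. us ! b = us ! j \<and> 2 * j \<in> S"
    proof (induction rule: rtrancl_induct)
      case base
      show ?case using S ab by auto
    next
      case (step y z)
      then obtain i where i: "i < m" "y = us ! i" "2 * i \<in> S" by auto
      have "i \<notin> split_nodes S" using step.hyps(2) i by (auto simp: C_def)
      then have i': "Suc (2 * i) \<in> S" using step.hyps(2) i by (auto simp: split_nodes_def)
      have "z \<in> set us" using step.hyps(2) nodes by auto
      then obtain j where j: "j < m" "z = us ! j" by (metis in_set_conv_nth m_def)
      have "2 * j \<in> S"
      proof (rule ccontr)
        assume "2 * j \<notin> S"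
        then have "cap (Suc (2 * i)) (2 * j) \<le> cut_value S"
          using j(1) i' by (intro cap_le_cut_value[OF S(1)]) auto
        with less show False using step.hyps(2) i j by (auto simp: cap_edge)
      qed
      with j show ?case by blast
    qed
    then obtain j where "j < m" "us ! b = us ! j" "2 * j \<in> S" by blast
    then have "2 * b \<in> S" using ab(2) distinct by (simp add: nth_eq_iff_index_eq m_def)
    then have "b \<in> split_nodes S" using S(3) ab by (simp add: split_nodes_def)
    with fin cost_ab show False by blast
  qed
  with C ab show "vertex_cut U (us ! a) (us ! b) C" by (subst vertex_cut_iff) auto
  have "sum c C = ereal (\<Sum>i\<in>split_nodes S. real_of_ereal (c (us ! i)))"
    unfolding C_def using J fin by (rule sum_cost)
  also have "(\<Sum>i\<in>split_nodes S. real_of_ereal (c (us ! i))) = (\<Sum>i\<in>split_nodes S. cap (2 * i) (Suc (2 * i)))"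
    using fin by (intro sum.cong) (auto simp: split_nodes_def cap_node)
  also have "\<dots> = (\<Sum>(p, q)\<in>(\<lambda>i. (2 * i, Suc (2 * i))) ` split_nodes S. cap p q)"
    by (subst sum.reindex) (auto simp: inj_on_def)
  also have "\<dots> \<le> cut_value S"
    unfolding cut_value_pairs[OF S(1)] using finite_subset[OF S(1)] cap_nonneg
    by (intro sum_mono2) (auto simp: split_nodes_def)
  finally show "sum c C \<le> ereal (cut_value S)" by simp
qed

lemma cut_of_vertex_cut:
  assumes C: "vertex_cut U (us ! a) (us ! b) C" and fin: "sum c C < \<infinity>"
  shows "\<exists>S\<subseteq>{..<2 * m}. 2 * a \<in> S \<and> Suc (2 * b) \<notin> S \<and> cut_value S < big \<and> ereal (cut_value S) \<le> sum c C"
proof -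
  let ?E = "uedges U \<inter> (unodes U - C) \<times> (unodes U - C)"
  let ?P = "\<lambda>i. (us ! a, us ! i) \<in> ?E\<^sup>*"
  have C': "C \<subseteq> unodes U - {us ! a, us ! b}" "(us ! a, us ! b) \<notin> ?E\<^sup>*"
    using C vertex_cut_iff[OF ab(3,4)] by auto
  define J where "J = {i. i < m \<and> us ! i \<in> C}"
  \<comment> \<open>The source side holds all that is reachable without \<open>C\<close>, and the
    entries of all nodes of \<open>C\<close>, whether reachable or not. So every splitting arc of
    \<open>C\<close> crosses, and the value is exactly the cost of \<open>C\<close>.\<close>
  define S where "S = {2 * i | i. i < m \<and> (?P i \<or> us ! i \<in> C)} \<union> {Suc (2 * i) | i. i < m \<and> ?P i}"
  have CJ: "C = (!) us ` J"
  proof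
    show "C \<subseteq> (!) us ` J"
    proof
      fix x assume "x \<in> C"
      then have "x \<in> set us" using C'(1) nodes by auto
      with \<open>x \<in> C\<close> show "x \<in> (!) us ` J" unfolding J_def m_def in_set_conv_nth by auto
    qed
  qed (auto simp: J_def)
  have notC: "us ! i \<notin> C" if "?P i" for i
  proof (cases "us ! i = us ! a")
    case False
    with that obtain y where "(y, us ! i) \<in> ?E" by (metis rtranclE)
    then show ?thesis by blast
  qed (use C'(1) in auto)
  have finite: "c (us ! i) \<noteq> \<infinity>" if "i \<in> J" for i
  proof
    assume "c (us ! i) = \<infinity>"
    moreover have "us ! i \<in> C" using that by (simp add: J_def)
    moreover have "finite C" using C'(1) nodes by (meson Diff_subset List.finite_set finite_subset)
    ultimately have "sum c C = \<infinity>" by (auto simp: sum_Pinfty)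
    with fin show False by simp
  qed
  have S: "S \<subseteq> {..<2 * m}" by (auto simp: S_def)
  have parity: "2 * i \<noteq> Suc (2 * j)" "Suc (2 * j) \<noteq> 2 * i" for i j :: nat by presburger+
  have even: "2 * i \<in> S \<longleftrightarrow> i < m \<and> (?P i \<or> us ! i \<in> C)" for i
    by (auto simp: S_def parity)
  have odd: "Suc (2 * i) \<in> S \<longleftrightarrow> i < m \<and> ?P i" for i
    by (auto simp: S_def parity)
  \<comment> \<open>An edge from a reachable exit leads to a node that is reachable or in
    \<open>C\<close>, and in both cases its entry is in \<open>S\<close>.\<close>
  have zero: "cap p q = 0" if "p \<in> S" "q < 2 * m" "q \<notin> S" "(p, q) \<notin> (\<lambda>i. (2 * i, Suc (2 * i))) ` J" for p q
  proof (rule ccontr)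
    assume "cap p q \<noteq> 0"
    then show False
    proof (cases rule: cap_cases)
      case (1 i)
      with that even[of i] odd[of i] show False by (auto simp: J_def)
    next
      case (2 i j)
      with that odd[of i] have "?P i" by auto
      with 2 edges that even[of j] notC[of i] have "(us ! i, us ! j) \<in> ?E" by auto
      with \<open>?P i\<close> have "?P j" by (rule rtrancl_into_rtrancl)
      with 2 that even[of j] show False by auto
    qed
  qed
  have "cut_value S = (\<Sum>(p, q)\<in>(\<lambda>i. (2 * i, Suc (2 * i))) ` J. cap p q)"
    unfolding cut_value_pairs[OF S]
  proof (rule sum.mono_neutral_right)
    show "finite (S \<times> ({..<2 * m} - S))" using finite_subset[OF S] by auto
    show "(\<lambda>i. (2 * i, Suc (2 * i))) ` J \<subseteq> S \<times> ({..<2 * m} - S)"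
      using even odd notC by (auto simp: J_def)
    show "\<forall>x\<in>S \<times> ({..<2 * m} - S) - (\<lambda>i. (2 * i, Suc (2 * i))) ` J. (case x of (p, q) \<Rightarrow> cap p q) = 0"
      using zero by auto
  qed
  also have "\<dots> = (\<Sum>i\<in>J. cap (2 * i) (Suc (2 * i)))"
    by (subst sum.reindex) (auto simp: inj_on_def)
  also have "\<dots> = (\<Sum>i\<in>J. real_of_ereal (c (us ! i)))"
    using finite C'(1) by (intro sum.cong) (auto simp: J_def cap_node)
  finally have val: "cut_value S = (\<Sum>i\<in>J. real_of_ereal (c (us ! i)))" .
  have "J \<subseteq> {..<m}" by (auto simp: J_def)
  then have "cut_value S \<le> (\<Sum>i<m. real_of_ereal (c (us ! i)))"
    unfolding val using cost_real_nonneg by (intro sum_mono2) auto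
  then have "cut_value S < big" by (simp add: big_def)
  moreover have "sum c C = ereal (cut_value S)"
    unfolding CJ val using \<open>J \<subseteq> {..<m}\<close> finite by (rule sum_cost)
  moreover have "2 * a \<in> S" "Suc (2 * b) \<notin> S" using even[of a] odd[of b] ab C'(2) by auto
  ultimately show ?thesis using S by auto
qed

text \<open>Optimality is a chain: the cost of \<open>C\<close> is at most the value of the gap cut,
  which equals the excess of the sink and is at most the value of any other cut, in particular of
  one that comes from a finite vertex cut.\<close>

lemma min_vertex_cut_if_gap:
  assumes p: "preflow r d cur" "\<And>v. \<not> active r d v" and k: "k < 2 * m" "\<And>v. v < 2 * m \<Longrightarrow> d v \<noteq> k"
    and less: "excess r (Suc (2 * b)) < big"
  defines "C \<equiv> (!) us ` {i. i < m \<and> us ! i \<in> unodes U \<and> k < d (2 * i) \<and> d (Suc (2 * i)) < k}"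
  shows "min_vertex_cut U c (us ! a) (us ! b) C" "sum c C < \<infinity>"
proof -
  define S where "S = {v. v < 2 * m \<and> k < d v}"
  note S = gap_cut[OF p k, folded S_def]
  have sub: "S \<subseteq> {..<2 * m}" by (auto simp: S_def)
  have "split_nodes S = {i. i < m \<and> us ! i \<in> unodes U \<and> k < d (2 * i) \<and> d (Suc (2 * i)) < k}"
  proof -
    have "Suc (2 * i) \<notin> S \<longleftrightarrow> d (Suc (2 * i)) < k" if "i < m" for i
      using that k(2)[of "Suc (2 * i)"] by (auto simp: S_def)
    moreover have "2 * i \<in> S \<longleftrightarrow> k < d (2 * i)" if "i < m" for i using that by (simp add: S_def)
    ultimately show ?thesis unfolding split_nodes_def by blast
  qed
  then have C: "C = (!) us ` split_nodes S" by (simp add: C_def)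
  have cut: "vertex_cut U (us ! a) (us ! b) C" "sum c C \<le> ereal (cut_value S)"
    using vertex_cut_of_cut[OF sub S(1,2)] less S(3) by (auto simp: C)
  have "sum c C \<le> sum c C'" if cut': "vertex_cut U (us ! a) (us ! b) C'" for C'
  proof (cases "sum c C' < \<infinity>")
    case True
    then obtain S' where S': "S' \<subseteq> {..<2 * m}" "2 * a \<in> S'" "Suc (2 * b) \<notin> S'"
      "ereal (cut_value S') \<le> sum c C'"
      using cut_of_vertex_cut[OF cut'] by blast
    have "ereal (cut_value S) \<le> ereal (cut_value S')"
      using excess_le_cut_value[OF p(1) S'(1-3)] S(3) by simp
    with cut(2) S'(4) show ?thesis by (meson order_trans)
  qed auto
  with cut show "min_vertex_cut U c (us ! a) (us ! b) C" by (auto simp: min_vertex_cut_def)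
  show "sum c C < \<infinity>" using cut(2) by (cases "sum c C") auto
qed

text \<open>A vertex cut of finite cost would give a cut of value below \<open>big\<close>, against
  weak duality.\<close>

lemma no_finite_vertex_cut:
  assumes p: "preflow r d cur" and "\<not> excess r (Suc (2 * b)) < big"
  shows "\<exists>C. min_vertex_cut U c (us ! a) (us ! b) C \<and> \<not> sum c C < \<infinity>"
proof -
  have inf: "sum c C = \<infinity>" if cut: "vertex_cut U (us ! a) (us ! b) C" for C
  proof (rule ccontr)
    assume "sum c C \<noteq> \<infinity>"
    then obtain S where S: "S \<subseteq> {..<2 * m}" "2 * a \<in> S" "Suc (2 * b) \<notin> S" "cut_value S < big"
      using cut_of_vertex_cut[OF cut] by auto
    with excess_le_cut_value[OF p(1) S(1-3)] assms(2) show False by simp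
  qed
  \<comment> \<open>When all vertex cuts have infinite cost, any of them is minimum. All nodes but
    the ends form one because the ends are not adjacent.\<close>
  let ?C = "unodes U - {us ! a, us ! b}"
  have "(us ! a, us ! b) \<notin> (uedges U \<inter> (unodes U - ?C) \<times> (unodes U - ?C))\<^sup>*" (is "_ \<notin> ?E\<^sup>*")
  proof
    assume "(us ! a, us ! b) \<in> ?E\<^sup>*"
    then have "us ! b = us ! a"
    proof (induction rule: rtrancl_induct)
      case (step y z)
      then show ?case using ab(6) by auto
    qed simp
    with ab show False by simp
  qed
  then have "vertex_cut U (us ! a) (us ! b) ?C" using ab by (subst vertex_cut_iff) auto
  with inf have "min_vertex_cut U c (us ! a) (us ! b) ?C" "\<not> sum c ?C < \<infinity>"
    by (auto simp: min_vertex_cut_def)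
  then show ?thesis by blast
qed

end

section \<open>Step 5\<close>

definition Push :: com where
  "Push = Seq (RStore ''r'' (NVar ''v'') (NVar ''u'') (RSub (RArr ''r'' (NVar ''v'') (NVar ''u''))
    (RVar ''x'')))
    (Seq (RStore ''r'' (NVar ''u'') (NVar ''v'') (RAdd (RArr ''r'' (NVar ''u'') (NVar ''v'')) (RVar ''x'')))
    (Seq (RStore ''e'' (NVar ''v'') (NConst 0) (RSub (RArr ''e'' (NVar ''v'') (NConst 0)) (RVar ''x'')))
      (RStore ''e'' (NVar ''u'') (NConst 0) (RAdd (RArr ''e'' (NVar ''u'') (NConst 0)) (RVar ''x'')))))"

abbreviation Advance :: com where
  "Advance \<equiv> NStore ''cur'' (NVar ''v'') (NConst 0) (NSuc (NArr ''cur'' (NVar ''v'') (NConst 0)))"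

abbreviation has_excess :: bexp where
  "has_excess \<equiv> RLess RZero (RArr ''e'' (NVar ''v'') (NConst 0))"

text \<open>The pointer advances unless the whole excess is pushed with residual capacity to spare.
  Hence each step of the loop either moves the pointer or ends the discharge.\<close>

definition Scan :: com where
  "Scan = Seq (NAssign ''u'' (NArr ''cur'' (NVar ''v'') (NConst 0)))
    (Cond (BAnd (RLess RZero (RArr ''r'' (NVar ''v'') (NVar ''u'')))
        (NEq (NArr ''d'' (NVar ''v'') (NConst 0)) (NSuc (NArr ''d'' (NVar ''u'') (NConst 0)))))
      (Cond (RLess (RArr ''e'' (NVar ''v'') (NConst 0)) (RArr ''r'' (NVar ''v'') (NVar ''u'')))
        (Seq (RAssign ''x'' (RArr ''e'' (NVar ''v'') (NConst 0))) Push)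
        (Seq (RAssign ''x'' (RArr ''r'' (NVar ''v'') (NVar ''u''))) (Seq Push Advance)))
      Advance)"

definition Discharge :: com where
  "Discharge = While (BAnd (NLess (NArr ''cur'' (NVar ''v'') (NConst 0)) (NVar ''N'')) has_excess) Scan"

text \<open>A vertex is relabelled at most once per pass and keeps its remaining excess until the
  next pass. So the maximal height of active vertices rises by at most one in a pass.\<close>

definition Process :: com where
  "Process = Cond (BAnd (BAnd (BNot (NEq (NVar ''v'') (NVar ''s''))) (BNot (NEq (NVar ''v'') (NVar ''t''))))
       (BAnd has_excess (NLess (NArr ''d'' (NVar ''v'') (NConst 0)) (NVar ''N''))))
    (Seq (NAssign ''flag'' (NConst 1)) (Seq Discharge
      (Cond has_excess
        (Seq (NStore ''d'' (NVar ''v'') (NConst 0) (NSuc (NArr ''d'' (NVar ''v'') (NConst 0))))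
          (NStore ''cur'' (NVar ''v'') (NConst 0) (NConst 0)))
        Skip)))
    Skip"

definition Push_Relabel :: com where
  "Push_Relabel = Seq (NAssign ''flag'' (NConst 1))
    (While (NEq (NVar ''flag'') (NConst 1)) (Seq (NAssign ''flag'' (NConst 0)) (For ''v'' ''N'' Process)))"

lemma writes_Push [simp]: "nw Push = {}" "aw Push = {}" "rw Push = {}" "raw Push = {''r'', ''e''}"
  by (auto simp: Push_def)

lemma writes_Discharge [simp]: "nw Discharge = {''u''}" "aw Discharge = {''cur''}" "rw Discharge = {''x''}"
  "raw Discharge = {''r'', ''e''}"
  by (auto simp: Discharge_def Scan_def)

lemma writes_Process [simp]: "nw Process = {''flag'', ''u''}" "aw Process = {''d'', ''cur''}"
  "rw Process = {''x''}" "raw Process = {''r'', ''e''}"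
  by (auto simp: Process_def)

lemma writes_Push_Relabel [simp]: "nw Push_Relabel = {''flag'', ''u'', ''v''}"
  "aw Push_Relabel = {''d'', ''cur''}"
  "rw Push_Relabel = {''x''}" "raw Push_Relabel = {''r'', ''e''}"
  by (auto simp: Push_Relabel_def)

abbreviation resid :: "store \<Rightarrow> nat \<Rightarrow> nat \<Rightarrow> real" where "resid s \<equiv> rarr s ''r''"
definition exc :: "store \<Rightarrow> nat \<Rightarrow> real" where "exc s = (\<lambda>v. rarr s ''e'' v 0)"
definition height :: "store \<Rightarrow> nat \<Rightarrow> nat" where "height s = (\<lambda>v. narr s ''d'' v 0)"
definition arc :: "store \<Rightarrow> nat \<Rightarrow> nat" where "arc s = (\<lambda>v. narr s ''cur'' v 0)"

text \<open>\<open>10\<close> pays for a step of a current arc and \<open>N * 18 + 5\<close> for a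
  pass. The number of passes is bounded by \<open>passes_le\<close>, with one more for the last
  pass, which meets no active vertex.\<close>

definition flow_time :: "nat \<Rightarrow> nat" where
  "flow_time N = 10 * (N * ((N + 1) * N + N)) + (N * 18 + 5) * (2 * (N * N) + N + 1) + 2"

context flow_network
begin

text \<open>The array of excesses is kept up to date away from the source only: the initialisation
  does not compute the excess of the source, which is never discharged.\<close>

definition flow_state :: "store \<Rightarrow> bool" where
  "flow_state s \<longleftrightarrow> nvar s ''N'' = N \<and> nvar s ''s'' = src \<and> nvar s ''t'' = snk \<and>
     preflow (resid s) (height s) (arc s) \<and> (\<forall>v<N. v \<noteq> src \<longrightarrow> exc s v = excess (resid s) v)"

lemma wp_Push:
  assumes "nvar s ''v'' = v" "nvar s ''u'' = u" "u \<noteq> v"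
    and Q: "\<And>s'. resid s' = push (resid s) v u (rvar s ''x'') \<Longrightarrow>
      exc s' = (exc s)(v := exc s v - rvar s ''x'', u := exc s u + rvar s ''x'') \<Longrightarrow>
      height s' = height s \<Longrightarrow> arc s' = arc s \<Longrightarrow> nvar s' = nvar s \<Longrightarrow> Q s' 4"
  shows "wp Push s Q"
proof -
  have "wp Push s (\<lambda>s' t. resid s' = push (resid s) v u (rvar s ''x'') \<and>
    exc s' = (exc s)(v := exc s v - rvar s ''x'', u := exc s u + rvar s ''x'') \<and> t = 4)"
    using assms(1-3) by (auto simp: Push_def push_def exc_def fun_eq_iff)
  then show ?thesis
  proof (rule wp_mono)
    fix s' and t :: nat assume "unchanged Push s s'"
    then have "nvar s' = nvar s" "narr s' = narr s" by (auto simp: unchanged_def)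
    moreover assume "resid s' = push (resid s) v u (rvar s ''x'') \<and>
      exc s' = (exc s)(v := exc s v - rvar s ''x'', u := exc s u + rvar s ''x'') \<and> t = 4"
    ultimately show "Q s' t" using Q[of s'] by (simp add: height_def arc_def)
  qed
qed

lemma wp_Advance:
  assumes "nvar s ''v'' = v"
    and "\<And>s'. arc s' = (arc s)(v := Suc (arc s v)) \<Longrightarrow> height s' = height s \<Longrightarrow> resid s' = resid s \<Longrightarrow>
      exc s' = exc s \<Longrightarrow> nvar s' = nvar s \<Longrightarrow> Q s' 1"
  shows "wp Advance s Q"
  unfolding wp_simps using assms(1) by (intro assms(2)) (auto simp: arc_def height_def exc_def)

text \<open>Advancing the pointer is paid by \<open>scans\<close>. A push that does not saturate its
  arc leaves the pointer in place but uses up the excess; it is paid by the credit of 10 held as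
  long as \<open>i\<close> has excess.\<close>

lemma wp_Scan:
  assumes s: "flow_state s" "nvar s ''v'' = i" "i < N" "i \<noteq> src" and cur: "arc s i < N" and ex:
    "0 < exc s i"
  shows "wp Scan s (\<lambda>s' t. flow_state s' \<and> nvar s' ''v'' = i \<and> height s' = height s \<and>
    (\<forall>u. u \<noteq> i \<longrightarrow> active (resid s') (height s) u \<longrightarrow> active (resid s) (height s) u \<or> Suc
      (height s u) = height s i) \<and>
    t + 1 + 10 * scans (height s') (arc s') + (if 0 < exc s' i then 10 else 0) \<le>
      10 * scans (height s) (arc s) + 10)" (is "wp _ _ ?Q")
proof -
  let ?d = "height s" and ?r = "resid s" and ?u = "arc s i"
  let ?s = "setn ''u'' ?u s"
  have s': "resid ?s = ?r" "exc ?s = exc s" "height ?s = ?d" "arc ?s = arc s" "nvar ?s ''v'' = i"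
    "nvar ?s ''u'' = ?u"
    using s(2) by (auto simp: exc_def height_def arc_def)
  have p: "preflow ?r ?d (arc s)" and e: "\<And>v. v < N \<Longrightarrow> v \<noteq> src \<Longrightarrow> exc s v = excess ?r v"
    using s(1) by (auto simp: flow_state_def)
  have sc: "Suc (scans ?d ((arc s)(i := Suc ?u))) = scans ?d (arc s)"
    using s(3) cur by (rule scans_advance)
  \<comment> \<open>The common ending of the three branches: the pointer has advanced or the excess
    is gone.\<close>
  have fin: "?Q s' t" if "preflow (resid s') ?d (arc s')" "height s' = ?d" "nvar s' = nvar ?s"
    "\<And>v. v < N \<Longrightarrow> v \<noteq> src \<Longrightarrow> exc s' v = excess (resid s') v"
    "\<And>u. u \<noteq> i \<Longrightarrow> active (resid s') ?d u \<Longrightarrow> active ?r ?d u \<or> Suc (?d u) = ?d i"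
    "arc s' = (arc s)(i := Suc ?u) \<or> arc s' = arc s \<and> exc s' i = 0" "t \<le> 9" for s' t
    using that s(1,2) sc by (auto simp: flow_state_def)
  have St: "wp Scan s Q \<longleftrightarrow> (if 0 < ?r i ?u \<and> ?d i = Suc (?d ?u)
      then if exc s i < ?r i ?u
        then wp Push (?s\<lparr>rvar := (rvar s)(''x'' := exc s i)\<rparr>) (\<lambda>s' t. Q s' (1 + Suc (Suc (1 + t))))
        else wp Push (?s\<lparr>rvar := (rvar s)(''x'' := ?r i ?u)\<rparr>)
          (\<lambda>s' t. wp Advance s' (\<lambda>s'' t'. Q s'' (1 + Suc (Suc (1 + (t + t'))))))
      else wp Advance ?s (\<lambda>s' t. Q s' (1 + Suc t)))" for Q :: "store \<Rightarrow> nat \<Rightarrow> bool"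
    by (simp add: Scan_def s(2) arc_def height_def exc_def)
  show ?thesis
  proof (cases "0 < ?r i ?u \<and> ?d i = Suc (?d ?u)")
    case False
    show ?thesis unfolding St if_not_P[OF False]
      by (rule wp_Advance[OF s'(5)], rule fin)
        (use s' e preflow_advance[OF p s(3) cur False] in auto)
  next
    case True
    then have ui: "?u \<noteq> i" by auto
    have act: "active ?r ?d u \<or> Suc (?d u) = ?d i" if "u \<noteq> i" "active (push ?r i ?u x) ?d u" for u x
      using that True excess_push[OF s(3) cur ui] by (auto simp: active_def split: if_splits)
    have e_i: "excess ?r i = exc s i" using e s by simp
    have exc': "((exc s)(i := exc s i - x, ?u := exc s ?u + x)) v = excess (push ?r i ?u x) v"
      if "v < N" "v \<noteq> src" for x v
      using e s(3,4) cur that unfolding excess_push[OF s(3) cur ui] by auto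
    have x: "exc (?s\<lparr>rvar := f\<rparr>) = exc s" "height (?s\<lparr>rvar := f\<rparr>) = ?d" "arc (?s\<lparr>rvar := f\<rparr>) = arc s"
      "resid (?s\<lparr>rvar := f\<rparr>) = ?r" "nvar (?s\<lparr>rvar := f\<rparr>) = nvar ?s" "rvar (?s\<lparr>rvar := f\<rparr>) = f"
      "nvar (?s\<lparr>rvar := f\<rparr>) ''v'' = i" "nvar (?s\<lparr>rvar := f\<rparr>) ''u'' = ?u" for f
      using s(2) by (auto simp: exc_def height_def arc_def)
    note push = preflow_push[OF p s(3,4) cur conjunct2[OF True]]
    show ?thesis
    proof (cases "exc s i < ?r i ?u")
      case less: True
      have pf: "preflow (push ?r i ?u (exc s i)) ?d (arc s)" using ex less e_i by (intro push) auto
      show ?thesis unfolding St if_P[OF True] if_P[OF less]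
      proof (rule wp_Push[OF x(7,8) ui], unfold x(1-6) fun_upd_same)
        fix s1 assume s1: "resid s1 = push ?r i ?u (exc s i)"
          "exc s1 = (exc s)(i := exc s i - exc s i, ?u := exc s ?u + exc s i)"
          "height s1 = ?d" "arc s1 = arc s" "nvar s1 = nvar ?s"
        show "?Q s1 (1 + Suc (Suc (1 + 4)))"
          by (rule fin) (use s1 pf act exc'[of _ "exc s i"] ui in auto)
      qed
    next
      case geq: False
      have "preflow (push ?r i ?u (?r i ?u)) ?d (arc s)" using True geq e_i by (intro push) auto
      then have pf: "preflow (push ?r i ?u (?r i ?u)) ?d ((arc s)(i := Suc ?u))"
        using s(3) cur ui by (intro preflow_advance) (auto simp: push_def)
      show ?thesis unfolding St if_P[OF True] if_not_P[OF geq]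
      proof (rule wp_Push[OF x(7,8) ui], unfold x(1-6) fun_upd_same)
        fix s1 assume s1: "resid s1 = push ?r i ?u (?r i ?u)"
          "exc s1 = (exc s)(i := exc s i - ?r i ?u, ?u := exc s ?u + ?r i ?u)"
          "height s1 = ?d" "arc s1 = arc s" "nvar s1 = nvar ?s"
        have v: "nvar s1 ''v'' = i" using s1(5) s'(5) by simp
        show "wp Advance s1 (\<lambda>s'' t'. ?Q s'' (1 + Suc (Suc (1 + (4 + t')))))"
        proof (rule wp_Advance[OF v], unfold s1)
          fix s2 assume s2: "arc s2 = (arc s)(i := Suc ?u)" "height s2 = ?d"
            "resid s2 = push ?r i ?u (?r i ?u)"
            "exc s2 = (exc s)(i := exc s i - ?r i ?u, ?u := exc s ?u + ?r i ?u)" "nvar s2 = nvar ?s"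
          show "?Q s2 (1 + Suc (Suc (1 + (4 + 1))))"
            by (rule fin) (use s2 pf act exc'[of _ "?r i ?u"] in auto)
        qed
      qed
    qed
  qed
qed

text \<open>The constant 11 consists of the credit of 10 for a final push that does not saturate its
  arc and of the failing loop test.\<close>

lemma wp_Discharge:
  assumes s: "flow_state s" "nvar s ''v'' = i" "i < N" "i \<noteq> src"
  shows "wp Discharge s (\<lambda>s' t. flow_state s' \<and> nvar s' ''v'' = i \<and> height s' = height s \<and>
    (\<forall>u. u \<noteq> i \<longrightarrow> active (resid s') (height s) u \<longrightarrow> active (resid s) (height s) u \<or> Suc
      (height s u) = height s i) \<and>
    \<not> (arc s' i < N \<and> 0 < exc s' i) \<and>
    t + 10 * scans (height s') (arc s') \<le> 10 * scans (height s) (arc s) + 11)"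
proof -
  let ?J = "\<lambda>s'. flow_state s' \<and> nvar s' ''v'' = i \<and> height s' = height s \<and>
    (\<forall>u. u \<noteq> i \<longrightarrow> active (resid s') (height s) u \<longrightarrow> active (resid s) (height s) u \<or> Suc
      (height s u) = height s i)"
  let ?b = "BAnd (NLess (NArr ''cur'' (NVar ''v'') (NConst 0)) (NVar ''N'')) has_excess"
  let ?m = "\<lambda>s'. 10 * scans (height s') (arc s') + (if 0 < exc s' i then 10 else 0)"
  have "wp Discharge s (\<lambda>s' t. ?J s' \<and> \<not> bval ?b s' \<and> t + ?m s' \<le> ?m s + 1)"
    unfolding Discharge_def
  proof (rule wp_While)
    fix s' assume J: "?J s'" and b: "bval ?b s'"
    then have "arc s' i < N" "0 < exc s' i" by (auto simp: arc_def exc_def flow_state_def)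
    with J s have "wp Scan s' (\<lambda>s'' t. flow_state s'' \<and> nvar s'' ''v'' = i \<and> height s'' = height s' \<and>
      (\<forall>u. u \<noteq> i \<longrightarrow> active (resid s'') (height s') u \<longrightarrow>
        active (resid s') (height s') u \<or> Suc (height s' u) = height s' i) \<and>
      t + 1 + 10 * scans (height s'') (arc s'') + (if 0 < exc s'' i then 10 else 0) \<le>
        10 * scans (height s') (arc s') + 10)"
      by (intro wp_Scan) auto
    then show "wp Scan s' (\<lambda>s'' t. ?J s'' \<and> t + 1 + ?m s'' \<le> ?m s')"
      by (rule wp_mono) (use J \<open>0 < exc s' i\<close> in auto)
  qed (use s in auto)
  then show ?thesis
    by (rule wp_mono) (auto simp: arc_def exc_def flow_state_def split: if_splits)
qed

text \<open>Excess left after discharging means that the pointer has run up to \<open>N\<close>,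
  which licenses the relabelling. The constant 16 is the 11 of \<open>Discharge\<close> and at most
  five further steps.\<close>

lemma wp_Process:
  assumes s: "flow_state s" "nvar s ''v'' = i" "i < N"
    and inv: "pass_inv B D i (nvar s ''flag'') (resid s) (height s)" "nvar s ''flag'' \<in> {0, 1}"
  shows "wp Process s (\<lambda>s' t. flow_state s' \<and> pass_inv B D (Suc i) (nvar s' ''flag'') (resid s')
    (height s') \<and>
    nvar s' ''flag'' \<in> {0, 1} \<and>
    t + 10 * scans (height s') (arc s') \<le> 10 * scans (height s) (arc s) + 16)"
proof -
  let ?Q = "\<lambda>s' t. flow_state s' \<and> pass_inv B D (Suc i) (nvar s' ''flag'') (resid s') (height s') \<and>
    nvar s' ''flag'' \<in> {0, 1} \<and>
    t + 10 * scans (height s') (arc s') \<le> 10 * scans (height s) (arc s) + 16"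
  let ?b = "BAnd (BAnd (BNot (NEq (NVar ''v'') (NVar ''s''))) (BNot (NEq (NVar ''v'') (NVar ''t''))))
       (BAnd has_excess (NLess (NArr ''d'' (NVar ''v'') (NConst 0)) (NVar ''N'')))"
  have b: "bval ?b s \<longleftrightarrow> active (resid s) (height s) i"
    using s by (auto simp: flow_state_def active_def exc_def height_def)
  show ?thesis
  proof (cases "active (resid s) (height s) i")
    case False
    then have "?Q s (Suc 1)" using s inv by (auto intro: pass_inv_inactive)
    with b False show ?thesis unfolding Process_def wp_Cond by (simp only: if_False wp_simps)
  next
    case True
    let ?s = "setn ''flag'' 1 s"
    let ?R = "Cond has_excess
        (Seq (NStore ''d'' (NVar ''v'') (NConst 0) (NSuc (NArr ''d'' (NVar ''v'') (NConst 0))))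
          (NStore ''cur'' (NVar ''v'') (NConst 0) (NConst 0)))
        Skip"
    have s': "flow_state ?s" "nvar ?s ''v'' = i" using s by (auto simp:
      flow_state_def height_def arc_def exc_def)
    have "i \<noteq> src" "i \<noteq> snk" "height s i < N" using True by (auto simp: active_def)
    from wp_Discharge[OF s' s(3) \<open>i \<noteq> src\<close>]
    have "wp Discharge ?s (\<lambda>s' t. wp ?R s' (\<lambda>s'' t'. ?Q s'' (Suc (1 + (t + t')))))"
    proof (rule wp_mono)
      fix s' t
      assume *: "flow_state s' \<and> nvar s' ''v'' = i \<and> height s' = height ?s \<and>
        (\<forall>u. u \<noteq> i \<longrightarrow> active (resid s') (height ?s) u \<longrightarrow>
          active (resid ?s) (height ?s) u \<or> Suc (height ?s u) = height ?s i) \<and>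
        \<not> (arc s' i < N \<and> 0 < exc s' i) \<and>
        t + 10 * scans (height s') (arc s') \<le> 10 * scans (height ?s) (arc ?s) + 11"
        and u: "unchanged Discharge ?s s'"
      have eq: "height ?s = height s" "arc ?s = arc s" by (auto simp: height_def arc_def)
      have fs: "flow_state s'" and v: "nvar s' ''v'' = i" and h: "height s' = height s"
        and act: "\<And>u. u \<noteq> i \<Longrightarrow> active (resid s') (height s) u \<Longrightarrow>
          active (resid s) (height s) u \<or> Suc (height s u) = height s i"
        and stop: "\<not> (arc s' i < N \<and> 0 < exc s' i)"
        and t: "t + 10 * scans (height s') (arc s') \<le> 10 * scans (height s) (arc s) + 11"
        using * unfolding eq by auto
      have flag: "nvar s' ''flag'' = 1" using u by (simp add: unchanged_def)
      have p: "preflow (resid s') (height s) (arc s')" and e: "exc s' i = excess (resid s') i"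
        using fs s(3) \<open>i \<noteq> src\<close> h by (auto simp: flow_state_def)
      show "wp ?R s' (\<lambda>s'' t'. ?Q s'' (Suc (1 + (t + t'))))"
      proof (cases "0 < exc s' i")
        case False
        then have "\<not> active (resid s') (height s) i" using e by (auto simp: active_def)
        from pass_inv_discharged[OF inv(1) True this act]
        have "pass_inv B D (Suc i) 1 (resid s') (height s')" by (simp add: h)
        with fs flag t False v show ?thesis by (simp add: exc_def)
      next
        case pos: True
        let ?s'' = "s'\<lparr>narr := upd2 (upd2 (narr s') ''d'' i 0 (Suc (height s i))) ''cur'' i 0 0\<rparr>"
        have "arc s' i = N" using stop pos p s(3) by (auto simp: preflow_def)
        have eqs: "height ?s'' = (height s)(i := Suc (height s i))" "arc ?s'' = (arc s')(i := 0)"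
          "resid ?s'' = resid s'" "exc ?s'' = exc s'" "nvar ?s'' = nvar s'"
          using h by (auto simp: height_def arc_def exc_def fun_eq_iff)
        have "preflow (resid s') ((height s)(i := Suc (height s i))) ((arc s')(i := 0))"
          using p s(3) \<open>i \<noteq> src\<close> \<open>i \<noteq> snk\<close> \<open>height s i < N\<close> \<open>arc s' i = N\<close> by (rule preflow_relabel)
        then have "flow_state ?s''" using fs unfolding flow_state_def eqs by auto
        moreover have "Suc (scans (height ?s'') (arc ?s'')) = scans (height s) (arc s')"
          unfolding eqs using s(3) \<open>height s i < N\<close> \<open>arc s' i = N\<close> by (rule scans_relabel)
        moreover have "pass_inv B D (Suc i) 1 (resid ?s'') (height ?s'')"
          unfolding eqs using inv(1) True act by (rule pass_inv_relabelled)
        ultimately have "?Q ?s'' (Suc (1 + (t + 3)))" using flag t h by simp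
        moreover have "narr s' ''d'' i 0 = height s i" using h by (metis height_def)
        ultimately show ?thesis using pos v by (simp add: exc_def numeral_3_eq_3)
      qed
    qed
    moreover have "bval ?b s" using b True by simp
    ultimately show ?thesis by (simp only: Process_def wp_Cond if_True wp_simps nval.simps)
  qed
qed

text \<open>The measure adds the cost of the passes still to come to the potential of the pointers.
  While \<open>flag\<close> is 1, one pass beyond \<open>passes\<close> is reserved for finding that
  nothing is active; when \<open>flag\<close> is 0, the invariant of the finished pass says just
  that.\<close>

lemma wp_Push_Relabel:
  assumes "flow_state s"
  shows "wp Push_Relabel s (\<lambda>s' t. flow_state s' \<and> (\<forall>v. \<not> active (resid s') (height s') v) \<and>
    t \<le> flow_time N)"
proof -
  let ?pot = "\<lambda>s. 10 * scans (height s) (arc s)"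
  let ?m = "\<lambda>s. ?pot s + (N * 18 + 5) * (if nvar s ''flag'' = 1 then passes (resid s)
    (height s) + 1 else 0)"
  let ?J = "\<lambda>s. flow_state s \<and> (nvar s ''flag'' = 1 \<or> nvar s ''flag'' = 0 \<and>
    (\<forall>v. \<not> active (resid s) (height s) v))"
  let ?b = "NEq (NVar ''flag'') (NConst 1)"
  let ?c = "Seq (NAssign ''flag'' (NConst 0)) (For ''v'' ''N'' Process)"
  let ?s = "setn ''flag'' 1 s"
  have setn_simps: "height (setn x k s) = height s" "arc (setn x k s) = arc s" "exc (setn x k s) = exc s"
    "x \<notin> {''N'', ''s'', ''t''} \<Longrightarrow> flow_state (setn x k s) \<longleftrightarrow> flow_state s" for x k s
    by (auto simp: height_def arc_def exc_def flow_state_def)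
  have "wp (While ?b ?c) ?s (\<lambda>s' t. ?J s' \<and> \<not> bval ?b s' \<and> t + ?m s' \<le> ?m ?s + 1)"
  proof (rule wp_While)
    fix s' assume J: "?J s'" and b: "bval ?b s'"
    let ?B = "level (resid s') (height s')" and ?D = "total (height s')"
    let ?Inv = "\<lambda>i s''. flow_state s'' \<and> pass_inv ?B ?D i (nvar s'' ''flag'') (resid s'') (height s'') \<and>
      nvar s'' ''flag'' \<in> {0, 1}"
    let ?s' = "setn ''flag'' 0 s'"
    have "wp (For ''v'' ''N'' Process) ?s' (\<lambda>s'' t. ?Inv N s'' \<and>
        t + ?pot s'' \<le> ?pot (setn ''v'' 0 ?s') + N * (16 + 2) + 2)"
    proof (rule wp_For_amortised[where Inv = ?Inv and \<phi> = ?pot])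
      show "?Inv 0 (setn ''v'' 0 ?s')"
        using J pass_inv_start[of "resid s'" "height s'"]
        by (auto simp: flow_state_def height_def arc_def exc_def)
    next
      fix i s'' assume i: "i < N" "nvar s'' ''v'' = i" and inv: "?Inv i s''"
      have "wp Process s'' (\<lambda>s3 t. flow_state s3 \<and>
        pass_inv ?B ?D (Suc i) (nvar s3 ''flag'') (resid s3) (height s3) \<and>
        nvar s3 ''flag'' \<in> {0, 1} \<and> t + ?pot s3 \<le> ?pot s'' + 16)"
        using inv i by (intro wp_Process) auto
      then show "wp Process s'' (\<lambda>s3 t. ?Inv (Suc i) (setn ''v'' (Suc i) s3) \<and>
        t + ?pot (setn ''v'' (Suc i) s3) \<le> ?pot s'' + 16)"
        by (rule wp_mono) (simp add: setn_simps)
    qed (use J in \<open>auto simp: flow_state_def\<close>)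
    then have "wp (For ''v'' ''N'' Process) ?s' (\<lambda>s'' t. ?J s'' \<and> 1 + t + 1 + ?m s'' \<le> ?m s')"
    proof (rule wp_mono)
      fix s'' t
      assume *: "?Inv N s'' \<and> t + ?pot s'' \<le> ?pot (setn ''v'' 0 ?s') + N * (16 + 2) + 2"
      then have t: "t + ?pot s'' \<le> ?pot s' + N * 18 + 2" by (simp add: height_def arc_def)
      show "?J s'' \<and> 1 + t + 1 + ?m s'' \<le> ?m s'"
      proof (cases "nvar s'' ''flag'' = 1")
        case True
        have "passes (resid s'') (height s'') < passes (resid s') (height s')"
          using * True by (intro passes_decrease[where cur' = "arc s''"]) (auto simp: flow_state_def)
        then have "(N * 18 + 5) * (passes (resid s'') (height s'') + 1) \<le> (N * 18 + 5) * passes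
          (resid s') (height s')"
          by (intro mult_le_mono) auto
        with t * True b show ?thesis by simp
      next
        case False
        then have "nvar s'' ''flag'' = 0" using * by auto
        moreover from this have "\<not> active (resid s'') (height s'') v" for v
          using * by (cases "v < N") (auto simp: pass_inv_def active_def)
        ultimately show ?thesis using t * b by simp
      qed
    qed
    then show "wp ?c s' (\<lambda>s'' t. ?J s'' \<and> t + 1 + ?m s'' \<le> ?m s')" by simp
  qed (use assms in \<open>simp add: setn_simps\<close>)
  then have "wp (While ?b ?c) ?s (\<lambda>s' t. flow_state s' \<and> (\<forall>v. \<not> active (resid s') (height s') v) \<and>
    1 + t \<le> flow_time N)"
  proof (rule wp_mono)
    fix s' t assume *: "?J s' \<and> \<not> bval ?b s' \<and> t + ?m s' \<le> ?m ?s + 1"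
    have "?m ?s \<le> 10 * (N * ((N + 1) * N + N)) + (N * 18 + 5) * (2 * (N * N) + N + 1)"
      using scans_le passes_le by (intro add_mono mult_le_mono) auto
    with * show "flow_state s' \<and> (\<forall>v. \<not> active (resid s') (height s') v) \<and> 1 + t \<le> flow_time N"
      by (auto simp: flow_time_def)
  qed
  then show ?thesis by (simp add: Push_Relabel_def)
qed

end

section \<open>Building the network and reading off the cut\<close>

text \<open>The arrays of the machine agree with \<open>r0\<close> and the initial heights only
  below \<open>N\<close>; their other entries are arbitrary.\<close>

lemma (in flow_network) preflow_cong:
  assumes p: "preflow r d cur" and r: "\<And>u v. u < N \<Longrightarrow> v < N \<Longrightarrow> r' u v = r u v"
    and d: "\<And>v. v < N \<Longrightarrow> d' v = d v" and cur: "\<And>v. v < N \<Longrightarrow> cur' v = cur v"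
  shows "preflow r' d' cur'" and "v < N \<Longrightarrow> excess r' v = excess r v"
proof -
  have ex: "excess r' v = excess r v" if "v < N" for v
    unfolding excess_def using r that by (intro sum.cong) auto
  then show "v < N \<Longrightarrow> excess r' v = excess r v" .
  show "preflow r' d' cur'"
  proof (rule preflowI)
    fix u v assume *: "v < N" "u < cur' v" "0 < r' v u"
    then have "u < cur v" "u < N" using cur preflowD(8)[OF p, of v] by auto
    with * show "d' v \<le> d' u" using preflowD(9)[OF p, of v u] r d by auto
  qed (use ex preflowD[OF p] src snk r d cur in auto)
qed

lemma wp_FillR2:
  assumes n: "nvar s y = n" and names: "i \<noteq> j" "i \<noteq> y" "j \<noteq> y" "i \<notin> nw c" "j \<notin> nw c" "y \<notin> nw c"
    and c: "\<And>p q s'. p < n \<Longrightarrow> q < n \<Longrightarrow> nvar s' i = p \<Longrightarrow> nvar s' j = q \<Longrightarrow> nvar s' y = n \<Longrightarrow>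
      unchanged (For i y (For j y c)) s s' \<Longrightarrow>
      wp c s' (\<lambda>s'' t. rarr s'' a = (rarr s' a)(p := (rarr s' a p)(q := F p q)) \<and> t \<le> k)"
  shows "wp (For i y (For j y c)) s (\<lambda>s' t. (\<forall>p<n. \<forall>q<n. rarr s' a p q = F p q) \<and>
    t \<le> n * (n * (k + 2) + 4) + 2)"
proof -
  let ?Inv = "\<lambda>p q (s' :: store). \<forall>p'<n. \<forall>q'<n. p' < p \<or> p' = p \<and> q' < q \<longrightarrow> rarr s' a p' q' = F p' q'"
  have "wp (For i y (For j y c)) s (\<lambda>s' t. ?Inv n 0 s' \<and> t \<le> n * ((n * (k + 2) + 2) + 2) + 2)"
  proof (rule wp_For[where Inv = "\<lambda>p. ?Inv p 0"])
    fix p s' assume p: "p < n" "nvar s' i = p" "nvar s' y = n" and inv: "?Inv p 0 s'"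
      and u: "unchanged (For i y (For j y c)) s s'"
    have "wp (For j y c) s' (\<lambda>s'' t. (nvar s'' i = p \<and> ?Inv p n s'') \<and> t \<le> n * (k + 2) + 2)"
    proof (rule wp_For[where Inv = "\<lambda>q s''. nvar s'' i = p \<and> ?Inv p q s''"])
      fix q s'' assume q: "q < n" "nvar s'' j = q" "nvar s'' y = n"
        and inv': "nvar s'' i = p \<and> ?Inv p q s''" and u': "unchanged (For j y c) s' s''"
      have "wp c s'' (\<lambda>s3 t. rarr s3 a = (rarr s'' a)(p := (rarr s'' a p)(q := F p q)) \<and> t \<le> k)"
        using u u' p q inv' by (intro c) (auto simp: unchanged_def)
      then show "wp c s'' (\<lambda>s3 t.
          (nvar (setn j (Suc q) s3) i = p \<and> ?Inv p (Suc q) (setn j (Suc q) s3)) \<and> t \<le> k)"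
        by (rule wp_mono) (use inv' names in \<open>auto simp: unchanged_def less_Suc_eq\<close>)
    qed (use p inv names in auto)
    then show "wp (For j y c) s' (\<lambda>s'' t. ?Inv (Suc p) 0 (setn i (Suc p) s'') \<and> t \<le> n * (k + 2) + 2)"
      by (rule wp_mono) (auto simp: less_Suc_eq)
  qed (use n names in auto)
  then show ?thesis by (rule wp_mono) (auto simp: algebra_simps)
qed

text \<open>Doubling and halving are no machine operations, so the tables between nodes and their
  two vertices are built by counting. In the end \<open>N\<close> is \<open>2 * m\<close> with
  \<open>m = n + 2\<close>; hence \<open>N - 4\<close> is the entry of \<open>Xm\<close> and
  \<open>N - 1\<close> the exit of \<open>Ym\<close>.\<close>

definition Split :: com where
  "Split = Seq (NAssign ''N'' (NConst 0)) (Seq (For ''i'' ''m''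
     (Seq (NStore ''base'' (NVar ''N'') (NConst 0) (NVar ''i''))
     (Seq (NStore ''side'' (NVar ''N'') (NConst 0) (NConst 0))
     (Seq (NStore ''left'' (NVar ''i'') (NConst 0) (NVar ''N''))
     (Seq (NAssign ''N'' (NSuc (NVar ''N'')))
     (Seq (NStore ''base'' (NVar ''N'') (NConst 0) (NVar ''i''))
     (Seq (NStore ''side'' (NVar ''N'') (NConst 0) (NConst 1))
     (Seq (NStore ''right'' (NVar ''i'') (NConst 0) (NVar ''N''))
       (NAssign ''N'' (NSuc (NVar ''N'')))))))))))
     (Seq (NAssign ''s'' (NPred (NPred (NPred (NPred (NVar ''N''))))))
       (NAssign ''t'' (NPred (NVar ''N'')))))"

definition Big :: com where
  "Big = Seq (RAssign ''M'' ROne)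
     (For ''i'' ''m'' (RAssign ''M'' (RAdd (RVar ''M'') (RArr ''cost'' (NVar ''i'') (NConst 0)))))"

abbreviation Base :: "name \<Rightarrow> nexp" where "Base x \<equiv> NArr ''base'' (NVar x) (NConst 0)"
abbreviation Side :: "name \<Rightarrow> nexp" where "Side x \<equiv> NArr ''side'' (NVar x) (NConst 0)"

definition Capacity :: com where
  "Capacity =
    Cond (BAnd (BAnd (NEq (Side ''i'') (NConst 0)) (NEq (Side ''j'') (NConst 1)))
        (BAnd (NEq (Base ''i'') (Base ''j'')) (tst ''node'' (Base ''i'') (NConst 0))))
      (Cond (tst ''inf'' (Base ''i'') (NConst 0))
        (RStore ''r'' (NVar ''i'') (NVar ''j'') (RVar ''M''))
        (RStore ''r'' (NVar ''i'') (NVar ''j'') (RArr ''cost'' (Base ''i'') (NConst 0))))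
      (Cond (BAnd (BAnd (NEq (Side ''i'') (NConst 1)) (NEq (Side ''j'') (NConst 0)))
          (tst ''edge'' (Base ''i'') (Base ''j'')))
        (RStore ''r'' (NVar ''i'') (NVar ''j'') (RVar ''M''))
        (RStore ''r'' (NVar ''i'') (NVar ''j'') RZero))"

definition Capacities :: com where
  "Capacities = For ''i'' ''N'' (For ''j'' ''N'' Capacity)"

text \<open>One sweep turns the capacities in \<open>r\<close> into \<open>r0\<close>, moving the
  capacity from the source to \<open>v\<close> over to the reverse arc. The excess of
  \<open>v\<close> is read off before the arc is cleared.\<close>

definition Init :: com where
  "Init = Seq (For ''v'' ''N'' (Seq (NStore ''d'' (NVar ''v'') (NConst 0) (NConst 0))
       (NStore ''cur'' (NVar ''v'') (NConst 0) (NConst 0))))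
    (Seq (NStore ''d'' (NVar ''s'') (NConst 0) (NVar ''N''))
    (For ''v'' ''N'' (Seq (RStore ''r'' (NVar ''v'') (NVar ''s'')
         (RAdd (RArr ''r'' (NVar ''v'') (NVar ''s'')) (RArr ''r'' (NVar ''s'') (NVar ''v''))))
       (Seq (RStore ''e'' (NVar ''v'') (NConst 0) (RArr ''r'' (NVar ''s'') (NVar ''v'')))
         (RStore ''r'' (NVar ''s'') (NVar ''v'') RZero)))))"

definition Gap :: com where
  "Gap = For ''k'' ''N'' (Seq (Exists ''x'' ''j'' ''N'' (NEq (NArr ''d'' (NVar ''j'') (NConst 0))
    (NVar ''k'')))
     (Cond (NEq (NVar ''x'') (NConst 0)) (NAssign ''gap'' (NVar ''k'')) Skip))"

text \<open>On termination of \<open>Push_Relabel\<close>, the sink has collected less than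
  \<open>big\<close> exactly when a vertex cut of finite cost exists.\<close>

definition Found :: com where
  "Found = Cond (RLess (RArr ''e'' (NVar ''t'') (NConst 0)) (RVar ''M''))
     (NAssign ''found'' (NConst 1)) (NAssign ''found'' (NConst 0))"

abbreviation output_test :: bexp where
  "output_test \<equiv> BOr (mem ''I'' ''i'') (BAnd (mem ''node'' ''i'') (BAnd (NLess (NVar
     ''gap'') (NArr ''d'' (NArr ''left'' (NVar ''i'') (NConst 0)) (NConst 0))) (NLess (NArr ''d''
     (NArr ''right'' (NVar ''i'') (NConst 0)) (NConst 0)) (NVar ''gap''))))"

text \<open>Entry above the gap and exit below it: the splitting arc of the node crosses the gap
  cut.\<close>

definition Output :: com where
  "Output = Fill1 ''i'' ''n'' ''Z'' (SetIf ''x'' output_test) (NVar ''x'')"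

definition Step5 :: com where
  "Step5 = Seq Split (Seq Big (Seq Capacities (Seq Init (Seq Push_Relabel (Seq Gap (Seq Found Output))))))"

lemma writes_Split [simp]: "nw Split = {''N'', ''i'', ''s'', ''t''}"
  "aw Split = {''base'', ''side'', ''left'', ''right''}"
  "rw Split = {}" "raw Split = {}"
  by (auto simp: Split_def)

lemma writes_Big [simp]: "nw Big = {''i''}" "aw Big = {}" "rw Big = {''M''}" "raw Big = {}"
  by (auto simp: Big_def)

lemma writes_Capacities [simp]: "nw Capacities = {''i'', ''j''}" "aw Capacities = {}" "rw Capacities = {}"
  "raw Capacities = {''r''}"
  by (auto simp: Capacities_def Capacity_def)

lemma writes_Init [simp]: "nw Init = {''v''}" "aw Init = {''d'', ''cur''}" "rw Init = {}"
  "raw Init = {''r'', ''e''}"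
  by (auto simp: Init_def)

lemma writes_Gap [simp]: "nw Gap = {''k'', ''x'', ''j'', ''gap''}" "aw Gap = {}" "rw Gap = {}"
  "raw Gap = {}"
  by (auto simp: Gap_def)

lemma writes_Found [simp]: "nw Found = {''found''}" "aw Found = {}" "rw Found = {}" "raw Found = {}"
  by (auto simp: Found_def)

context encoded_problem
begin

lemma us_nodes: "set us = Node ` nodes G \<union> {Xm, Ym}"
  using vs by (auto simp: ext_list_def)

definition sink :: nat where "sink = Suc n"

sublocale net: cut_network us cut_graph cost n sink m
proof unfold_locales
  show "m \<equiv> length us" by simp
  show "distinct us" using vs by (auto simp: ext_list_def distinct_map inj_on_def)
  show "unodes cut_graph \<subseteq> set us" using A_simps(1) by (auto simp: us_nodes unodes_cut_graph)
  show "uedges cut_graph \<subseteq> unodes cut_graph \<times> unodes cut_graph"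
    using uedges_H1 input_simps(4-6,9) A_simps(2,3) unfolding uedges_cut_graph unodes_cut_graph by blast
  show "n < length us" "sink < length us" by (auto simp: m_def sink_def)
  show "us ! n \<in> unodes cut_graph" "us ! sink \<in> unodes cut_graph" "us ! n \<noteq> us ! sink"
    by (auto simp: unodes_cut_graph sink_def)
  show "(us ! n, us ! sink) \<notin> uedges cut_graph" by (auto simp: uedges_cut_graph sink_def)
  show "cost (us ! n) = \<infinity>" "cost (us ! sink) = \<infinity>" by (auto simp: step3_def sink_def)
  show "0 \<le> cost x" if "x \<in> set us" for x
    using that input_simps(10) by (auto simp: us_nodes step3_def less_imp_le)
qed

definition env :: "store \<Rightarrow> bool" where
  "env s \<longleftrightarrow> inp s \<and> nvar s ''m'' = m \<and> holds_ugraph us cut_graph s \<and> holds_costs us cost s"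

lemma env_unchanged:
  assumes "env s" "unchanged c s s'" "nw c \<inter> {''n'', ''m''} = {}" "raw c \<inter> {''w'', ''cost''} = {}"
    "aw c \<inter> {''dir'', ''und'', ''bid'', ''X'', ''Y'', ''I'', ''R'', ''node'', ''edge'', ''inf''} = {}"
  shows "env s'"
proof -
  have "inp s'" using assms by (intro inp_unchanged[of s c s']) (auto simp: env_def)
  moreover have "narr s' a = narr s a" if "a \<in> {''node'', ''edge'', ''inf''}" for a
    using that assms(2,5) by (auto simp: unchanged_def)
  moreover have "rarr s' ''cost'' = rarr s ''cost''" "nvar s' ''m'' = nvar s ''m''"
    using assms(2-4) by (auto simp: unchanged_def)
  ultimately show ?thesis using assms(1)
    by (simp add: env_def holds_ugraph_def holds_costs_def holds_set_def holds_rel_def holds_reals_def)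
qed

lemma env_simps:
  assumes "env s"
  shows "nvar s ''m'' = m" "nvar s ''n'' = n"
    "\<And>i. i < m \<Longrightarrow> narr s ''node'' i 0 = of_bool (us ! i \<in> unodes cut_graph)"
    "\<And>i j. i < m \<Longrightarrow> j < m \<Longrightarrow> narr s ''edge'' i j = of_bool ((us ! i, us ! j) \<in> uedges cut_graph)"
    "\<And>i. i < m \<Longrightarrow> narr s ''inf'' i 0 = of_bool (cost (us ! i) = \<infinity>)"
    "\<And>i. i < m \<Longrightarrow> rarr s ''cost'' i 0 = real_of_ereal (cost (us ! i))"
    "\<And>i. i < n \<Longrightarrow> narr s ''I'' i 0 = of_bool (vs ! i \<in> I)"
  using assms by (auto simp: env_def inp_simps holds_ugraph_def holds_costs_def holds_set_def
      holds_rel_def holds_reals_def)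

definition split :: "store \<Rightarrow> bool" where
  "split s \<longleftrightarrow> nvar s ''N'' = 2 * m \<and> nvar s ''s'' = 2 * n \<and> nvar s ''t'' = Suc (2 * sink) \<and>
     (\<forall>p<2 * m. narr s ''base'' p 0 = p div 2 \<and> narr s ''side'' p 0 = p mod 2) \<and>
     (\<forall>i<m. narr s ''left'' i 0 = 2 * i \<and> narr s ''right'' i 0 = Suc (2 * i))"

lemma split_unchanged:
  assumes "split s" "unchanged c s s'" "nw c \<inter> {''N'', ''s'', ''t''} = {}"
    "aw c \<inter> {''base'', ''side'', ''left'', ''right''} = {}"
  shows "split s'"
proof -
  have "narr s' a = narr s a" if "a \<in> {''base'', ''side'', ''left'', ''right''}" for a
    using that assms(2,4) by (auto simp: unchanged_def)
  moreover have "nvar s' a = nvar s a" if "a \<in> {''N'', ''s'', ''t''}" for a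
    using that assms(2,3) by (auto simp: unchanged_def)
  ultimately show ?thesis using assms(1) by (simp add: split_def)
qed

lemma wp_Split:
  assumes "env s"
  shows "wp Split s (\<lambda>s' t. split s' \<and> t \<le> m * 10 + 5)"
proof -
  let ?c = "Seq (NStore ''base'' (NVar ''N'') (NConst 0) (NVar ''i''))
     (Seq (NStore ''side'' (NVar ''N'') (NConst 0) (NConst 0))
     (Seq (NStore ''left'' (NVar ''i'') (NConst 0) (NVar ''N''))
     (Seq (NAssign ''N'' (NSuc (NVar ''N'')))
     (Seq (NStore ''base'' (NVar ''N'') (NConst 0) (NVar ''i''))
     (Seq (NStore ''side'' (NVar ''N'') (NConst 0) (NConst 1))
     (Seq (NStore ''right'' (NVar ''i'') (NConst 0) (NVar ''N''))
       (NAssign ''N'' (NSuc (NVar ''N''))))))))) "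
  let ?Inv = "\<lambda>i (s :: store). nvar s ''N'' = 2 * i \<and>
     (\<forall>p<2 * i. narr s ''base'' p 0 = p div 2 \<and> narr s ''side'' p 0 = p mod 2) \<and>
     (\<forall>q<i. narr s ''left'' q 0 = 2 * q \<and> narr s ''right'' q 0 = Suc (2 * q))"
  have "wp (For ''i'' ''m'' ?c) (setn ''N'' 0 s) (\<lambda>s' t. ?Inv m s' \<and> t \<le> m * (8 + 2) + 2)"
  proof (rule wp_For[where Inv = ?Inv])
    fix i s' assume i: "i < m" "nvar s' ''i'' = i" and inv: "?Inv i s'"
    have less: "p < 2 * Suc i \<longleftrightarrow> p < 2 * i \<or> p = 2 * i \<or> p = Suc (2 * i)" for p :: nat by auto
    show "wp ?c s' (\<lambda>s'' t. ?Inv (Suc i) (setn ''i'' (Suc i) s'') \<and> t \<le> 8)"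
      using i(2) inv unfolding less by (simp add: less_Suc_eq)
  qed (use env_simps(1)[OF assms] in auto)
  then have "wp (For ''i'' ''m'' ?c) (setn ''N'' 0 s) (\<lambda>s' t.
      wp (Seq (NAssign ''s'' (NPred (NPred (NPred (NPred (NVar ''N''))))))
       (NAssign ''t'' (NPred (NVar ''N'')))) s' (\<lambda>s'' t'. split s'' \<and> 1 + (t + t') \<le> m * 10 + 5))"
    by (rule wp_mono) (auto simp: split_def m_def sink_def)
  then show ?thesis unfolding Split_def by simp
qed

lemma wp_Big:
  assumes "env s"
  shows "wp Big s (\<lambda>s' t. rvar s' ''M'' = net.big \<and> t \<le> m * 3 + 3)"
proof -
  let ?c = "RAssign ''M'' (RAdd (RVar ''M'') (RArr ''cost'' (NVar ''i'') (NConst 0)))"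
  let ?s = "s\<lparr>rvar := (rvar s)(''M'' := 1)\<rparr>"
  have "wp (For ''i'' ''m'' ?c) ?s (\<lambda>s' t. rvar s' ''M'' = 1 + (\<Sum>j<m. real_of_ereal (cost
    (us ! j))) \<and> t \<le> m * (1 + 2) + 2)"
  proof (rule wp_For[where Inv = "\<lambda>i s'. rvar s' ''M'' = 1 + (\<Sum>j<i. real_of_ereal (cost (us ! j)))"])
    fix i s' assume i: "i < m" "nvar s' ''i'' = i"
      "rvar s' ''M'' = 1 + (\<Sum>j<i. real_of_ereal (cost (us ! j)))"
      and u: "unchanged (For ''i'' ''m'' ?c) ?s s'"
    have "rarr s' ''cost'' i 0 = real_of_ereal (cost (us ! i))"
      using u env_simps(6)[OF assms i(1)] by (simp add: unchanged_def)
    then show "wp ?c s' (\<lambda>s'' t. rvar (setn ''i'' (Suc i) s'') ''M'' =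
        1 + (\<Sum>j<Suc i. real_of_ereal (cost (us ! j))) \<and> t \<le> 1)"
      using i by simp
  qed (use assms in \<open>auto simp: env_simps\<close>)
  then have "wp (For ''i'' ''m'' ?c) ?s (\<lambda>s' t. rvar s' ''M'' = net.big \<and> 1 + t \<le> m * 3 + 3)"
    by (rule wp_mono) (auto simp: net.big_def)
  then show ?thesis by (simp add: Big_def)
qed

lemma wp_Capacities:
  assumes "env s" "split s" "rvar s ''M'' = net.big"
  shows "wp Capacities s (\<lambda>s' t. (\<forall>p<2 * m. \<forall>q<2 * m. rarr s' ''r'' p q = net.cap p q) \<and>
    t \<le> 2 * m * (2 * m * 5 + 4) + 2)"
proof -
  have "wp Capacities s (\<lambda>s' t. (\<forall>p<2 * m. \<forall>q<2 * m. rarr s' ''r'' p q = net.cap p q) \<and>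
    t \<le> 2 * m * (2 * m * (3 + 2) + 4) + 2)"
    unfolding Capacities_def
  proof (rule wp_FillR2)
    fix p q s' assume pq: "p < 2 * m" "q < 2 * m" "nvar s' ''i'' = p" "nvar s' ''j'' = q"
      and u: "unchanged (For ''i'' ''N'' (For ''j'' ''N'' Capacity)) s s'"
    have e: "env s'" using assms(1) u by (rule env_unchanged) (auto simp: Capacity_def)
    have sp: "split s'" using assms(2) u by (rule split_unchanged) (auto simp: Capacity_def)
    have M: "rvar s' ''M'' = net.big" using assms(3) u by (simp add: unchanged_def Capacity_def)
    have div: "p div 2 < m" "q div 2 < m" using pq by auto
    have idx: "narr s' ''base'' p 0 = p div 2" "narr s' ''base'' q 0 = q div 2"
      "narr s' ''side'' p 0 = p mod 2" "narr s' ''side'' q 0 = q mod 2"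
      using sp pq by (auto simp: split_def)
    let ?b1 = "BAnd (BAnd (NEq (Side ''i'') (NConst 0)) (NEq (Side ''j'') (NConst 1)))
        (BAnd (NEq (Base ''i'') (Base ''j'')) (tst ''node'' (Base ''i'') (NConst 0)))"
      and ?b2 = "BAnd (BAnd (NEq (Side ''i'') (NConst 1)) (NEq (Side ''j'') (NConst 0)))
          (tst ''edge'' (Base ''i'') (Base ''j''))"
      and ?b3 = "tst ''inf'' (Base ''i'') (NConst 0)"
    have b1: "bval ?b1 s' \<longleftrightarrow> even p \<and> odd q \<and> p div 2 = q div 2 \<and> us ! (p div 2) \<in> unodes cut_graph"
      using pq(3,4) idx env_simps(3)[OF e div(1)] by (simp add: even_iff_mod_2_eq_zero odd_iff_mod_2_eq_one)
    have b2: "bval ?b2 s' \<longleftrightarrow> odd p \<and> even q \<and> (us ! (p div 2), us ! (q div 2)) \<in> uedges cut_graph"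
      using pq(3,4) idx env_simps(4)[OF e div] by (simp add: even_iff_mod_2_eq_zero odd_iff_mod_2_eq_one)
    have b3: "bval ?b3 s' \<longleftrightarrow> cost (us ! (p div 2)) = \<infinity>"
      using pq(3) idx env_simps(5)[OF e div(1)] by simp
    have c: "rval (RArr ''cost'' (Base ''i'') (NConst 0)) s' = real_of_ereal (cost (us ! (p div 2)))"
      using pq(3) idx env_simps(6)[OF e div(1)] by simp
    show "wp Capacity s' (\<lambda>s'' t. rarr s'' ''r'' = (rarr s' ''r'')(p :=
      (rarr s' ''r'' p)(q := net.cap p q)) \<and> t \<le> 3)"
      unfolding Capacity_def wp_Cond b1 b2 b3 wp_simps c net.cap_def
      using pq(3,4) M div by (cases "p div 2 = q div 2") simp_all
  qed (use assms in \<open>auto simp: split_def Capacity_def\<close>)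
  then show ?thesis by simp
qed

lemma wp_Init:
  assumes "env s" "split s" and cap: "\<forall>p<2 * m. \<forall>q<2 * m. rarr s ''r'' p q = net.cap p q"
  shows "wp Init s (\<lambda>s' t. net.flow_state s' \<and> t \<le> 2 * m * 9 + 5)"
proof -
  let ?N = "2 * m" and ?s = "2 * n"
  let ?a = "Seq (NStore ''d'' (NVar ''v'') (NConst 0) (NConst 0))
       (NStore ''cur'' (NVar ''v'') (NConst 0) (NConst 0))"
  let ?A = "For ''v'' ''N'' ?a"
  let ?B = "NStore ''d'' (NVar ''s'') (NConst 0) (NVar ''N'')"
  let ?c = "Seq (RStore ''r'' (NVar ''v'') (NVar ''s'')
         (RAdd (RArr ''r'' (NVar ''v'') (NVar ''s'')) (RArr ''r'' (NVar ''s'') (NVar ''v''))))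
       (Seq (RStore ''e'' (NVar ''v'') (NConst 0) (RArr ''r'' (NVar ''s'') (NVar ''v'')))
         (RStore ''r'' (NVar ''s'') (NVar ''v'') RZero))"
  have sN: "?s < ?N" by (simp add: m_def)
  have "wp Init s (\<lambda>s' t. net.flow_state s' \<and> t \<le> (2 * m * 4 + 2) + (1 + (2 * m * 5 + 2)))"
    unfolding Init_def
  proof (rule wp_Seq)
    show "wp ?A s (\<lambda>s' t. (\<forall>v<?N. narr s' ''d'' v 0 = 0 \<and> narr s' ''cur'' v 0 = 0) \<and> t \<le> 2 * m * 4 + 2)"
    proof -
      have "wp ?A s (\<lambda>s' t. (\<forall>v<?N. narr s' ''d'' v 0 = 0 \<and> narr s' ''cur'' v 0 = 0) \<and>
        t \<le> 2 * m * (2 + 2) + 2)"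
        by (rule wp_For[where Inv = "\<lambda>i s'. \<forall>v<i. narr s' ''d'' v 0 = 0 \<and> narr s' ''cur'' v 0 = 0"])
          (use assms in \<open>auto simp: split_def less_Suc_eq\<close>)
      then show ?thesis by simp
    qed
    fix s1 assume z: "\<forall>v<?N. narr s1 ''d'' v 0 = 0 \<and> narr s1 ''cur'' v 0 = 0" and u: "unchanged ?A s s1"
    have sp1: "split s1" using assms(2) u by (rule split_unchanged) auto
    have r1: "rarr s1 ''r'' = rarr s ''r''" using u by (simp add: unchanged_def)
    let ?D = "\<lambda>s'. \<forall>v<?N. narr s' ''d'' v 0 = (if v = ?s then ?N else 0) \<and> narr s' ''cur'' v 0 = 0"
    show "wp (Seq ?B (For ''v'' ''N'' ?c)) s1 (\<lambda>s' t. net.flow_state s' \<and> t \<le> 1 + (2 * m * 5 + 2))"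
    proof (rule wp_Seq[where Q = "\<lambda>s'. split s' \<and> rarr s' ''r'' = rarr s ''r'' \<and> ?D s'"])
      show "wp ?B s1 (\<lambda>s' t. (split s' \<and> rarr s' ''r'' = rarr s ''r'' \<and> ?D s') \<and> t \<le> 1)"
        using z sp1 r1 by (auto simp: split_def)
      fix s2 assume s2: "split s2 \<and> rarr s2 ''r'' = rarr s ''r'' \<and> ?D s2"
      \<comment> \<open>Row and column of the source are converted up to \<open>i\<close>;
        everything else still holds capacities.\<close>
      let ?Inv = "\<lambda>i s'. (\<forall>u<?N. \<forall>v<?N. rarr s' ''r'' u v =
          (if u = ?s then if v < i then 0 else net.cap u v
           else if v = ?s \<and> u < i then net.cap u ?s + net.cap ?s u else net.cap u v)) \<and>
        (\<forall>v<i. rarr s' ''e'' v 0 = net.cap ?s v)"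
      have "wp (For ''v'' ''N'' ?c) s2 (\<lambda>s' t. ?Inv ?N s' \<and> t \<le> 2 * m * (3 + 2) + 2)"
      proof (rule wp_For[where Inv = ?Inv])
        show "?Inv 0 (setn ''v'' 0 s2)" using s2 cap by simp
        fix i s' assume i: "i < ?N" "nvar s' ''v'' = i" and inv: "?Inv i s'"
          and u': "unchanged (For ''v'' ''N'' ?c) s2 s'"
        have vs: "nvar s' ''s'' = ?s" using s2 u' by (simp add: unchanged_def split_def)
        have 1: "rarr s' ''r'' ?s i = net.cap ?s i" using inv sN i by auto
        have 2: "rarr s' ''r'' i ?s = net.cap i ?s" using inv sN i by auto
        show "wp ?c s' (\<lambda>s'' t. ?Inv (Suc i) (setn ''v'' (Suc i) s'') \<and> t \<le> 3)"
        proof (cases "i = ?s")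
          case True
          \<comment> \<open>When \<open>v\<close> is the source, the row entry and the column entry
            coincide; the sum written first and the final zero agree because the source has no
            loop.\<close>
          have "net.cap ?s ?s = 0" by (rule net.cap_src)
          then show ?thesis using i vs 1 2 inv True by (simp add: less_Suc_eq)
        next
          case False
          then show ?thesis using i vs 1 2 inv by (auto simp: less_Suc_eq)
        qed
      qed (use s2 in \<open>auto simp: split_def\<close>)
      then show "wp (For ''v'' ''N'' ?c) s2 (\<lambda>s' t. net.flow_state s' \<and> t \<le> 2 * m * 5 + 2)"
      proof (rule wp_mono)
        fix s' t assume *: "?Inv ?N s' \<and> t \<le> 2 * m * (3 + 2) + 2" and u':
          "unchanged (For ''v'' ''N'' ?c) s2 s'"
        have sp: "split s'" using conjunct1[OF s2] u' by (rule split_unchanged) auto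
        have D: "?D s'" using s2 u' by (simp add: unchanged_def)
        have r: "rarr s' ''r'' u v = net.r0 u v" if "u < ?N" "v < ?N" for u v
          using * that by (auto simp: net.r0_def)
        note pf = net.preflow_cong[OF net.preflow_init r, of "height s'" "arc s'"]
        have "net.preflow (resid s') (height s') (arc s')"
          using D by (intro pf(1)) (auto simp: height_def arc_def)
        moreover have "exc s' v = net.excess (resid s') v" if "v < ?N" "v \<noteq> ?s" for v
          using * that D pf(2)[of v] net.excess_r0[of v] by (auto simp: exc_def height_def arc_def)
        ultimately show "net.flow_state s' \<and> t \<le> 2 * m * 5 + 2"
          using sp * by (auto simp: net.flow_state_def split_def)
      qed
    qed
  qed
  then show ?thesis by (rule wp_mono) auto
qed

lemma wp_Gap:
  assumes s: "net.flow_state s"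
  shows "wp Gap s (\<lambda>s' t. (nvar s' ''gap'' < 2 * m \<and> (\<forall>v<2 * m. height s v \<noteq> nvar s' ''gap'')) \<and>
    t \<le> 2 * m * (2 * m * 4 + 7) + 2)"
proof -
  let ?g = "\<lambda>k. k < 2 * m \<and> (\<forall>v<2 * m. height s v \<noteq> k)"
  let ?b = "NEq (NArr ''d'' (NVar ''j'') (NConst 0)) (NVar ''k'')"
  let ?c = "Seq (Exists ''x'' ''j'' ''N'' ?b) (Cond (NEq (NVar ''x'') (NConst 0)) (NAssign ''gap''
    (NVar ''k'')) Skip)"
  \<comment> \<open>An implication, because the variable has arbitrary contents until a gap is
    found. \<open>gap_exists\<close> discharges its premise after the loop.\<close>
  let ?Inv = "\<lambda>k s'. (\<exists>k'<k. ?g k') \<longrightarrow> ?g (nvar s' ''gap'')"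
  have "wp Gap s (\<lambda>s' t. ?Inv (2 * m) s' \<and> t \<le> 2 * m * (((2 * m * 4 + 3) + 2) + 2) + 2)"
    unfolding Gap_def
  proof (rule wp_For[where Inv = ?Inv])
    fix k s' assume k: "k < 2 * m" "nvar s' ''k'' = k" "nvar s' ''N'' = 2 * m" and inv: "?Inv k s'"
      and u: "unchanged (For ''k'' ''N'' ?c) s s'"
    have "wp ?c s' (\<lambda>s'' t. ?Inv (Suc k) s'' \<and> t \<le> (2 * m * 4 + 3) + 2)"
    proof (rule wp_Seq)
      show "wp (Exists ''x'' ''j'' ''N'' ?b) s' (\<lambda>s'' t. nvar s'' ''x'' = of_bool
        (\<exists>v<2 * m. height s v = k) \<and> t \<le> 2 * m * 4 + 3)"
        by (rule wp_Exists) (use u k in \<open>auto simp: unchanged_def height_def\<close>)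
      fix s'' assume x: "nvar s'' ''x'' = of_bool (\<exists>v<2 * m. height s v = k)"
        and u': "unchanged (Exists ''x'' ''j'' ''N'' ?b) s' s''"
      have "nvar s'' ''k'' = k" "nvar s'' ''gap'' = nvar s' ''gap''" using u' k by (auto simp:
        unchanged_def)
      then show "wp (Cond (NEq (NVar ''x'') (NConst 0)) (NAssign ''gap'' (NVar ''k'')) Skip) s''
          (\<lambda>s'' t. ?Inv (Suc k) s'' \<and> t \<le> 2)"
        using x inv k(1) by (auto simp: less_Suc_eq)
    qed
    then show "wp ?c s' (\<lambda>s'' t. ?Inv (Suc k) (setn ''k'' (Suc k) s'') \<and> t \<le> (2 * m * 4 + 3) + 2)" by simp
  qed (use s in \<open>auto simp: net.flow_state_def\<close>)
  moreover have "\<exists>k<2 * m. ?g k"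
    using s net.gap_exists[of "resid s" "height s" "arc s"] by (auto simp: net.flow_state_def)
  ultimately show ?thesis by (elim wp_mono) (auto simp: numeral_eq_Suc)
qed

lemma wp_Found:
  "wp Found s (\<lambda>s' t. nvar s' ''found'' = of_bool (rarr s ''e'' (nvar s ''t'') 0 < rvar s ''M'') \<and> t \<le> 2)"
  by (simp add: Found_def)

lemma wp_Output:
  assumes "env s" "split s"
  shows "wp Output s (\<lambda>s' t. holds_set vs ''Z'' ({v. Node v \<in> (!) us ` {i. i < m \<and>
    us ! i \<in> unodes cut_graph \<and>
      nvar s ''gap'' < height s (2 * i) \<and> height s (Suc (2 * i)) < nvar s ''gap''}} \<union> I) s' \<and>
        t \<le> n * 5 + 2)"
proof -
  let ?J = "{i. i < m \<and> us ! i \<in> unodes cut_graph \<and>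
      nvar s ''gap'' < height s (2 * i) \<and> height s (Suc (2 * i)) < nvar s ''gap''}"
  have "wp Output s (\<lambda>s' t. (\<forall>p<n. narr s' ''Z'' p 0 = of_bool (vs ! p \<in> {v. Node v \<in>
    (!) us ` ?J} \<union> I)) \<and> t \<le> n * (2 + 3) + 2)"
    unfolding Output_def
  proof (rule wp_Fill1)
    fix p s' assume p: "p < n" "nvar s' ''i'' = p"
      and u: "unchanged (Fill1 ''i'' ''n'' ''Z'' (SetIf ''x'' output_test) (NVar ''x'')) s s'"
    have e: "env s'" using assms(1) u by (rule env_unchanged) auto
    have sp: "split s'" using assms(2) u by (rule split_unchanged) auto
    have pm: "p < m" using p by (simp add: m_def)
    have "Node (vs ! p) \<in> (!) us ` ?J \<longleftrightarrow> p \<in> ?J"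
    proof
      assume "Node (vs ! p) \<in> (!) us ` ?J"
      then obtain i where i: "i \<in> ?J" "Node (vs ! p) = us ! i" by blast
      have "us ! i = us ! p" using i(2) us_simps(2)[OF p(1)] by (rule trans[OF sym sym])
      moreover have "i < length us" "p < length us" using i(1) pm unfolding us_simps(1) by blast+
      ultimately have "i = p" using nth_eq_iff_index_eq[OF net.distinct, of i p] by blast
      show "p \<in> ?J" using i(1) unfolding \<open>i = p\<close> .
    next
      assume "p \<in> ?J"
      then have "us ! p \<in> (!) us ` ?J" by (rule imageI)
      then show "Node (vs ! p) \<in> (!) us ` ?J" unfolding us_simps(2)[OF p(1)] .
    qed
    moreover have "narr s' ''left'' p 0 = 2 * p" "narr s' ''right'' p 0 = Suc (2 * p)"
      using sp pm by (simp_all add: split_def)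
    moreover have "nvar s' ''gap'' = nvar s ''gap''" "narr s' ''d'' = narr s ''d''"
      using u by (simp_all add: unchanged_def)
    ultimately have "bval output_test s' \<longleftrightarrow> vs ! p \<in> {v. Node v \<in> (!) us ` ?J} \<union> I"
      using p(2) pm env_simps(3)[OF e pm] env_simps(7)[OF e p(1)] by (simp add: height_def)
    then show "wp (SetIf ''x'' output_test) s' (\<lambda>s'' t. nval (NVar ''x'') s'' =
        of_bool (vs ! p \<in> {v. Node v \<in> (!) us ` ?J} \<union> I) \<and> t \<le> 2)" by simp
  qed (use assms in \<open>auto simp: env_simps\<close>)
  then show ?thesis by (rule wp_mono) (auto simp: holds_set_def n_def)
qed

end

section \<open>The whole run and its cubic bound\<close>

definition time5 :: "nat \<Rightarrow> nat" where
  "time5 m = (m * 10 + 5) + ((m * 3 + 3) + ((2 * m * (2 * m * 5 + 4) + 2) + ((2 * m * 9 + 5) +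
     (flow_time (2 * m) + ((2 * m * (2 * m * 4 + 7) + 2) + (2 + (m * 5 + 2)))))))"

lemma (in encoded_problem) wp_Step5:
  assumes "env s"
  shows "wp Step5 s (\<lambda>s' t. (\<exists>res. find_min_cost_sep G X Y I R w res \<and> holds_result vs res s') \<and>
    t \<le> time5 m)"
proof -
  let ?M = "\<lambda>s. rvar s ''M'' = net.big"
  let ?P = "\<lambda>s. env s \<and> split s \<and> ?M s"
  let ?cap = "\<lambda>s. \<forall>p<2 * m. \<forall>q<2 * m. rarr s ''r'' p q = net.cap p q"
  let ?flow = "\<lambda>s. net.flow_state s \<and> (\<forall>v. \<not> net.active (resid s) (height s) v)"
  let ?gap = "\<lambda>s. nvar s ''gap'' < 2 * m \<and> (\<forall>v<2 * m. height s v \<noteq> nvar s ''gap'')"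
  let ?found = "\<lambda>s. nvar s ''found'' = of_bool (exc s (Suc (2 * sink)) < net.big)"
  let ?res = "\<lambda>s. \<exists>res. find_min_cost_sep G X Y I R w res \<and> holds_result vs res s"
  \<comment> \<open>The input, the tables and the value of \<open>big\<close> survive all stages
    after \<open>Big\<close>; this is checked on the names that a stage writes.\<close>
  have keep: "?P s'" if "?P s" "unchanged c s s'" "nw c \<inter> {''n'', ''m'', ''N'', ''s'', ''t''} = {}"
    "raw c \<inter> {''w'', ''cost''} = {}" "rw c \<inter> {''M''} = {}"
    "aw c \<inter> {''dir'', ''und'', ''bid'', ''X'', ''Y'', ''I'', ''R'', ''node'', ''edge'', ''inf'',
      ''base'', ''side'', ''left'', ''right''} = {}" for c s s'
    using that env_unchanged[of s c s'] split_unchanged[of s c s'] by (auto simp: unchanged_def)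
  have h1: "hoare env Split (m * 10 + 5) (\<lambda>s. env s \<and> split s)"
    by (rule hoareI[OF wp_Split]) (use env_unchanged[where c = Split, simplified] in blast)+
  have h2: "hoare (\<lambda>s. env s \<and> split s) Big (m * 3 + 3) ?P"
  proof (rule hoareI[where Q = ?M])
    show "wp Big s (\<lambda>s' t. ?M s' \<and> t \<le> m * 3 + 3)" if "env s \<and> split s" for s
      using that by (intro wp_Big) blast
    show "?P s'" if "env s \<and> split s" "unchanged Big s s'" "?M s'" for s s'
      using that env_unchanged[OF _ that(2)] split_unchanged[OF _ that(2)] by simp
  qed
  have frame: "hoare (\<lambda>s. ?P s \<and> B s) c k (\<lambda>s. ?P s \<and> Q s)"
    if "\<And>s. ?P s \<Longrightarrow> B s \<Longrightarrow> wp c s (\<lambda>s' t. Q s' \<and> t \<le> k)"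
      and disj: "nw c \<inter> {''n'', ''m'', ''N'', ''s'', ''t''} = {}" "raw c \<inter> {''w'', ''cost''} = {}"
        "rw c \<inter> {''M''} = {}"
      "aw c \<inter> {''dir'', ''und'', ''bid'', ''X'', ''Y'', ''I'', ''R'', ''node'', ''edge'', ''inf'',
        ''base'', ''side'', ''left'', ''right''} = {}" for B c k Q
  proof (rule hoareI[where Q = Q])
    show "wp c s (\<lambda>s' t. Q s' \<and> t \<le> k)" if "?P s \<and> B s" for s
      using that by (intro \<open>\<And>s. ?P s \<Longrightarrow> B s \<Longrightarrow> wp c s (\<lambda>s' t. Q s' \<and> t \<le> k)\<close>) blast+
    show "?P s' \<and> Q s'" if s: "?P s \<and> B s" "unchanged c s s'" "Q s'" for s s'
      using keep[OF conjunct1[OF s(1)] s(2) disj] s(3) by blast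
  qed
  have "hoare (\<lambda>s. ?P s \<and> True) Capacities (2 * m * (2 * m * 5 + 4) + 2) (\<lambda>s. ?P s \<and> ?cap s)"
    by (rule frame[OF wp_Capacities]) auto
  then have h3: "hoare ?P Capacities (2 * m * (2 * m * 5 + 4) + 2) (\<lambda>s. ?P s \<and> ?cap s)" by simp
  have h4: "hoare (\<lambda>s. ?P s \<and> ?cap s) Init (2 * m * 9 + 5) (\<lambda>s. ?P s \<and> net.flow_state s)"
    by (rule frame[OF wp_Init]) auto
  have h5: "hoare (\<lambda>s. ?P s \<and> net.flow_state s) Push_Relabel (flow_time (2 * m)) (\<lambda>s. ?P s \<and> ?flow s)"
    by (rule frame, rule wp_mono[OF net.wp_Push_Relabel]) auto
  have h6: "hoare (\<lambda>s. ?P s \<and> ?flow s) Gap (2 * m * (2 * m * 4 + 7) + 2) (\<lambda>s. ?P s \<and> ?flow s \<and> ?gap s)"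
    by (rule frame, rule wp_mono[OF wp_Gap])
      (auto simp: unchanged_def net.flow_state_def height_def arc_def exc_def)
  have h7: "hoare (\<lambda>s. ?P s \<and> ?flow s \<and> ?gap s) Found 2 (\<lambda>s. ?P s \<and> (?flow s \<and> ?gap s) \<and> ?found s)"
  proof (rule frame)
    fix s assume s: "?P s" "?flow s \<and> ?gap s"
    then have "rarr s ''e'' (nvar s ''t'') 0 = exc s (Suc (2 * sink))" by (simp add: split_def exc_def)
    with s show "wp Found s (\<lambda>s' t. ((?flow s' \<and> ?gap s') \<and> ?found s') \<and> t \<le> 2)"
      by (intro wp_mono[OF wp_Found]) (auto simp: unchanged_def net.flow_state_def height_def
        arc_def exc_def)
  qed auto
  have h8: "hoare (\<lambda>s. ?P s \<and> (?flow s \<and> ?gap s) \<and> ?found s) Output (m * 5 + 2) ?res"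
    unfolding hoare_def
  proof (intro allI impI)
    fix s assume s: "?P s \<and> (?flow s \<and> ?gap s) \<and> ?found s"
    then have pf: "net.preflow (resid s) (height s) (arc s)" and no:
      "\<And>v. \<not> net.active (resid s) (height s) v"
      and k: "nvar s ''gap'' < 2 * m" "\<And>v. v < 2 * m \<Longrightarrow> height s v \<noteq> nvar s ''gap''"
      and exc: "exc s (Suc (2 * sink)) = net.excess (resid s) (Suc (2 * sink))"
      and es: "env s" "split s" and fnd: "?found s"
      using net.snk net.src_snk by (auto simp: net.flow_state_def)
    let ?C = "(!) us ` {i. i < m \<and> us ! i \<in> unodes cut_graph \<and>
      nvar s ''gap'' < height s (2 * i) \<and> height s (Suc (2 * i)) < nvar s ''gap''}"
    have find: "find_min_cost_sep G X Y I R w res \<longleftrightarrow> (\<exists>C. min_vertex_cut cut_graph cost Xm Ym C \<and>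
        res = (if sum cost C < \<infinity> then Some ({v. Node v \<in> C} \<union> I) else None))" for res
      by (simp add: find_min_cost_sep_def cut_graph_def Let_def)
    have ends: "us ! n = Xm" "us ! sink = Ym" by (simp_all add: sink_def)
    from wp_Output[OF es] show "wp Output s (\<lambda>s' t. ?res s' \<and> t \<le> m * 5 + 2)"
    proof (rule wp_mono)
      fix s' t assume *: "holds_set vs ''Z'' ({v. Node v \<in> ?C} \<union> I) s' \<and> t \<le> n * 5 + 2"
        and u: "unchanged Output s s'"
      have fnd': "nvar s' ''found'' = nvar s ''found''" using u by (simp add: unchanged_def Output_def)
      \<comment> \<open>Below \<open>big\<close>, the gap yields a minimum cut of finite cost.
        Otherwise no finite cut exists, and a minimum cut of infinite cost justifies the answer
        \<open>None\<close>.\<close>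
      have "?res s'"
      proof (cases "net.excess (resid s) (Suc (2 * sink)) < net.big")
        case True
        note C = net.min_vertex_cut_if_gap[OF pf no k True, unfolded ends]
        show ?thesis
          using C * fnd fnd' True exc unfolding find holds_result_def
          by (intro exI[of _ "Some ({v. Node v \<in> ?C} \<union> I)"]) (auto intro!: exI[of _ ?C])
      next
        case False
        from net.no_finite_vertex_cut[OF pf False, unfolded ends] obtain C where
          "min_vertex_cut cut_graph cost Xm Ym C" "\<not> sum cost C < \<infinity>" by blast
        with fnd fnd' False exc show ?thesis unfolding find holds_result_def
          by (intro exI[of _ None]) auto
      qed
      with * show "?res s' \<and> t \<le> m * 5 + 2" by (auto simp: m_def)
    qed
  qed
  show ?thesis
    using hoare_Seq[OF h1 hoare_Seq[OF h2 hoare_Seq[OF h3 hoare_Seq[OF h4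
      hoare_Seq[OF h5 hoare_Seq[OF h6 hoare_Seq[OF h7 h8]]]]]]] assms
    by (simp add: hoare_def Step5_def time5_def)
qed

definition total_time :: "nat \<Rightarrow> nat" where
  "total_time n = time1 n + time2 (n + 2) + time3 (n + 2) + time4 (n + 2) + time5 (n + 2)"

text \<open>Degree three is reached by the closures and products of step 1 and by
  \<open>flow_time\<close>; all other terms have lower degree.\<close>

lemma total_time_bigo: "(\<lambda>n. real (total_time n)) \<in> O(\<lambda>n. real n ^ 3)"
  unfolding total_time_def time1_def time2_def time3_def time4_def time5_def flow_time_def
    of_nat_add of_nat_mult
    of_nat_numeral of_nat_1
  by real_asymp

lemma (in encoded_problem) runs_in_total_time:
  assumes "inp s"
  shows "runs_find_min_cost_sep Step1 Step2 Step3 Step4 Step5 vs G X Y I R w s (total_time n)"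
proof -
  obtain t1 s1 where 1: "exec Step1 s t1 s1" "inp s1" "holds_ugraph vs H1 s1" "t1 \<le> time1 n"
    using wp_Step1[OF assms] by (auto simp: wp_def)
  obtain t2 s2 where 2: "exec Step2 s1 t2 s2" "inp s2" "nvar s2 ''m'' = m"
    "holds_ugraph us (step2 X Y H1) s2" "t2 \<le> time2 m"
    using wp_Step2[OF 1(2,3)] by (auto simp: wp_def)
  obtain t3 s3 where 3: "exec Step3 s2 t3 s3" "inp s3" "holds_costs us cost s3" "t3 \<le> time3 m"
    using wp_Step3[OF 2(2,3)] by (auto simp: wp_def)
  \<comment> \<open>The specification of step 3 mentions only the costs; that the graph is still
    stored follows from the names it writes.\<close>
  have u3: "nvar s3 ''m'' = m" "holds_ugraph us (step2 X Y H1) s3"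
    using exec_unchanged[OF 3(1)] 2 by (auto simp:
      unchanged_def holds_ugraph_def holds_set_def holds_rel_def)
  obtain t4 s4 where 4: "exec Step4 s3 t4 s4" "inp s4" "holds_ugraph us cut_graph s4" "t4 \<le> time4 m"
    using wp_Step4[OF 3(2) u3] by (auto simp: wp_def)
  have u4: "nvar s4 ''m'' = m" "holds_costs us cost s4"
    using exec_unchanged[OF 4(1)] u3 3 by (auto simp:
      unchanged_def holds_costs_def holds_set_def holds_reals_def)
  have "env s4" using 4 u4 by (simp add: env_def)
  from wp_Step5[OF this] obtain t5 s5 res where 5: "exec Step5 s4 t5 s5" "find_min_cost_sep G X Y I R w res"
    "holds_result vs res s5" "t5 \<le> time5 m" by (auto simp: wp_def)
  have "t1 + t2 + t3 + t4 + t5 \<le> total_time n"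
    using 1 2 3 4 5 by (simp add: total_time_def m_def)
  with 1 2 3 u3 4 u4 5 show ?thesis
    unfolding runs_find_min_cost_sep_def Let_def step1_eq cut_graph_def by blast
qed

theorem proposition5:
  "(\<forall>(G :: 'v mgraph) X Y I R w res.
      sep_input G X Y I R w \<and> find_min_cost_sep G X Y I R w res \<longrightarrow>
      solves_min_cost_sep G X Y I R w res) \<and>
   (\<exists>P1 P2 P3 P4 P5. \<exists>T :: nat \<Rightarrow> nat.
      (\<lambda>n. real (T n)) \<in> O(\<lambda>n. real n ^ 3) \<and>
      (\<forall>(G :: 'v mgraph) X Y I R w vs s.
         sep_input G X Y I R w \<and> distinct vs \<and> set vs = nodes G \<and>
         holds_input vs G X Y I R w s \<longrightarrow>
         runs_find_min_cost_sep P1 P2 P3 P4 P5 vs G X Y I R w s (T (card (nodes G)))))"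
proof (intro conjI exI allI impI)
  have problem: "separation_problem G X Y I R w" if "sep_input G X Y I R w" for G :: "'v mgraph"
    and X Y I R w
    using that by unfold_locales (auto simp: sep_input_def)
  fix G :: "'v mgraph" and X Y I R w res
  assume "sep_input G X Y I R w \<and> find_min_cost_sep G X Y I R w res"
  then show "solves_min_cost_sep G X Y I R w res"
    using separation_problem.find_min_cost_sep_correct problem by blast
next
  show "(\<lambda>n. real (total_time n)) \<in> O(\<lambda>n. real n ^ 3)" by (rule total_time_bigo)
  fix G :: "'v mgraph" and X Y I R w vs s
  assume *: "sep_input G X Y I R w \<and> distinct vs \<and> set vs = nodes G \<and> holds_input vs G X Y I R w s"
  then interpret encoded_problem G X Y I R w vs "length vs"
    by unfold_locales (auto simp: sep_input_def)
  have "card (nodes G) = length vs" using * distinct_card by metis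
  then show "runs_find_min_cost_sep Step1 Step2 Step3 Step4 Step5 vs G X Y I R w s (total_time
    (card (nodes G)))"
    using runs_in_total_time[of s] * by (simp add: inp_def)
qed

end
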